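(* Let $(X,d_X)$ and $(Y,d_Y)$ be uniformly locally finite metric spaces. If the uniform Roe algebras $\mathrm{C}^*_u(X)$ and $\mathrm{C}^*_u(Y)$ are $^*$-isomorphic, then $X$ and $Y$ are bijectively coarsely equivalent.
   Context: A metric space $(X,d)$ is uniformly locally finite (u.l.f.) if $\sup_{x\in X}|B_r(x)|<\infty$ for every $r>0$, where $B_r(x)$ is the ball of radius $r$ about $x$. For an $X$-by-$X$ complex matrix $a=[a_{x,x'}]$, its propagation is $\sup\{d(x,x')\mid a_{x,x'}\neq 0\}$; finite propagation matrices with uniformly bounded entries define bounded operators on $\ell_2(X)$. The uniform Roe algebra $\mathrm{C}^*_u(X)$ is the norm closure in $\mathcal B(\ell_2(X))$ of the $^*$-algebra of finite propagation operators. A map $f\colon X\to Y$ is coarse if for every $r>0$ there is $s>0$ with $d_X(x,x')\le r\Rightarrow d_Y(f(x),f(x'))\le s$; maps $f,g\colon X\to Y$ are close if $\sup_x d_Y(f(x),g(x))<\infty$; $f$ is a coarse equivalence if there is a coarse $g\colon Y\to X$ with $f\circ g$ close to $\mathrm{Id}_Y$ and $g\circ f$ close to $\mathrm{Id}_X$. $X$ and $Y$ are bijectively coarsely equivalent if there is a bijective coarse equivalence $X\to Y$. *)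

theory Defs
  imports "HOL-Analysis.Analysis"
begin

text \<open>Metric spaces are given as a carrier set together with a distance
  function satisfying the library locale Metric_space.\<close>

definition ulf :: "'a set \<Rightarrow> ('a \<Rightarrow> 'a \<Rightarrow> real) \<Rightarrow> bool" where
  "ulf X d \<longleftrightarrow> (\<forall>r>0. \<exists>N::nat. \<forall>x\<in>X.
      finite {y\<in>X. d x y \<le> r} \<and> card {y\<in>X. d x y \<le> r} \<le> N)"

definition l2 :: "'a set \<Rightarrow> ('a \<Rightarrow> complex) set" where
  "l2 X = {f. (\<forall>x. x \<notin> X \<longrightarrow> f x = 0) \<and> (\<lambda>x. (cmod (f x))\<^sup>2) summable_on X}"

definition l2norm :: "'a set \<Rightarrow> ('a \<Rightarrow> complex) \<Rightarrow> real" where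
  "l2norm X f = sqrt (infsum (\<lambda>x. (cmod (f x))\<^sup>2) X)"

definition l2inner :: "'a set \<Rightarrow> ('a \<Rightarrow> complex) \<Rightarrow> ('a \<Rightarrow> complex) \<Rightarrow> complex" where
  "l2inner X f g = infsum (\<lambda>x. cnj (f x) * g x) X"

type_synonym 'a op = "('a \<Rightarrow> complex) \<Rightarrow> ('a \<Rightarrow> complex)"

text \<open>Bounded linear operators on l2(X); they are normalised to be 0 off l2(X)
  so that equality of operators is equality of functions.\<close>

definition bounded_op :: "'a set \<Rightarrow> 'a op \<Rightarrow> bool" where
  "bounded_op X T \<longleftrightarrow>
     (\<forall>f\<in>l2 X. T f \<in> l2 X) \<and>
     (\<forall>f. f \<notin> l2 X \<longrightarrow> T f = (\<lambda>_. 0)) \<and>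
     (\<forall>f\<in>l2 X. \<forall>g\<in>l2 X. T (\<lambda>x. f x + g x) = (\<lambda>x. T f x + T g x)) \<and>
     (\<forall>f\<in>l2 X. \<forall>c::complex. T (\<lambda>x. c * f x) = (\<lambda>x. c * T f x)) \<and>
     (\<exists>C. \<forall>f\<in>l2 X. l2norm X (T f) \<le> C * l2norm X f)"

definition opnorm :: "'a set \<Rightarrow> 'a op \<Rightarrow> real" where
  "opnorm X T = Sup {l2norm X (T f) | f. f \<in> l2 X \<and> l2norm X f \<le> 1}"

definition delta :: "'a \<Rightarrow> 'a \<Rightarrow> complex" where
  "delta y = (\<lambda>z. if z = y then 1 else 0)"

text \<open>Matrix entry a_{x,x'} = <delta_x, T delta_x'>.\<close>
definition entry :: "'a op \<Rightarrow> 'a \<Rightarrow> 'a \<Rightarrow> complex" where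
  "entry T x x' = T (delta x') x"

definition finite_propagation :: "'a set \<Rightarrow> ('a \<Rightarrow> 'a \<Rightarrow> real) \<Rightarrow> 'a op \<Rightarrow> bool" where
  "finite_propagation X d T \<longleftrightarrow>
     (\<exists>R. \<forall>x\<in>X. \<forall>x'\<in>X. entry T x x' \<noteq> 0 \<longrightarrow> d x x' \<le> R)"

definition op_add :: "'a op \<Rightarrow> 'a op \<Rightarrow> 'a op" where
  "op_add S T = (\<lambda>f x. S f x + T f x)"

definition op_diff :: "'a op \<Rightarrow> 'a op \<Rightarrow> 'a op" where
  "op_diff S T = (\<lambda>f x. S f x - T f x)"

definition op_scale :: "complex \<Rightarrow> 'a op \<Rightarrow> 'a op" where
  "op_scale c T = (\<lambda>f x. c * T f x)"

definition is_adjoint :: "'a set \<Rightarrow> 'a op \<Rightarrow> 'a op \<Rightarrow> bool" where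
  "is_adjoint X T S \<longleftrightarrow> bounded_op X S \<and>
     (\<forall>f\<in>l2 X. \<forall>g\<in>l2 X. l2inner X f (T g) = l2inner X (S f) g)"

definition adjoint :: "'a set \<Rightarrow> 'a op \<Rightarrow> 'a op" where
  "adjoint X T = (THE S. is_adjoint X T S)"

definition uniform_roe :: "'a set \<Rightarrow> ('a \<Rightarrow> 'a \<Rightarrow> real) \<Rightarrow> 'a op set" where
  "uniform_roe X d = {T. bounded_op X T \<and>
     (\<forall>e>0. \<exists>S. bounded_op X S \<and> finite_propagation X d S \<and> opnorm X (op_diff T S) < e)}"

definition star_iso :: "'a set \<Rightarrow> ('a \<Rightarrow> 'a \<Rightarrow> real) \<Rightarrow> 'b set \<Rightarrow> ('b \<Rightarrow> 'b \<Rightarrow> real)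
    \<Rightarrow> ('a op \<Rightarrow> 'b op) \<Rightarrow> bool" where
  "star_iso X dX Y dY \<Phi> \<longleftrightarrow>
     bij_betw \<Phi> (uniform_roe X dX) (uniform_roe Y dY) \<and>
     (\<forall>S\<in>uniform_roe X dX. \<forall>T\<in>uniform_roe X dX.
        \<Phi> (op_add S T) = op_add (\<Phi> S) (\<Phi> T) \<and> \<Phi> (S \<circ> T) = \<Phi> S \<circ> \<Phi> T) \<and>
     (\<forall>S\<in>uniform_roe X dX. \<forall>c. \<Phi> (op_scale c S) = op_scale c (\<Phi> S)) \<and>
     (\<forall>S\<in>uniform_roe X dX. \<Phi> (adjoint X S) = adjoint Y (\<Phi> S))"

definition coarse_map :: "'a set \<Rightarrow> ('a \<Rightarrow> 'a \<Rightarrow> real) \<Rightarrow> ('b \<Rightarrow> 'b \<Rightarrow> real) \<Rightarrow> ('a \<Rightarrow> 'b) \<Rightarrow> bool" where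
  "coarse_map X dX dY f \<longleftrightarrow>
     (\<forall>r>0. \<exists>s>0. \<forall>x\<in>X. \<forall>x'\<in>X. dX x x' \<le> r \<longrightarrow> dY (f x) (f x') \<le> s)"

definition close_maps :: "'a set \<Rightarrow> ('b \<Rightarrow> 'b \<Rightarrow> real) \<Rightarrow> ('a \<Rightarrow> 'b) \<Rightarrow> ('a \<Rightarrow> 'b) \<Rightarrow> bool" where
  "close_maps X dY f g \<longleftrightarrow> (\<exists>C. \<forall>x\<in>X. dY (f x) (g x) \<le> C)"

definition coarse_equivalence :: "'a set \<Rightarrow> ('a \<Rightarrow> 'a \<Rightarrow> real) \<Rightarrow> 'b set \<Rightarrow> ('b \<Rightarrow> 'b \<Rightarrow> real)
    \<Rightarrow> ('a \<Rightarrow> 'b) \<Rightarrow> bool" where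
  "coarse_equivalence X dX Y dY f \<longleftrightarrow>
     f \<in> X \<rightarrow> Y \<and> coarse_map X dX dY f \<and>
     (\<exists>g. g \<in> Y \<rightarrow> X \<and> coarse_map Y dY dX g \<and>
          close_maps Y dY (f \<circ> g) id \<and> close_maps X dX (g \<circ> f) id)"

definition bij_coarsely_equivalent :: "'a set \<Rightarrow> ('a \<Rightarrow> 'a \<Rightarrow> real) \<Rightarrow> 'b set \<Rightarrow> ('b \<Rightarrow> 'b \<Rightarrow> real) \<Rightarrow> bool" where
  "bij_coarsely_equivalent X dX Y dY \<longleftrightarrow>
     (\<exists>f. bij_betw f X Y \<and> coarse_equivalence X dX Y dY f)"

end

theory Submission
  imports Defs
begin

text \<open>
  Minimal projections of a uniform Roe algebra have rank one, so an isomorphism is implemented by a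
  unitary \<open>U\<close> with entries \<open>u y x\<close>. The projections \<open>U \<chi>\<^sub>A U\<^sup>*\<close> for subsets \<open>A\<close> of \<open>X\<close> all lie in
  the Roe algebra of \<open>Y\<close>, and a Baire category argument on the power set of \<open>X\<close> makes them
  quasi-local uniformly in \<open>A\<close>. Averaging the unitaries \<open>1 - 2 U \<chi>\<^sub>A U\<^sup>*\<close> over \<open>A\<close> then shows that
  every row of \<open>U\<close> has an entry of modulus at least some fixed \<open>\<delta>\<close>; by symmetry every column does,
  and a choice \<open>f\<close> of such entries is a coarse equivalence. For finite \<open>A\<close>, averaging
  \<open>U diag(s) U\<^sup>* W diag(s)\<close> over sign vectors \<open>s\<close>, where \<open>W\<close> maps the basis vector at \<open>x\<close> to the one
  at \<open>f x\<close>, recovers \<open>U\<close> up to an invertible diagonal factor. Hence \<open>U\<close> maps \<open>l2 A\<close> almost into the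
  \<open>l2\<close> space of a uniform neighbourhood of \<open>f ` A\<close>, which therefore has at least as many points as \<open>A\<close>.
  Hall's theorem in both directions and the Schroeder-Bernstein argument yield a bijection close
  to \<open>f\<close>.
\<close>

section \<open>Square-summable functions\<close>

text \<open>A single image \<open>U \<chi>\<^sub>A U\<^sup>*\<close> is within \<open>e\<close> of
  an operator of finite propagation, but that propagation may grow with \<open>A\<close>, while
  averaging over \<open>A\<close> needs one radius for all subsets. Quasi-locality is tested on
  finitely supported vectors, so its failure at a fixed radius is already decided on a finite part
  of \<open>X\<close>; the subsets that are good for a given radius therefore form a closed set in
  the product topology, as the category argument requires. A second obstacle is that large entries
  determine \<open>f\<close> only up to bounded error, so \<open>f\<close> need be neither injective
  nor surjective. Unit rows make it at most \<open>1 / \<delta>^2\<close> to one, which controls the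
  norm of \<open>W\<close>. The bijection has to come from counting dimensions: if the neighbourhood
  had fewer points than \<open>A\<close>, a non-zero combination of columns indexed by
  \<open>A\<close> would vanish on it, whereas averaging leaves at most half of its norm outside.
  The average isolates single columns because the product of two signs has mean 0 at distinct points
  and 1 at equal ones.\<close>

lemma l2_outside: "f \<in> l2 X \<Longrightarrow> x \<notin> X \<Longrightarrow> f x = 0"
  by (simp add: l2_def)

lemma l2_summable: "f \<in> l2 X \<Longrightarrow> (\<lambda>x. (cmod (f x))\<^sup>2) summable_on X"
  by (simp add: l2_def)

lemma l2norm_nonneg: "0 \<le> l2norm X f"
  by (simp add: l2norm_def infsum_nonneg)

lemma l2norm_square: "(l2norm X f)\<^sup>2 = infsum (\<lambda>x. (cmod (f x))\<^sup>2) X"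
  by (simp add: l2norm_def infsum_nonneg)

lemma L2_set_square: "(L2_set f A)\<^sup>2 = (\<Sum>x\<in>A. (f x)\<^sup>2)"
  by (simp add: L2_set_def sum_nonneg)

text \<open>Membership and norm bound are both read off finite subsets, where \<open>L2_set\<close>
  supplies Minkowski and Cauchy-Schwarz. The estimates for sums, restrictions, adjoints and
  neighbourhood sums all enter through this criterion.\<close>

lemma l2_via_finite:
  assumes "\<And>x. x \<notin> X \<Longrightarrow> f x = 0"
    and "\<And>F. finite F \<Longrightarrow> F \<subseteq> X \<Longrightarrow> L2_set (\<lambda>x. cmod (f x)) F \<le> c"
  shows l2_via_finite_mem: "f \<in> l2 X" and l2_via_finite_norm: "l2norm X f \<le> c"
proof -
  have c: "0 \<le> c" using assms(2)[of "{}"] by simp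
  have b: "(\<Sum>x\<in>F. (cmod (f x))\<^sup>2) \<le> c\<^sup>2" if "finite F" "F \<subseteq> X" for F
    using assms(2)[OF that] unfolding L2_set_def by (rule sqrt_le_D)
  have s: "(\<lambda>x. (cmod (f x))\<^sup>2) summable_on X"
    by (rule nonneg_bdd_above_summable_on) (auto intro!: bdd_aboveI2[where M="c\<^sup>2"] b)
  show "f \<in> l2 X" using s assms(1) by (simp add: l2_def)
  have "infsum (\<lambda>x. (cmod (f x))\<^sup>2) X \<le> c\<^sup>2"
    using s b by (rule infsum_le_finite_sums)
  then show "l2norm X f \<le> c"
    unfolding l2norm_def using c by (simp add: real_le_lsqrt)
qed

lemma L2_set_le_l2norm:
  assumes "f \<in> l2 X" "finite F" "F \<subseteq> X"
  shows "L2_set (\<lambda>x. cmod (f x)) F \<le> l2norm X f"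
  unfolding L2_set_def l2norm_def
  using finite_sum_le_infsum[OF l2_summable[OF assms(1)] assms(2,3)] by simp

lemma l2_zero [simp]: "(\<lambda>_. 0) \<in> l2 X"
  by (simp add: l2_def)

lemma l2norm_zero [simp]: "l2norm X (\<lambda>_. 0) = 0"
  by (simp add: l2norm_def)

lemma
  assumes "f \<in> l2 X" "g \<in> l2 X"
  shows l2_add: "(\<lambda>x. f x + g x) \<in> l2 X"
    and l2norm_triangle: "l2norm X (\<lambda>x. f x + g x) \<le> l2norm X f + l2norm X g"
proof -
  have "L2_set (\<lambda>x. cmod (f x + g x)) F \<le> l2norm X f + l2norm X g"
    if "finite F" "F \<subseteq> X" for F
  proof -
    have "L2_set (\<lambda>x. cmod (f x + g x)) F \<le> L2_set (\<lambda>x. cmod (f x) + cmod (g x)) F"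
      by (rule L2_set_mono) (auto simp: norm_triangle_ineq)
    also have "\<dots> \<le> L2_set (\<lambda>x. cmod (f x)) F + L2_set (\<lambda>x. cmod (g x)) F"
      by (rule L2_set_triangle_ineq)
    finally show ?thesis
      using L2_set_le_l2norm[OF assms(1) that] L2_set_le_l2norm[OF assms(2) that] by linarith
  qed
  then show "(\<lambda>x. f x + g x) \<in> l2 X"
    and "l2norm X (\<lambda>x. f x + g x) \<le> l2norm X f + l2norm X g"
    using assms by (auto intro!: l2_via_finite simp: l2_outside)
qed

lemma
  assumes "f \<in> l2 X"
  shows l2_scale: "(\<lambda>x. c * f x) \<in> l2 X"
    and l2norm_scale: "l2norm X (\<lambda>x. c * f x) = cmod c * l2norm X f"
  using assms
  by (auto simp: l2_def l2norm_def norm_mult power_mult_distrib infsum_cmult_right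
      real_sqrt_mult intro: summable_on_cmult_right)

lemma
  assumes "f \<in> l2 X" "g \<in> l2 X"
  shows l2_diff: "(\<lambda>x. f x - g x) \<in> l2 X"
    and l2norm_diff_le: "l2norm X (\<lambda>x. f x - g x) \<le> l2norm X f + l2norm X g"
  using l2_add[OF assms(1) l2_scale[OF assms(2), of "-1"]]
    l2norm_triangle[OF assms(1) l2_scale[OF assms(2), of "-1"]]
    l2norm_scale[OF assms(2), of "-1"] by auto

lemma l2_sum:
  assumes "finite F" "\<And>i. i \<in> F \<Longrightarrow> g i \<in> l2 X"
  shows "(\<lambda>x. \<Sum>i\<in>F. c i * g i x) \<in> l2 X"
  using assms
proof (induction F)
  case (insert i F)
  then show ?case
    using l2_add[OF l2_scale[of "g i" X "c i"]] by simp
qed simp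

lemma
  assumes "finite F" "F \<subseteq> X" "\<And>x. x \<notin> F \<Longrightarrow> f x = 0"
  shows l2_finite_support: "f \<in> l2 X"
    and l2norm_finite_support: "l2norm X f = L2_set (\<lambda>x. cmod (f x)) F"
proof -
  have h: "((\<lambda>x. (cmod (f x))\<^sup>2) has_sum (\<Sum>x\<in>F. (cmod (f x))\<^sup>2)) X"
    using has_sum_finite[OF assms(1), of "\<lambda>x. (cmod (f x))\<^sup>2"] assms
    by (subst has_sum_cong_neutral[where S=X and T=F and g="\<lambda>x. (cmod (f x))\<^sup>2"]) auto
  then show "f \<in> l2 X" using assms by (auto simp: l2_def summable_on_def)
  show "l2norm X f = L2_set (\<lambda>x. cmod (f x)) F"
    using infsumI[OF h] by (simp add: l2norm_def L2_set_def)
qed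

lemma delta_same [simp]: "delta a a = 1"
  by (simp add: delta_def)

lemma delta_l2 [simp]: "a \<in> X \<Longrightarrow> delta a \<in> l2 X"
  by (rule l2_finite_support[of "{a}"]) (auto simp: delta_def)

lemma l2norm_delta [simp]: "a \<in> X \<Longrightarrow> l2norm X (delta a) = 1"
  by (subst l2norm_finite_support[of "{a}"]) (auto simp: delta_def)

lemma norm_le_l2norm:
  assumes "f \<in> l2 X"
  shows "cmod (f x) \<le> l2norm X f"
proof (cases "x \<in> X")
  case True
  then show ?thesis using L2_set_le_l2norm[OF assms, of "{x}"] by simp
next
  case False
  then show ?thesis using assms by (simp add: l2_outside l2norm_nonneg)
qed

lemma l2norm_eq_0:
  assumes "f \<in> l2 X" "l2norm X f = 0"
  shows "f = (\<lambda>_. 0)"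
  using norm_le_l2norm[OF assms(1)] assms(2) by auto

lemma
  assumes "f \<in> l2 X" "g \<in> l2 X"
  shows l2inner_summable: "(\<lambda>x. cnj (f x) * g x) summable_on X"
    and l2inner_bound: "cmod (l2inner X f g) \<le> l2norm X f * l2norm X g"
proof -
  have b: "(\<Sum>x\<in>F. cmod (cnj (f x) * g x)) \<le> l2norm X f * l2norm X g"
    if "finite F" "F \<subseteq> X" for F
  proof -
    have "(\<Sum>x\<in>F. cmod (cnj (f x) * g x)) = (\<Sum>x\<in>F. \<bar>cmod (f x)\<bar> * \<bar>cmod (g x)\<bar>)"
      by (simp add: norm_mult)
    also have "\<dots> \<le> L2_set (\<lambda>x. cmod (f x)) F * L2_set (\<lambda>x. cmod (g x)) F"
      by (rule L2_set_mult_ineq)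
    also have "\<dots> \<le> l2norm X f * l2norm X g"
      using L2_set_le_l2norm[OF assms(1) that] L2_set_le_l2norm[OF assms(2) that]
      by (intro mult_mono) (auto simp: l2norm_nonneg)
    finally show ?thesis .
  qed
  have s: "(\<lambda>x. cmod (cnj (f x) * g x)) summable_on X"
    by (rule nonneg_bdd_above_summable_on)
      (auto intro!: bdd_aboveI2[where M="l2norm X f * l2norm X g"] b)
  show "(\<lambda>x. cnj (f x) * g x) summable_on X"
    using s by (rule abs_summable_summable)
  have "cmod (l2inner X f g) \<le> infsum (\<lambda>x. cmod (cnj (f x) * g x)) X"
    unfolding l2inner_def using s by (rule norm_infsum_bound)
  also have "\<dots> \<le> l2norm X f * l2norm X g"
    using s b by (rule infsum_le_finite_sums)
  finally show "cmod (l2inner X f g) \<le> l2norm X f * l2norm X g" .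
qed

lemma l2inner_zero [simp]: "l2inner X f (\<lambda>_. 0) = 0" "l2inner X (\<lambda>_. 0) f = 0"
  by (simp_all add: l2inner_def)

lemma l2inner_cnj: "l2inner X g f = cnj (l2inner X f g)"
  unfolding l2inner_def by (simp flip: infsum_cnj add: mult.commute)

lemma l2inner_add_right:
  assumes "f \<in> l2 X" "g \<in> l2 X" "h \<in> l2 X"
  shows "l2inner X f (\<lambda>x. g x + h x) = l2inner X f g + l2inner X f h"
  unfolding l2inner_def
  using infsum_add[OF l2inner_summable[OF assms(1,2)] l2inner_summable[OF assms(1,3)]]
  by (simp add: algebra_simps)

lemma l2inner_scale_right:
  "l2inner X f (\<lambda>x. c * g x) = c * l2inner X f g"
  unfolding l2inner_def by (simp add: infsum_cmult_right' mult.left_commute)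

lemma l2inner_scale_left:
  "l2inner X (\<lambda>x. c * f x) g = cnj c * l2inner X f g"
  unfolding l2inner_def by (simp add: infsum_cmult_right' mult.assoc)

lemma l2inner_diff_right:
  assumes "f \<in> l2 X" "g \<in> l2 X" "h \<in> l2 X"
  shows "l2inner X f (\<lambda>x. g x - h x) = l2inner X f g - l2inner X f h"
  using l2inner_add_right[OF assms(1,2) l2_scale[OF assms(3), of "-1"]]
    l2inner_scale_right[of X f "-1" h] by simp

lemma l2inner_add_left:
  assumes "f \<in> l2 X" "g \<in> l2 X" "h \<in> l2 X"
  shows "l2inner X (\<lambda>x. g x + h x) f = l2inner X g f + l2inner X h f"
  using l2inner_add_right[OF assms] by (metis complex_cnj_add l2inner_cnj)

lemma l2inner_diff_left:
  assumes "f \<in> l2 X" "g \<in> l2 X" "h \<in> l2 X"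
  shows "l2inner X (\<lambda>x. g x - h x) f = l2inner X g f - l2inner X h f"
  using l2inner_diff_right[OF assms] by (metis complex_cnj_diff l2inner_cnj)

lemma l2inner_sum_right:
  assumes "finite F" "f \<in> l2 X" "\<And>i. i \<in> F \<Longrightarrow> g i \<in> l2 X"
  shows "l2inner X f (\<lambda>x. \<Sum>i\<in>F. c i * g i x) = (\<Sum>i\<in>F. c i * l2inner X f (g i))"
  using assms
proof (induction F)
  case (insert i F)
  then show ?case
    by (simp add: l2inner_add_right l2_scale l2_sum l2inner_scale_right)
qed simp

lemma l2inner_sum_left:
  assumes "finite F" "f \<in> l2 X" "\<And>i. i \<in> F \<Longrightarrow> g i \<in> l2 X"
  shows "l2inner X (\<lambda>x. \<Sum>i\<in>F. c i * g i x) f = (\<Sum>i\<in>F. cnj (c i) * l2inner X (g i) f)"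
  using assms
proof (induction F)
  case (insert i F)
  then show ?case
    by (simp add: l2inner_add_left l2_scale l2_sum l2inner_scale_left)
qed simp

lemma l2inner_finite_support:
  assumes "finite F" "F \<subseteq> X" "\<And>x. x \<notin> F \<Longrightarrow> f x = 0"
  shows "l2inner X f g = (\<Sum>x\<in>F. cnj (f x) * g x)"
  unfolding l2inner_def using assms
  by (subst infsum_cong_neutral[where T=F and g="\<lambda>x. cnj (f x) * g x"]) auto

lemma l2inner_delta [simp]:
  assumes "a \<in> X"
  shows "l2inner X (delta a) g = g a"
  using assms by (subst l2inner_finite_support[of "{a}"]) (auto simp: delta_def)

lemma l2inner_delta_right [simp]:
  assumes "a \<in> X"
  shows "l2inner X g (delta a) = cnj (g a)"
  using l2inner_cnj[of X g "delta a"] assms by simp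

lemma l2inner_self:
  assumes "f \<in> l2 X"
  shows "l2inner X f f = of_real ((l2norm X f)\<^sup>2)"
proof -
  have "((\<lambda>x. complex_of_real ((cmod (f x))\<^sup>2)) has_sum of_real ((l2norm X f)\<^sup>2)) X"
    unfolding l2norm_square by (intro has_sum_of_real has_sum_infsum l2_summable assms)
  then have "((\<lambda>x. cnj (f x) * f x) has_sum of_real ((l2norm X f)\<^sup>2)) X"
    by (simp only: complex_norm_square mult.commute)
  then show ?thesis unfolding l2inner_def by (rule infsumI)
qed

lemma l2norm_unit:
  assumes "f \<in> l2 Z" "l2inner Z f f = 1"
  shows "l2norm Z f = 1"
proof -
  have "complex_of_real ((l2norm Z f)\<^sup>2) = of_real 1"
    using l2inner_self[OF assms(1)] assms(2) by simp
  then have "(l2norm Z f)\<^sup>2 = 1" by (simp only: of_real_eq_iff)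
  then show ?thesis using l2norm_nonneg[of Z f] by (auto simp: power2_eq_1_iff)
qed

section \<open>Restrictions of vectors and density of finite supports\<close>

definition restr :: "'a set \<Rightarrow> ('a \<Rightarrow> complex) \<Rightarrow> ('a \<Rightarrow> complex)" where
  "restr A f = (\<lambda>x. if x \<in> A then f x else 0)"

lemma
  assumes "f \<in> l2 X"
  shows restr_l2: "restr A f \<in> l2 X"
    and l2norm_restr_le: "l2norm X (restr A f) \<le> l2norm X f"
proof -
  have "L2_set (\<lambda>x. cmod (restr A f x)) F \<le> l2norm X f" if "finite F" "F \<subseteq> X" for F
  proof -
    have "L2_set (\<lambda>x. cmod (restr A f x)) F \<le> L2_set (\<lambda>x. cmod (f x)) F"
      by (rule L2_set_mono) (auto simp: restr_def)
    then show ?thesis using L2_set_le_l2norm[OF assms that] by linarith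
  qed
  note b = this
  have z: "restr A f x = 0" if "x \<notin> X" for x
    using that assms by (auto simp: restr_def l2_outside)
  show "restr A f \<in> l2 X" using z b by (rule l2_via_finite_mem)
  show "l2norm X (restr A f) \<le> l2norm X f" using z b by (rule l2_via_finite_norm)
qed

text \<open>The discarded mass is the tail of the convergent series of squares. It serves the
  existence of adjoints and the finite windows of the category argument.\<close>

lemma l2_finite_approx:
  assumes "f \<in> l2 X" "0 < e"
  obtains F where "finite F" "F \<subseteq> X" "l2norm X (\<lambda>x. f x - restr F f x) \<le> e"
proof -
  let ?n = "\<lambda>x. (cmod (f x))\<^sup>2"
  have "\<exists>F. finite F \<and> F \<subseteq> X \<and> infsum ?n X - e\<^sup>2 < sum ?n F"
  proof (rule ccontr)
    assume "\<not> ?thesis"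
    then have "infsum ?n X \<le> infsum ?n X - e\<^sup>2"
      using infsum_le_finite_sums[OF l2_summable[OF assms(1)], of "infsum ?n X - e\<^sup>2"]
      by (meson not_less)
    then show False using assms(2) by simp
  qed
  then obtain F where F: "finite F" "F \<subseteq> X" "infsum ?n X - e\<^sup>2 < sum ?n F" by blast
  have "l2norm X (\<lambda>x. f x - restr F f x) \<le> e"
  proof (rule l2_via_finite_norm)
    show "f x - restr F f x = 0" if "x \<notin> X" for x
      using that assms(1) by (simp add: restr_def l2_outside)
    show "L2_set (\<lambda>x. cmod (f x - restr F f x)) G \<le> e" if G: "finite G" "G \<subseteq> X" for G
    proof -
      have "(\<Sum>x\<in>G. (cmod (f x - restr F f x))\<^sup>2) = sum ?n (G - F)"
        by (rule sum.mono_neutral_cong_right) (use G in \<open>auto simp: restr_def\<close>)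
      also have "\<dots> = sum ?n (G \<union> F) - sum ?n F"
        using sum_diff[of "G \<union> F" F ?n] F G by (simp add: Un_Diff)
      also have "\<dots> \<le> e\<^sup>2"
        using finite_sum_le_infsum[OF l2_summable[OF assms(1)], of "G \<union> F"] F G by simp
      finally show ?thesis
        unfolding L2_set_def using assms(2) by (simp add: real_le_lsqrt)
    qed
  qed
  with F that show thesis by blast
qed

section \<open>Bounded operators and their adjoints\<close>

lemma bounded_op_mem: "bounded_op X T \<Longrightarrow> f \<in> l2 X \<Longrightarrow> T f \<in> l2 X"
  and bounded_op_outside: "bounded_op X T \<Longrightarrow> f \<notin> l2 X \<Longrightarrow> T f = (\<lambda>_. 0)"
  and bounded_op_add: "bounded_op X T \<Longrightarrow> f \<in> l2 X \<Longrightarrow> g \<in> l2 X \<Longrightarrow>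
    T (\<lambda>x. f x + g x) = (\<lambda>x. T f x + T g x)"
  and bounded_op_scale: "bounded_op X T \<Longrightarrow> f \<in> l2 X \<Longrightarrow> T (\<lambda>x. c * f x) = (\<lambda>x. c * T f x)"
  by (simp_all add: bounded_op_def)

lemma bounded_opI:
  assumes "\<And>f. f \<notin> l2 X \<Longrightarrow> T f = (\<lambda>_. 0)"
    and "\<And>f. f \<in> l2 X \<Longrightarrow> T f \<in> l2 X"
    and "\<And>f g. f \<in> l2 X \<Longrightarrow> g \<in> l2 X \<Longrightarrow> T (\<lambda>x. f x + g x) = (\<lambda>x. T f x + T g x)"
    and "\<And>f c. f \<in> l2 X \<Longrightarrow> T (\<lambda>x. c * f x) = (\<lambda>x. c * T f x)"
    and "\<And>f. f \<in> l2 X \<Longrightarrow> l2norm X (T f) \<le> C * l2norm X f"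
  shows "bounded_op X T"
  using assms unfolding bounded_op_def by blast

lemma bounded_op_bound:
  assumes "bounded_op X T"
  obtains C where "0 < C" "\<And>f. f \<in> l2 X \<Longrightarrow> l2norm X (T f) \<le> C * l2norm X f"
proof -
  obtain C where C: "\<And>f. f \<in> l2 X \<Longrightarrow> l2norm X (T f) \<le> C * l2norm X f"
    using assms unfolding bounded_op_def by blast
  have "l2norm X (T f) \<le> (\<bar>C\<bar> + 1) * l2norm X f" if "f \<in> l2 X" for f
  proof -
    have "C * l2norm X f \<le> (\<bar>C\<bar> + 1) * l2norm X f"
      by (rule mult_right_mono) (auto simp: l2norm_nonneg)
    then show ?thesis using C[OF that] by linarith
  qed
  then show thesis using that[of "\<bar>C\<bar> + 1"] by simp
qed

lemma bounded_op_zero: "bounded_op X T \<Longrightarrow> T (\<lambda>_. 0) = (\<lambda>_. 0)"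
  using bounded_op_scale[of X T "\<lambda>_. 0" 0] by simp

lemma bounded_op_diff:
  assumes "bounded_op X T" "f \<in> l2 X" "g \<in> l2 X"
  shows "T (\<lambda>x. f x - g x) = (\<lambda>x. T f x - T g x)"
  using bounded_op_add[OF assms(1,2) l2_scale[OF assms(3), of "-1"]]
    bounded_op_scale[OF assms(1,3), of "-1"] by simp

lemma bounded_op_sum:
  assumes "bounded_op X T" "finite F" "\<And>i. i \<in> F \<Longrightarrow> g i \<in> l2 X"
  shows "T (\<lambda>x. \<Sum>i\<in>F. c i * g i x) = (\<lambda>x. \<Sum>i\<in>F. c i * T (g i) x)"
  using assms(2,3)
proof (induction F)
  case empty
  then show ?case using bounded_op_zero[OF assms(1)] by simp
next
  case (insert i F)
  then show ?case
    using bounded_op_add[OF assms(1) l2_scale[of "g i" X "c i"] l2_sum[of F g X c]]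
      bounded_op_scale[OF assms(1), of "g i" "c i"] by simp
qed

lemma finite_support_eq_sum_delta:
  assumes "finite F" "\<And>x. x \<notin> F \<Longrightarrow> f x = 0"
  shows "f = (\<lambda>x. \<Sum>i\<in>F. f i * delta i x)"
proof
  fix x
  have "(\<Sum>i\<in>F. f i * delta i x) = (\<Sum>i\<in>F. if i = x then f x else 0)"
    by (rule sum.cong) (auto simp: delta_def)
  also have "\<dots> = f x" using assms by auto
  finally show "f x = (\<Sum>i\<in>F. f i * delta i x)" by simp
qed

lemma bounded_op_finite_support:
  assumes "bounded_op X T" "finite F" "F \<subseteq> X" "\<And>x. x \<notin> F \<Longrightarrow> f x = 0"
  shows "T f = (\<lambda>x. \<Sum>i\<in>F. f i * T (delta i) x)"
proof -
  have f: "f = (\<lambda>x. \<Sum>i\<in>F. f i * delta i x)"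
    using assms(2,4) by (rule finite_support_eq_sum_delta)
  show ?thesis
    by (subst f, rule bounded_op_sum[OF assms(1,2)]) (use assms(3) in auto)
qed

lemma bounded_op_comp:
  assumes "bounded_op X S" "bounded_op X T"
  shows "bounded_op X (S \<circ> T)"
proof -
  obtain C where C: "0 < C" "\<And>f. f \<in> l2 X \<Longrightarrow> l2norm X (S f) \<le> C * l2norm X f"
    using bounded_op_bound[OF assms(1)] by blast
  obtain D where D: "0 < D" "\<And>f. f \<in> l2 X \<Longrightarrow> l2norm X (T f) \<le> D * l2norm X f"
    using bounded_op_bound[OF assms(2)] by blast
  show ?thesis
  proof (rule bounded_opI[where C="C * D"])
    fix f assume f: "f \<in> l2 X"
    have "l2norm X (S (T f)) \<le> C * l2norm X (T f)"
      using C(2) bounded_op_mem[OF assms(2) f] by blast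
    also have "\<dots> \<le> C * (D * l2norm X f)"
      using D(2)[OF f] C(1) by simp
    finally show "l2norm X ((S \<circ> T) f) \<le> C * D * l2norm X f" by (simp add: mult.assoc)
  qed (use assms in \<open>auto simp: bounded_op_mem bounded_op_add[OF assms(1)] bounded_op_add[OF assms(2)]
        bounded_op_scale[OF assms(1)] bounded_op_scale[OF assms(2)]
        bounded_op_outside[OF assms(2)] bounded_op_zero[OF assms(1)]\<close>)
qed

lemma bounded_op_op_scale:
  assumes "bounded_op X T"
  shows "bounded_op X (op_scale c T)"
proof -
  obtain C where C: "0 < C" "\<And>f. f \<in> l2 X \<Longrightarrow> l2norm X (T f) \<le> C * l2norm X f"
    using bounded_op_bound[OF assms] by blast
  have "l2norm X (op_scale c T f) \<le> cmod c * C * l2norm X f" if "f \<in> l2 X" for f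
    using C(2)[OF that] bounded_op_mem[OF assms that]
    by (simp add: op_scale_def l2norm_scale mult.assoc mult_left_mono)
  note b = this
  show ?thesis
    by (rule bounded_opI[OF _ _ _ _ b]) (use assms in \<open>auto simp: bounded_op_mem bounded_op_add[OF assms]
        bounded_op_scale[OF assms] bounded_op_outside[OF assms] op_scale_def l2_scale algebra_simps\<close>)
qed

text \<open>Testing against \<open>delta x\<close> forces coordinate \<open>x\<close> of the adjoint
  to be the inner product of \<open>T (delta x)\<close> with \<open>f\<close>. Square-summability
  comes from applying \<open>T\<close> to the truncation of this candidate to a finite set: the
  squared norm of the truncation is an inner product bounded by \<open>C\<close> times its norm
  times that of \<open>f\<close>. The adjoint identity is algebraic for finitely supported
  \<open>g\<close> and extends by density. Since \<open>adjoint\<close> is a definite description,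
  existence and uniqueness both have to be established before it can be used.\<close>

lemma bounded_op_has_adjoint:
  assumes T: "bounded_op X T"
  shows "is_adjoint X T (\<lambda>f. if f \<in> l2 X
    then (\<lambda>x. if x \<in> X then l2inner X (T (delta x)) f else 0) else (\<lambda>_. 0))"
    (is "is_adjoint X T ?S")
proof -
  obtain C where C: "0 < C" "\<And>f. f \<in> l2 X \<Longrightarrow> l2norm X (T f) \<le> C * l2norm X f"
    using bounded_op_bound[OF T] by blast
  have Td: "T (delta x) \<in> l2 X" if "x \<in> X" for x
    using that T by (simp add: bounded_op_mem)
  have fin: "L2_set (\<lambda>x. cmod (?S f x)) F \<le> C * l2norm X f"
    if f: "f \<in> l2 X" and F: "finite F" "F \<subseteq> X" for f F
  proof -
    let ?s = "L2_set (\<lambda>x. cmod (?S f x)) F"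
    define g where "g = restr F (?S f)"
    have g0: "\<And>x. x \<notin> F \<Longrightarrow> g x = 0" by (simp add: g_def restr_def)
    have gl: "g \<in> l2 X" using F g0 by (rule l2_finite_support)
    have gn: "l2norm X g = ?s"
      using l2norm_finite_support[OF F g0] by (simp add: g_def restr_def L2_set_def)
    have Tg: "T g = (\<lambda>x. \<Sum>i\<in>F. g i * T (delta i) x)"
      using T F g0 by (rule bounded_op_finite_support)
    have "l2inner X (T g) f = (\<Sum>x\<in>F. cnj (g x) * l2inner X (T (delta x)) f)"
      unfolding Tg
      by (rule l2inner_sum_left) (use F f Td in auto)
    also have "\<dots> = (\<Sum>x\<in>F. of_real ((cmod (?S f x))\<^sup>2))"
    proof (rule sum.cong)
      fix x assume x: "x \<in> F"
      then have "g x = l2inner X (T (delta x)) f" using F f by (auto simp: g_def restr_def)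
      moreover have "?S f x = l2inner X (T (delta x)) f" using x F f by auto
      ultimately show "cnj (g x) * l2inner X (T (delta x)) f = of_real ((cmod (?S f x))\<^sup>2)"
        by (simp only: complex_norm_square mult.commute)
    qed simp
    also have "\<dots> = of_real (?s\<^sup>2)" by (simp add: L2_set_square)
    finally have "?s\<^sup>2 = cmod (l2inner X (T g) f)" by (simp del: of_real_power)
    also have "\<dots> \<le> l2norm X (T g) * l2norm X f"
      using bounded_op_mem[OF T gl] f by (rule l2inner_bound)
    also have "\<dots> \<le> (C * ?s) * l2norm X f"
      using C(2)[OF gl] gn by (simp add: mult_right_mono l2norm_nonneg)
    finally have "?s * ?s \<le> ?s * (C * l2norm X f)" by (simp add: power2_eq_square algebra_simps)
    then show ?thesis
      using L2_set_nonneg[of "\<lambda>x. cmod (?S f x)" F] C(1) l2norm_nonneg[of X f]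
      by (cases "?s = 0") (auto simp: mult_le_cancel_left)
  qed
  have out: "?S f x = 0" if "x \<notin> X" for f x using that by simp
  have mem: "?S f \<in> l2 X" if "f \<in> l2 X" for f
    using out fin[OF that] by (rule l2_via_finite_mem)
  have bnd: "l2norm X (?S f) \<le> C * l2norm X f" if "f \<in> l2 X" for f
    using out fin[OF that] by (rule l2_via_finite_norm)
  have bop: "bounded_op X ?S"
  proof (rule bounded_opI[OF _ mem _ _ bnd])
    fix f g assume "f \<in> l2 X" "g \<in> l2 X"
    then show "?S (\<lambda>x. f x + g x) = (\<lambda>x. ?S f x + ?S g x)"
      using Td by (auto simp: l2_add l2inner_add_right)
  next
    fix f c assume "f \<in> l2 X"
    then show "?S (\<lambda>x. c * f x) = (\<lambda>x. c * ?S f x)"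
      by (auto simp: l2_scale l2inner_scale_right)
  qed auto
  have "l2inner X f (T g) = l2inner X (?S f) g" if f: "f \<in> l2 X" and g: "g \<in> l2 X" for f g
  proof -
    have "cmod (l2inner X f (T g) - l2inner X (?S f) g) \<le> 0 + e" if e: "0 < e" for e
    proof -
      \<comment> \<open>Truncating \<open>g\<close> costs at most \<open>2 * C * l2norm X f\<close>
        times the norm of the error, half from each side of the identity; the added 1 keeps the
        divisor positive.\<close>
      let ?K = "2 * C * l2norm X f + 1"
      have K: "0 < ?K" using C(1) l2norm_nonneg[of X f]
        by (smt (verit) mult_nonneg_nonneg)
      obtain F where F: "finite F" "F \<subseteq> X" "l2norm X (\<lambda>x. g x - restr F g x) \<le> e / ?K"
        using l2_finite_approx[OF g, of "e / ?K"] e K by auto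
      define h where "h = restr F g"
      have h0: "\<And>x. x \<notin> F \<Longrightarrow> h x = 0" by (simp add: h_def restr_def)
      have hl: "h \<in> l2 X" using F(1,2) h0 by (rule l2_finite_support)
      have dl: "(\<lambda>x. g x - h x) \<in> l2 X" using g hl by (rule l2_diff)
      have Th: "T h = (\<lambda>x. \<Sum>i\<in>F. h i * T (delta i) x)"
        using T F(1,2) h0 by (rule bounded_op_finite_support)
      have "l2inner X f (T h) = (\<Sum>x\<in>F. h x * l2inner X f (T (delta x)))"
        unfolding Th
        by (rule l2inner_sum_right) (use F f Td in auto)
      also have "\<dots> = (\<Sum>x\<in>F. cnj (cnj (h x) * ?S f x))"
        using F f by (intro sum.cong) (auto simp: subset_iff l2inner_cnj[of X f])
      also have "\<dots> = cnj (l2inner X h (?S f))"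
        by (simp add: l2inner_finite_support[OF F(1,2) h0])
      also have "\<dots> = l2inner X (?S f) h" by (rule l2inner_cnj[symmetric])
      finally have eq: "l2inner X f (T h) = l2inner X (?S f) h" .
      have "l2inner X f (T (\<lambda>x. g x - h x)) = l2inner X f (T g) - l2inner X f (T h)"
        using bounded_op_diff[OF T g hl] l2inner_diff_right[OF f] bounded_op_mem[OF T] g hl by simp
      moreover have "l2inner X (?S f) (\<lambda>x. g x - h x) = l2inner X (?S f) g - l2inner X (?S f) h"
        by (rule l2inner_diff_right[OF mem[OF f] g hl])
      ultimately have "cmod (l2inner X f (T g) - l2inner X (?S f) g)
          = cmod (l2inner X f (T (\<lambda>x. g x - h x)) - l2inner X (?S f) (\<lambda>x. g x - h x))"
        using eq by simp
      also have "\<dots> \<le> l2norm X f * l2norm X (T (\<lambda>x. g x - h x))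
          + l2norm X (?S f) * l2norm X (\<lambda>x. g x - h x)"
        by (rule order_trans[OF norm_triangle_ineq4])
          (intro add_mono l2inner_bound f bounded_op_mem[OF T] mem dl)
      also have "\<dots> \<le> l2norm X f * (C * l2norm X (\<lambda>x. g x - h x))
          + (C * l2norm X f) * l2norm X (\<lambda>x. g x - h x)"
        by (intro add_mono mult_left_mono mult_right_mono C(2) bnd dl f l2norm_nonneg)
      also have "\<dots> \<le> ?K * l2norm X (\<lambda>x. g x - h x)"
        using l2norm_nonneg[of X "\<lambda>x. g x - h x"] by (simp add: algebra_simps)
      also have "\<dots> \<le> ?K * (e / ?K)"
        using F(3) K unfolding h_def by (intro mult_left_mono) auto
      also have "\<dots> = e" using K by simp
      finally show ?thesis by simp
    qed
    then have "cmod (l2inner X f (T g) - l2inner X (?S f) g) \<le> 0"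
      by (rule field_le_epsilon)
    then show ?thesis by simp
  qed
  then show ?thesis using bop unfolding is_adjoint_def by blast
qed

section \<open>Uniqueness of adjoints and their matrix entries\<close>

lemma is_adjointD:
  "is_adjoint X T S \<Longrightarrow> f \<in> l2 X \<Longrightarrow> g \<in> l2 X \<Longrightarrow> l2inner X f (T g) = l2inner X (S f) g"
  by (simp add: is_adjoint_def)

lemma is_adjoint_unique:
  assumes "is_adjoint X T S" "is_adjoint X T S'"
  shows "S = S'"
proof
  have b: "bounded_op X S" "bounded_op X S'" using assms by (simp_all add: is_adjoint_def)
  fix f
  show "S f = S' f"
  proof (cases "f \<in> l2 X")
    case f: True
    show ?thesis
    proof
      fix x
      show "S f x = S' f x"
      proof (cases "x \<in> X")
        case True
        then have "l2inner X (S f) (delta x) = l2inner X (S' f) (delta x)"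
          using is_adjointD[OF assms(1) f, of "delta x"] is_adjointD[OF assms(2) f, of "delta x"]
          by (simp del: l2inner_delta_right)
        then show ?thesis using True by simp
      next
        case False
        then show ?thesis
          using l2_outside[OF bounded_op_mem[OF b(1) f]] l2_outside[OF bounded_op_mem[OF b(2) f]]
          by simp
      qed
    qed
  next
    case False
    then show ?thesis using bounded_op_outside[OF b(1)] bounded_op_outside[OF b(2)] by simp
  qed
qed

lemma adjoint_eqI: "is_adjoint X T S \<Longrightarrow> adjoint X T = S"
  unfolding adjoint_def by (rule the_equality) (auto intro: is_adjoint_unique)

lemma is_adjoint_adjoint:
  assumes "bounded_op X T"
  shows "is_adjoint X T (adjoint X T)"
  unfolding adjoint_eqI[OF bounded_op_has_adjoint[OF assms]]
  by (rule bounded_op_has_adjoint[OF assms])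

lemma bounded_op_adjoint: "bounded_op X T \<Longrightarrow> bounded_op X (adjoint X T)"
  by (drule is_adjoint_adjoint) (simp add: is_adjoint_def)

lemma l2inner_adjoint:
  "bounded_op X T \<Longrightarrow> f \<in> l2 X \<Longrightarrow> g \<in> l2 X \<Longrightarrow> l2inner X f (T g) = l2inner X (adjoint X T f) g"
  by (rule is_adjointD[OF is_adjoint_adjoint])

lemma entry_adjoint:
  assumes "bounded_op X T" "x \<in> X" "x' \<in> X"
  shows "entry (adjoint X T) x x' = cnj (entry T x' x)"
proof -
  have "cnj (adjoint X T (delta x') x) = l2inner X (adjoint X T (delta x')) (delta x)"
    using assms by simp
  also have "\<dots> = l2inner X (delta x') (T (delta x))"
    using l2inner_adjoint[OF assms(1), of "delta x'" "delta x"] assms by simp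
  finally have "cnj (cnj (adjoint X T (delta x') x)) = cnj (T (delta x) x')"
    using assms by simp
  then show ?thesis by (simp add: entry_def)
qed

section \<open>The uniform Roe algebra\<close>

lemma bounded_op_op_diff:
  assumes "bounded_op X S" "bounded_op X T"
  shows "bounded_op X (op_diff S T)"
proof -
  obtain C where C: "0 < C" "\<And>f. f \<in> l2 X \<Longrightarrow> l2norm X (S f) \<le> C * l2norm X f"
    using bounded_op_bound[OF assms(1)] by blast
  obtain D where D: "0 < D" "\<And>f. f \<in> l2 X \<Longrightarrow> l2norm X (T f) \<le> D * l2norm X f"
    using bounded_op_bound[OF assms(2)] by blast
  have "l2norm X (op_diff S T f) \<le> (C + D) * l2norm X f" if f: "f \<in> l2 X" for f
    using l2norm_diff_le[OF bounded_op_mem[OF assms(1) f] bounded_op_mem[OF assms(2) f]]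
      C(2)[OF f] D(2)[OF f] by (simp add: op_diff_def algebra_simps)
  note b = this
  show ?thesis
    by (rule bounded_opI[OF _ _ _ _ b]) (use assms in \<open>auto simp: bounded_op_mem bounded_op_add[OF assms(1)]
        bounded_op_add[OF assms(2)] bounded_op_scale[OF assms(1)] bounded_op_scale[OF assms(2)]
        bounded_op_outside[OF assms(1)] bounded_op_outside[OF assms(2)] op_diff_def l2_diff
        algebra_simps\<close>)
qed

lemma opnorm_bound:
  assumes "bounded_op X T" "f \<in> l2 X"
  shows "l2norm X (T f) \<le> opnorm X T * l2norm X f"
proof (cases "l2norm X f = 0")
  case True
  then have "f = (\<lambda>_. 0)" using assms(2) by (rule l2norm_eq_0[rotated])
  then show ?thesis using bounded_op_zero[OF assms(1)] by simp
next
  case False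
  then have p: "0 < l2norm X f" using l2norm_nonneg[of X f] by linarith
  obtain C where C: "0 < C" "\<And>f. f \<in> l2 X \<Longrightarrow> l2norm X (T f) \<le> C * l2norm X f"
    using bounded_op_bound[OF assms(1)] by blast
  define g where "g = (\<lambda>x. of_real (1 / l2norm X f) * f x)"
  have g: "g \<in> l2 X" "l2norm X g = 1"
    unfolding g_def using p by (simp_all only: l2_scale[OF assms(2)] l2norm_scale[OF assms(2)])
      (simp add: norm_divide)
  have "bdd_above {l2norm X (T f) | f. f \<in> l2 X \<and> l2norm X f \<le> 1}"
    by (rule bdd_aboveI[of _ C]) (use C in \<open>force intro: order_trans\<close>)
  then have "l2norm X (T g) \<le> opnorm X T"
    unfolding opnorm_def by (rule cSup_upper[rotated]) (use g in auto)
  moreover have "l2norm X (T g) = 1 / l2norm X f * l2norm X (T f)"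
    unfolding g_def bounded_op_scale[OF assms] using p
    by (simp only: l2norm_scale[OF bounded_op_mem[OF assms]]) (simp add: norm_divide)
  ultimately show ?thesis using p by (simp add: field_simps)
qed

lemma opnorm_le:
  assumes "\<And>f. f \<in> l2 X \<Longrightarrow> l2norm X (T f) \<le> c * l2norm X f" "0 \<le> c"
  shows "opnorm X T \<le> c"
  unfolding opnorm_def
proof (rule cSup_least)
  show "{l2norm X (T f) | f. f \<in> l2 X \<and> l2norm X f \<le> 1} \<noteq> {}"
    using l2_zero[of X] by (auto intro!: exI[of _ "\<lambda>_. 0"])
  fix z assume "z \<in> {l2norm X (T f) | f. f \<in> l2 X \<and> l2norm X f \<le> 1}"
  then obtain f where f: "f \<in> l2 X" "l2norm X f \<le> 1" "z = l2norm X (T f)" by auto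
  have "c * l2norm X f \<le> c * 1" using f(2) assms(2) by (rule mult_left_mono)
  then show "z \<le> c" using assms(1)[OF f(1)] f(3) by simp
qed

text \<open>Replaces the supremum in \<open>opnorm\<close> by a vectorwise estimate. Using the
  hypothesis at \<open>e / 2\<close> turns the weak bound into the strict one of the
  definition.\<close>

lemma uniform_roeI:
  assumes "bounded_op X T"
    and "\<And>e. 0 < e \<Longrightarrow> \<exists>S. bounded_op X S \<and> finite_propagation X d S \<and>
      (\<forall>f\<in>l2 X. l2norm X (\<lambda>x. T f x - S f x) \<le> e * l2norm X f)"
  shows "T \<in> uniform_roe X d"
  unfolding uniform_roe_def
proof (safe)
  fix e :: real assume e: "0 < e"
  obtain S where S: "bounded_op X S" "finite_propagation X d S"
    "\<And>f. f \<in> l2 X \<Longrightarrow> l2norm X (\<lambda>x. T f x - S f x) \<le> e / 2 * l2norm X f"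
    using assms(2)[of "e / 2"] e by auto
  have "opnorm X (op_diff T S) \<le> e / 2"
    by (rule opnorm_le) (use S(3) e in \<open>auto simp: op_diff_def\<close>)
  then show "\<exists>S. bounded_op X S \<and> finite_propagation X d S \<and> opnorm X (op_diff T S) < e"
    using S e by (intro exI[of _ S]) auto
qed (fact assms)

lemma uniform_roe_bounded: "T \<in> uniform_roe X d \<Longrightarrow> bounded_op X T"
  by (simp add: uniform_roe_def)

lemma uniform_roe_approx:
  assumes "T \<in> uniform_roe X d" "0 < e"
  obtains S where "bounded_op X S" "finite_propagation X d S"
    "\<And>f. f \<in> l2 X \<Longrightarrow> l2norm X (\<lambda>x. T f x - S f x) \<le> e * l2norm X f"
proof -
  obtain S where S: "bounded_op X S" "finite_propagation X d S" "opnorm X (op_diff T S) < e"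
    using assms unfolding uniform_roe_def by blast
  have "l2norm X (\<lambda>x. T f x - S f x) \<le> e * l2norm X f" if f: "f \<in> l2 X" for f
  proof -
    have "l2norm X (op_diff T S f) \<le> opnorm X (op_diff T S) * l2norm X f"
      using bounded_op_op_diff[OF uniform_roe_bounded[OF assms(1)] S(1)] f by (rule opnorm_bound)
    also have "\<dots> \<le> e * l2norm X f"
      using S(3) by (intro mult_right_mono l2norm_nonneg) simp
    finally show ?thesis by (simp add: op_diff_def)
  qed
  with S that show thesis by blast
qed

lemma uniform_roe_finite_propagation:
  assumes "bounded_op X T" "finite_propagation X d T"
  shows "T \<in> uniform_roe X d"
proof (rule uniform_roeI[OF assms(1)])
  fix e :: real assume "0 < e"
  then show "\<exists>S. bounded_op X S \<and> finite_propagation X d S \<and>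
      (\<forall>f\<in>l2 X. l2norm X (\<lambda>x. T f x - S f x) \<le> e * l2norm X f)"
    using assms by (intro exI[of _ T] conjI ballI) (simp_all add: l2norm_nonneg)
qed

text \<open>The matrix product may be an infinite sum. Moving \<open>S\<close> to the other side of
  an inner product turns the entry into an \<open>infsum\<close>, which is non-zero only if some
  summand is; that index is the intermediate point for the triangle inequality.\<close>

lemma finite_propagation_comp:
  assumes "Metric_space X d" "bounded_op X S" "bounded_op X T"
    and "finite_propagation X d S" "finite_propagation X d T"
  shows "finite_propagation X d (S \<circ> T)"
proof -
  obtain R where R: "\<And>x y. x \<in> X \<Longrightarrow> y \<in> X \<Longrightarrow> entry S x y \<noteq> 0 \<Longrightarrow> d x y \<le> R"
    using assms(4) unfolding finite_propagation_def by blast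
  obtain Q where Q: "\<And>x y. x \<in> X \<Longrightarrow> y \<in> X \<Longrightarrow> entry T x y \<noteq> 0 \<Longrightarrow> d x y \<le> Q"
    using assms(5) unfolding finite_propagation_def by blast
  have "d x z \<le> R + Q" if x: "x \<in> X" and z: "z \<in> X" and nz: "entry (S \<circ> T) x z \<noteq> 0" for x z
  proof -
    have "entry (S \<circ> T) x z = l2inner X (delta x) (S (T (delta z)))"
      using x by (simp add: entry_def)
    also have "\<dots> = l2inner X (adjoint X S (delta x)) (T (delta z))"
      using x z assms by (intro l2inner_adjoint) (auto intro: bounded_op_mem)
    finally have "l2inner X (adjoint X S (delta x)) (T (delta z)) \<noteq> 0" using nz by simp
    then obtain y where y: "y \<in> X" "adjoint X S (delta x) y \<noteq> 0" "T (delta z) y \<noteq> 0"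
      unfolding l2inner_def
      by (metis (no_types, lifting) complex_cnj_zero infsum_0 mult_zero_left mult_zero_right)
    have "entry S x y \<noteq> 0"
      using entry_adjoint[OF assms(2) y(1) x] y(2) by (auto simp: entry_def)
    moreover have "entry T y z \<noteq> 0" using y(3) by (simp add: entry_def)
    ultimately have "d x y \<le> R" "d y z \<le> Q" using R Q x y z by auto
    moreover have "d x z \<le> d x y + d y z"
      using Metric_space.triangle[OF assms(1) x y(1) z] .
    ultimately show ?thesis by linarith
  qed
  then show ?thesis unfolding finite_propagation_def by blast
qed

lemma uniform_roe_comp:
  assumes "Metric_space X d" "S \<in> uniform_roe X d" "T \<in> uniform_roe X d"
  shows "S \<circ> T \<in> uniform_roe X d"
proof (rule uniform_roeI)
  have bS: "bounded_op X S" and bT: "bounded_op X T"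
    using assms(2,3) by (auto dest: uniform_roe_bounded)
  show "bounded_op X (S \<circ> T)" using bS bT by (rule bounded_op_comp)
  fix e :: real assume e: "0 < e"
  obtain C where C: "0 < C" "\<And>f. f \<in> l2 X \<Longrightarrow> l2norm X (T f) \<le> C * l2norm X f"
    using bounded_op_bound[OF bT] by blast
  obtain S' where S': "bounded_op X S'" "finite_propagation X d S'"
    "\<And>f. f \<in> l2 X \<Longrightarrow> l2norm X (\<lambda>x. S f x - S' f x) \<le> e / (2 * C) * l2norm X f"
    using uniform_roe_approx[OF assms(2), of "e / (2 * C)"] e C by auto
  obtain D where D: "0 < D" "\<And>f. f \<in> l2 X \<Longrightarrow> l2norm X (S' f) \<le> D * l2norm X f"
    using bounded_op_bound[OF S'(1)] by blast
  \<comment> \<open>\<open>T'\<close> is chosen after \<open>S'\<close> because its error gets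
    multiplied by the bound \<open>D\<close> of \<open>S'\<close> in
    \<open>S T - S' T' = (S - S') T + S' (T - T')\<close>.\<close>
  obtain T' where T': "bounded_op X T'" "finite_propagation X d T'"
    "\<And>f. f \<in> l2 X \<Longrightarrow> l2norm X (\<lambda>x. T f x - T' f x) \<le> e / (2 * D) * l2norm X f"
    using uniform_roe_approx[OF assms(3), of "e / (2 * D)"] e D by auto
  have "l2norm X (\<lambda>x. (S \<circ> T) f x - (S' \<circ> T') f x) \<le> e * l2norm X f" if f: "f \<in> l2 X" for f
  proof -
    have m: "T f \<in> l2 X" "T' f \<in> l2 X" using f bT T'(1) by (auto intro: bounded_op_mem)
    have eq: "(\<lambda>x. (S \<circ> T) f x - (S' \<circ> T') f x)
        = (\<lambda>x. (S (T f) x - S' (T f) x) + S' (\<lambda>x. T f x - T' f x) x)"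
      using bounded_op_diff[OF S'(1) m] by auto
    have "l2norm X (\<lambda>x. (S \<circ> T) f x - (S' \<circ> T') f x)
        \<le> l2norm X (\<lambda>x. S (T f) x - S' (T f) x) + l2norm X (S' (\<lambda>x. T f x - T' f x))"
      unfolding eq by (intro l2norm_triangle l2_diff bounded_op_mem[OF bS] bounded_op_mem[OF S'(1)] m)
    also have "\<dots> \<le> e / (2 * C) * l2norm X (T f) + D * l2norm X (\<lambda>x. T f x - T' f x)"
      by (intro add_mono S'(3) D(2) l2_diff m)
    also have "\<dots> \<le> e / (2 * C) * (C * l2norm X f) + D * (e / (2 * D) * l2norm X f)"
      using e C(1) D(1) by (intro add_mono mult_left_mono C(2) T'(3) f) auto
    also have "\<dots> = e * l2norm X f" using C(1) D(1) by (simp add: field_simps)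
    finally show ?thesis .
  qed
  then show "\<exists>V. bounded_op X V \<and> finite_propagation X d V \<and>
      (\<forall>f\<in>l2 X. l2norm X (\<lambda>x. (S \<circ> T) f x - V f x) \<le> e * l2norm X f)"
    using bounded_op_comp[OF S'(1) T'(1)]
      finite_propagation_comp[OF assms(1) S'(1) T'(1) S'(2) T'(2)]
    by (intro exI[of _ "S' \<circ> T'"] conjI ballI)
qed

lemma uniform_roe_op_scale:
  assumes "T \<in> uniform_roe X d"
  shows "op_scale c T \<in> uniform_roe X d"
proof (rule uniform_roeI)
  have bT: "bounded_op X T" using assms by (rule uniform_roe_bounded)
  then show "bounded_op X (op_scale c T)" by (rule bounded_op_op_scale)
  fix e :: real assume e: "0 < e"
  let ?e = "e / (cmod c + 1)"
  have c1: "0 < cmod c + 1" by (simp add: add_nonneg_pos)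
  have "cmod c * ?e = e * (cmod c / (cmod c + 1))" by simp
  also have "\<dots> \<le> e * 1" using c1 e by (intro mult_left_mono) auto
  finally have ce: "cmod c * ?e \<le> e" by simp
  obtain S where S: "bounded_op X S" "finite_propagation X d S"
    "\<And>f. f \<in> l2 X \<Longrightarrow> l2norm X (\<lambda>x. T f x - S f x) \<le> ?e * l2norm X f"
    using uniform_roe_approx[OF assms, of ?e] e c1 by (metis divide_pos_pos)
  have "l2norm X (\<lambda>x. op_scale c T f x - op_scale c S f x) \<le> e * l2norm X f"
    if f: "f \<in> l2 X" for f
  proof -
    have "l2norm X (\<lambda>x. op_scale c T f x - op_scale c S f x)
        = cmod c * l2norm X (\<lambda>x. T f x - S f x)"
      using l2norm_scale[OF l2_diff[OF bounded_op_mem[OF bT f] bounded_op_mem[OF S(1) f]], of c]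
      by (simp add: op_scale_def right_diff_distrib)
    also have "\<dots> \<le> cmod c * (?e * l2norm X f)" by (intro mult_left_mono S(3) f) simp
    also have "\<dots> = (cmod c * ?e) * l2norm X f" by simp
    also have "\<dots> \<le> e * l2norm X f" using ce by (intro mult_right_mono l2norm_nonneg)
    finally show ?thesis .
  qed
  moreover have "finite_propagation X d (op_scale c S)"
    using S(2) by (auto simp: finite_propagation_def entry_def op_scale_def)
  ultimately show "\<exists>V. bounded_op X V \<and> finite_propagation X d V \<and>
      (\<forall>f\<in>l2 X. l2norm X (\<lambda>x. op_scale c T f x - V f x) \<le> e * l2norm X f)"
    using bounded_op_op_scale[OF S(1)] by (intro exI[of _ "op_scale c S"] conjI ballI)
qed

text \<open>Adjoints are approximated with the same error: if \<open>h\<close> is the difference of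
  the adjoints at \<open>f\<close>, its squared norm is the inner product of \<open>f\<close> with
  \<open>T h - S h\<close>, at most \<open>e\<close> times both norms. Finite propagation survives
  by symmetry of the distance.\<close>

lemma uniform_roe_adjoint:
  assumes "Metric_space X d" "T \<in> uniform_roe X d"
  shows "adjoint X T \<in> uniform_roe X d"
proof (rule uniform_roeI)
  have bT: "bounded_op X T" using assms(2) by (rule uniform_roe_bounded)
  then show bA: "bounded_op X (adjoint X T)" by (rule bounded_op_adjoint)
  fix e :: real assume e: "0 < e"
  obtain S where S: "bounded_op X S" "finite_propagation X d S"
    "\<And>f. f \<in> l2 X \<Longrightarrow> l2norm X (\<lambda>x. T f x - S f x) \<le> e * l2norm X f"
    using uniform_roe_approx[OF assms(2) e] by blast
  have bB: "bounded_op X (adjoint X S)" using S(1) by (rule bounded_op_adjoint)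
  have "l2norm X (\<lambda>x. adjoint X T f x - adjoint X S f x) \<le> e * l2norm X f"
    if f: "f \<in> l2 X" for f
  proof -
    define h where "h = (\<lambda>x. adjoint X T f x - adjoint X S f x)"
    have h: "h \<in> l2 X"
      unfolding h_def using f bA bB by (intro l2_diff) (auto intro: bounded_op_mem)
    have "of_real ((l2norm X h)\<^sup>2) = l2inner X h h" by (rule l2inner_self[OF h, symmetric])
    also have "\<dots> = l2inner X (adjoint X T f) h - l2inner X (adjoint X S f) h"
      using l2inner_diff_left[OF h bounded_op_mem[OF bA f] bounded_op_mem[OF bB f]]
      by (simp add: h_def)
    also have "\<dots> = l2inner X f (\<lambda>x. T h x - S h x)"
      using l2inner_adjoint[OF bT f h] l2inner_adjoint[OF S(1) f h]
        l2inner_diff_right[OF f bounded_op_mem[OF bT h] bounded_op_mem[OF S(1) h]] by simp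
    finally have "(l2norm X h)\<^sup>2 = cmod (l2inner X f (\<lambda>x. T h x - S h x))"
      by (metis abs_power2 norm_of_real)
    also have "\<dots> \<le> l2norm X f * l2norm X (\<lambda>x. T h x - S h x)"
      by (intro l2inner_bound f l2_diff bounded_op_mem[OF bT h] bounded_op_mem[OF S(1) h])
    also have "\<dots> \<le> l2norm X f * (e * l2norm X h)"
      by (intro mult_left_mono S(3) h l2norm_nonneg)
    finally have "l2norm X h * l2norm X h \<le> l2norm X h * (e * l2norm X f)"
      by (simp add: power2_eq_square algebra_simps)
    then have "l2norm X h \<le> e * l2norm X f"
      using l2norm_nonneg[of X h] l2norm_nonneg[of X f] e
      by (cases "l2norm X h = 0") (auto simp: mult_le_cancel_left)
    then show ?thesis by (simp add: h_def)
  qed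
  moreover have "finite_propagation X d (adjoint X S)"
    using S(2) entry_adjoint[OF S(1)]
    unfolding finite_propagation_def
    by (metis complex_cnj_zero Metric_space.commute[OF assms(1)])
  ultimately show "\<exists>V. bounded_op X V \<and> finite_propagation X d V \<and>
      (\<forall>f\<in>l2 X. l2norm X (\<lambda>x. adjoint X T f x - V f x) \<le> e * l2norm X f)"
    using bB by (intro exI[of _ "adjoint X S"] conjI ballI)
qed

section \<open>Matrix units and the implementing unitary\<close>

definition matunit :: "'a set \<Rightarrow> 'a \<Rightarrow> 'a \<Rightarrow> 'a op" where
  "matunit X a b = (\<lambda>f. if f \<in> l2 X then (\<lambda>x. f b * delta a x) else (\<lambda>_. 0))"

lemma matunit_apply: "f \<in> l2 X \<Longrightarrow> matunit X a b f = (\<lambda>x. f b * delta a x)"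
  by (simp add: matunit_def)

lemma bounded_op_matunit:
  assumes "a \<in> X"
  shows "bounded_op X (matunit X a b)"
proof (rule bounded_opI[where C=1])
  fix f assume f: "f \<in> l2 X"
  show "matunit X a b f \<in> l2 X"
    using f assms by (simp add: matunit_apply l2_scale)
  show "l2norm X (matunit X a b f) \<le> 1 * l2norm X f"
    using f assms by (simp add: matunit_apply l2norm_scale norm_le_l2norm)
qed (auto simp: matunit_def l2_add l2_scale algebra_simps)

lemma matunit_roe:
  assumes "a \<in> X" "b \<in> X"
  shows "matunit X a b \<in> uniform_roe X d"
proof (rule uniform_roe_finite_propagation)
  have "d x x' \<le> d a b" if "x' \<in> X" "entry (matunit X a b) x x' \<noteq> 0" for x x'
    using that by (simp add: entry_def matunit_apply) (auto simp: delta_def split: if_splits)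
  then show "finite_propagation X d (matunit X a b)"
    unfolding finite_propagation_def by blast
qed (rule bounded_op_matunit[OF assms(1)])

lemma adjoint_matunit:
  assumes "a \<in> X" "b \<in> X"
  shows "adjoint X (matunit X a b) = matunit X b a"
  using assms
  by (intro adjoint_eqI) (simp add: is_adjoint_def bounded_op_matunit matunit_apply
      l2inner_scale_right l2inner_scale_left)

text \<open>Matrix units on both sides extract a single entry. The formula involves only composition
  and scalars, so an isomorphism carries it over and makes entries visible in the image.\<close>

lemma matunit_comp_matunit:
  assumes "T \<in> uniform_roe X d" "a \<in> X" "b \<in> X" "c \<in> X"
  shows "matunit X a b \<circ> (T \<circ> matunit X c e) = op_scale (entry T b c) (matunit X a e)"
proof
  fix f
  have T: "bounded_op X T" using assms(1) by (rule uniform_roe_bounded)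
  show "(matunit X a b \<circ> (T \<circ> matunit X c e)) f = op_scale (entry T b c) (matunit X a e) f"
  proof (cases "f \<in> l2 X")
    case True
    have "T (\<lambda>x. f e * delta c x) = (\<lambda>x. f e * T (delta c) x)"
      by (rule bounded_op_scale[OF T delta_l2[OF assms(4)]])
    moreover have "(\<lambda>x. f e * T (delta c) x) \<in> l2 X"
      by (rule l2_scale[OF bounded_op_mem[OF T delta_l2[OF assms(4)]]])
    ultimately show ?thesis
      using True by (simp add: matunit_apply op_scale_def entry_def algebra_simps)
  next
    case False
    then have "matunit X c e f = (\<lambda>_. 0)" by (simp add: matunit_def)
    then show ?thesis
      using False bounded_op_zero[OF T] by (simp add: op_scale_def matunit_def)
  qed
qed

section \<open>From an abstract isomorphism to the entries of a unitary\<close>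

definition roe_iso :: "'a set \<Rightarrow> ('a \<Rightarrow> 'a \<Rightarrow> real) \<Rightarrow> 'b set \<Rightarrow> ('b \<Rightarrow> 'b \<Rightarrow> real)
    \<Rightarrow> ('a op \<Rightarrow> 'b op) \<Rightarrow> bool" where
  "roe_iso X dX Y dY \<Phi> \<longleftrightarrow>
     bij_betw \<Phi> (uniform_roe X dX) (uniform_roe Y dY) \<and>
     (\<forall>S\<in>uniform_roe X dX. \<forall>T\<in>uniform_roe X dX. \<Phi> (S \<circ> T) = \<Phi> S \<circ> \<Phi> T) \<and>
     (\<forall>S\<in>uniform_roe X dX. \<forall>c. \<Phi> (op_scale c S) = op_scale c (\<Phi> S)) \<and>
     (\<forall>S\<in>uniform_roe X dX. \<Phi> (adjoint X S) = adjoint Y (\<Phi> S))"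

lemma star_iso_imp_roe_iso: "star_iso X dX Y dY \<Phi> \<Longrightarrow> roe_iso X dX Y dY \<Phi>"
  unfolding star_iso_def roe_iso_def by blast

text \<open>Bases are built on both sides, the second one from the inverse map.\<close>

lemma roe_iso_inverse:
  assumes "Metric_space X dX" "roe_iso X dX Y dY \<Phi>"
  shows "roe_iso Y dY X dX (inv_into (uniform_roe X dX) \<Phi>)"
proof -
  let ?A = "uniform_roe X dX" and ?B = "uniform_roe Y dY"
  let ?\<Psi> = "inv_into ?A \<Phi>"
  have bij: "bij_betw \<Phi> ?A ?B" using assms(2) by (simp add: roe_iso_def)
  then have inj: "inj_on \<Phi> ?A" by (rule bij_betw_imp_inj_on)
  have mem: "?\<Psi> S \<in> ?A" if "S \<in> ?B" for S
    using that bij by (simp add: bij_betw_def inv_into_into)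
  have \<Phi>\<Psi>: "\<Phi> (?\<Psi> S) = S" if "S \<in> ?B" for S
    using that bij by (simp add: bij_betw_inv_into_right)
  have eqI: "?\<Psi> S = T" if "T \<in> ?A" "\<Phi> T = S" for S T
    using that inj by (auto simp: inv_into_f_f)
  have "?\<Psi> (S \<circ> T) = ?\<Psi> S \<circ> ?\<Psi> T" if "S \<in> ?B" "T \<in> ?B" for S T
    using that assms mem \<Phi>\<Psi> by (intro eqI) (auto simp: roe_iso_def uniform_roe_comp)
  moreover have "?\<Psi> (op_scale c S) = op_scale c (?\<Psi> S)" if "S \<in> ?B" for S c
    using that assms mem \<Phi>\<Psi> by (intro eqI) (auto simp: roe_iso_def uniform_roe_op_scale)
  moreover have "?\<Psi> (adjoint Y S) = adjoint X (?\<Psi> S)" if "S \<in> ?B" for S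
    using that assms mem \<Phi>\<Psi> by (intro eqI) (auto simp: roe_iso_def uniform_roe_adjoint)
  ultimately show ?thesis
    unfolding roe_iso_def using bij_betw_inv_into[OF bij] by blast
qed

text \<open>Apply the adjoint of \<open>T\<close> to \<open>T f\<close>: the coordinates of the
  result are, up to conjugation, inner products of \<open>T f\<close> with
  \<open>T (delta x)\<close> and vanish, while its inner product with \<open>f\<close> is the
  squared norm of \<open>T f\<close>.\<close>

lemma bounded_op_eq_zeroI:
  assumes "bounded_op X T" "\<And>x. x \<in> X \<Longrightarrow> T (delta x) = (\<lambda>_. 0)"
  shows "T f = (\<lambda>_. 0)"
proof (cases "f \<in> l2 X")
  case True
  define g where "g = adjoint X T (T f)"
  have Tf: "T f \<in> l2 X" using assms(1) True by (rule bounded_op_mem)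
  have g: "g \<in> l2 X" unfolding g_def using bounded_op_adjoint[OF assms(1)] Tf by (rule bounded_op_mem)
  have "g x = 0" for x
  proof (cases "x \<in> X")
    case x: True
    then have "cnj (g x) = l2inner X (T f) (T (delta x))"
      using l2inner_adjoint[OF assms(1) Tf, of "delta x"] by (simp add: g_def)
    then show ?thesis using assms(2)[OF x] by simp
  next
    case False
    then show ?thesis using g by (simp add: l2_outside)
  qed
  then have "g = (\<lambda>_. 0)" by auto
  then have "l2inner X (T f) (T f) = 0"
    using l2inner_adjoint[OF assms(1) Tf True] by (simp add: g_def)
  then show ?thesis using l2inner_self[OF Tf] l2norm_eq_0[OF Tf] by simp
qed (rule bounded_op_outside[OF assms(1)])

text \<open>\<open>\<xi> x\<close> is the image of \<open>delta x\<close> under the isometry to be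
  found. Completeness of the family is not recorded here; it comes from the basis of the inverse
  isomorphism.\<close>

definition spatial_basis :: "'a set \<Rightarrow> ('a \<Rightarrow> 'a \<Rightarrow> real) \<Rightarrow> 'b set \<Rightarrow> ('a op \<Rightarrow> 'b op)
    \<Rightarrow> ('a \<Rightarrow> 'b \<Rightarrow> complex) \<Rightarrow> bool" where
  "spatial_basis X dX Y \<Phi> \<xi> \<longleftrightarrow>
     (\<forall>x\<in>X. \<xi> x \<in> l2 Y) \<and>
     (\<forall>x\<in>X. \<forall>x'\<in>X. l2inner Y (\<xi> x) (\<xi> x') = (if x = x' then 1 else 0)) \<and>
     (\<forall>T\<in>uniform_roe X dX. \<forall>x\<in>X. \<forall>x'\<in>X. l2inner Y (\<xi> x) (\<Phi> T (\<xi> x')) = entry T x x') \<and>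
     (\<forall>x\<in>X. \<forall>x'\<in>X. \<forall>f\<in>l2 Y. \<Phi> (matunit X x x') f = (\<lambda>y. l2inner Y (\<xi> x') f * \<xi> x y))"

text \<open>A minimal projection of the Roe algebra has rank one: it is a multiple of its own
  compression of any matrix unit that it does not annihilate.\<close>

lemma roe_iso_basis:
  assumes "Metric_space X dX" "Metric_space Y dY" "roe_iso X dX Y dY \<Phi>" "x0 \<in> X"
  obtains \<xi> where "spatial_basis X dX Y \<Phi> \<xi>"
proof -
  let ?A = "uniform_roe X dX" and ?B = "uniform_roe Y dY"
  let ?E = "matunit X"
  have bij: "bij_betw \<Phi> ?A ?B" using assms(3) by (simp add: roe_iso_def)
  have comp: "\<Phi> (S \<circ> T) = \<Phi> S \<circ> \<Phi> T" if "S \<in> ?A" "T \<in> ?A" for S T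
    using assms(3) that by (simp add: roe_iso_def)
  have scale: "\<Phi> (op_scale c S) = op_scale c (\<Phi> S)" if "S \<in> ?A" for S c
    using assms(3) that by (simp add: roe_iso_def)
  have adj: "\<Phi> (adjoint X S) = adjoint Y (\<Phi> S)" if "S \<in> ?A" for S
    using assms(3) that by (simp add: roe_iso_def)
  have E: "?E a b \<in> ?A" if "a \<in> X" "b \<in> X" for a b using that by (rule matunit_roe)
  have B: "\<Phi> S \<in> ?B" if "S \<in> ?A" for S using bij that by (auto dest: bij_betwE)
  have bop: "bounded_op Y (\<Phi> S)" if "S \<in> ?A" for S
    using B[OF that] by (rule uniform_roe_bounded)
  have sandwich: "\<Phi> (?E a b) (\<Phi> T (\<Phi> (?E c e) f)) = (\<lambda>y. entry T b c * \<Phi> (?E a e) f y)"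
    if "a \<in> X" "b \<in> X" "c \<in> X" "e \<in> X" "T \<in> ?A" for a b c e T f
  proof -
    have "\<Phi> (?E a b \<circ> (T \<circ> ?E c e)) = \<Phi> (?E a b) \<circ> (\<Phi> T \<circ> \<Phi> (?E c e))"
      using that E by (simp add: comp uniform_roe_comp[OF assms(1)])
    moreover have "?E a b \<circ> (T \<circ> ?E c e) = op_scale (entry T b c) (?E a e)"
      using that by (intro matunit_comp_matunit)
    ultimately have "op_scale (entry T b c) (\<Phi> (?E a e)) = \<Phi> (?E a b) \<circ> (\<Phi> T \<circ> \<Phi> (?E c e))"
      using that E by (simp add: scale)
    then show ?thesis by (metis (no_types, lifting) comp_apply op_scale_def)
  qed
  have mult: "\<Phi> (?E a b) (\<Phi> (?E c e) f) = (\<lambda>y. delta c b * \<Phi> (?E a e) f y)"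
    if "a \<in> X" "b \<in> X" "c \<in> X" "e \<in> X" for a b c e f
  proof -
    have "?E a b \<circ> ?E c e = op_scale (delta c b) (?E a e)"
    proof
      fix g
      show "(?E a b \<circ> ?E c e) g = op_scale (delta c b) (?E a e) g"
      proof (cases "g \<in> l2 X")
        case True
        then have "(\<lambda>x. g e * delta c x) \<in> l2 X" using that by (intro l2_scale) auto
        then show ?thesis using True by (simp add: matunit_apply op_scale_def algebra_simps)
      next
        case False
        then show ?thesis by (simp add: matunit_def op_scale_def)
      qed
    qed
    then have "op_scale (delta c b) (\<Phi> (?E a e)) = \<Phi> (?E a b) \<circ> \<Phi> (?E c e)"
      using that E by (simp add: comp[symmetric] scale)
    then show ?thesis by (metis (no_types, lifting) comp_apply op_scale_def)
  qed
  have swap: "l2inner Y f (\<Phi> (?E a b) g) = l2inner Y (\<Phi> (?E b a) f) g"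
    if "a \<in> X" "b \<in> X" "f \<in> l2 Y" "g \<in> l2 Y" for a b f g
    using l2inner_adjoint[OF bop[OF E[OF that(1,2)]] that(3,4)] adj[OF E[OF that(1,2)]]
      adjoint_matunit[OF that(1,2)] by simp
  have mem: "\<Phi> (?E a b) f \<in> l2 Y" if "a \<in> X" "b \<in> X" "f \<in> l2 Y" for a b f
    using bop[OF E[OF that(1,2)]] that(3) by (rule bounded_op_mem)
  let ?q = "\<Phi> (?E x0 x0)"
  \<comment> \<open>If \<open>?q\<close> annihilated every basis vector it would be zero, hence also
    the image of \<open>op_scale 0 (?E x0 x0)\<close>, against injectivity.\<close>
  have "\<exists>y\<in>Y. ?q (delta y) \<noteq> (\<lambda>_. 0)"
  proof (rule ccontr)
    assume "\<not> ?thesis"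
    then have q0: "?q f = (\<lambda>_. 0)" for f
      using bounded_op_eq_zeroI[OF bop[OF E[OF assms(4,4)]]] by blast
    have "\<Phi> (op_scale 0 (?E x0 x0)) = op_scale 0 ?q"
      using E[OF assms(4,4)] by (rule scale)
    also have "\<dots> = ?q" using q0 by (auto simp: op_scale_def)
    finally have "op_scale 0 (?E x0 x0) = ?E x0 x0"
      using bij E[OF assms(4,4)] uniform_roe_op_scale[OF E[OF assms(4,4)]]
      by (meson bij_betw_imp_inj_on inj_onD)
    then have "op_scale 0 (?E x0 x0) (delta x0) x0 = ?E x0 x0 (delta x0) x0" by simp
    then show False using assms(4) by (simp add: op_scale_def matunit_apply)
  qed
  then obtain y0 where y0: "y0 \<in> Y" "?q (delta y0) \<noteq> (\<lambda>_. 0)" by blast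
  define v where "v = ?q (delta y0)"
  have v: "v \<in> l2 Y" unfolding v_def using assms(4) y0 by (intro mem) auto
  have vn: "0 < l2norm Y v" using l2norm_eq_0[OF v] y0(2) l2norm_nonneg[of Y v]
    by (fastforce simp: v_def)
  have qv: "?q v = v" unfolding v_def using mult[of x0 x0 x0 x0] assms(4) by simp
  \<comment> \<open>Surjectivity pulls the rank-one projection at \<open>y0\<close> back to
    \<open>T\<close>. Compressing it by \<open>?q\<close> gives the rank-one operator of
    \<open>v\<close>, and by \<open>sandwich\<close> also a scalar multiple of \<open>?q\<close>; so
    \<open>?q\<close> itself has rank one.\<close>
  obtain T where T: "T \<in> ?A" "\<Phi> T = matunit Y y0 y0"
    using bij matunit_roe[OF y0(1,1)] by (metis bij_betw_imp_surj_on imageE)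
  have rank: "(\<lambda>y. l2inner Y v f * v y) = (\<lambda>y. entry T x0 x0 * ?q f y)" if f: "f \<in> l2 Y" for f
  proof -
    have qf: "?q f \<in> l2 Y" using assms(4) f by (intro mem)
    have "?q f y0 = l2inner Y (delta y0) (?q f)" using y0 by simp
    also have "\<dots> = l2inner Y v f" unfolding v_def using assms(4) y0 f by (intro swap) auto
    finally have e: "?q f y0 = l2inner Y v f" .
    have "?q (\<Phi> T (?q f)) = ?q (\<lambda>x. l2inner Y v f * delta y0 x)"
      using qf e by (simp add: T(2) matunit_apply)
    also have "\<dots> = (\<lambda>y. l2inner Y v f * v y)"
      unfolding v_def by (rule bounded_op_scale[OF bop[OF E[OF assms(4,4)]] delta_l2[OF y0(1)]])
    finally show ?thesis using sandwich[OF assms(4,4,4,4) T(1), of f] by simp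
  qed
  define \<xi>0 where "\<xi>0 = (\<lambda>y. of_real (1 / l2norm Y v) * v y)"
  \<comment> \<open>The scalar is found by evaluating \<open>rank\<close> at \<open>v\<close>, which
    \<open>?q\<close> fixes.\<close>
  have c: "entry T x0 x0 = of_real ((l2norm Y v)\<^sup>2)"
  proof -
    obtain y where y: "v y \<noteq> 0" using y0(2) unfolding v_def by fastforce
    have "l2inner Y v v * v y = entry T x0 x0 * v y" using rank[OF v] qv by metis
    then show ?thesis using y l2inner_self[OF v] by simp
  qed
  have \<xi>0: "\<xi>0 \<in> l2 Y" unfolding \<xi>0_def using v by (rule l2_scale)
  have in\<xi>0: "l2inner Y \<xi>0 f = of_real (1 / l2norm Y v) * l2inner Y v f" for f
    unfolding \<xi>0_def by (simp only: l2inner_scale_left complex_cnj_complex_of_real)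
  have q\<xi>: "?q f = (\<lambda>y. l2inner Y \<xi>0 f * \<xi>0 y)" if "f \<in> l2 Y" for f
  proof
    fix y
    have "l2inner Y v f * v y = of_real ((l2norm Y v)\<^sup>2) * ?q f y"
      using rank[OF that] c by metis
    then show "?q f y = l2inner Y \<xi>0 f * \<xi>0 y"
      unfolding in\<xi>0 using vn by (simp add: \<xi>0_def field_simps power2_eq_square)
  qed
  have q\<xi>0: "?q \<xi>0 = \<xi>0"
    unfolding \<xi>0_def bounded_op_scale[OF bop[OF E[OF assms(4,4)]] v] qv ..
  have n\<xi>0: "l2inner Y \<xi>0 \<xi>0 = 1"
    unfolding in\<xi>0 unfolding \<xi>0_def l2inner_scale_right
    using vn l2inner_self[OF v] by (simp add: power2_eq_square)
  \<comment> \<open>\<open>?E x x0\<close> moves \<open>delta x0\<close> to \<open>delta x\<close>,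
    so its image must move \<open>\<xi>0\<close> to the vector belonging to
    \<open>x\<close>.\<close>
  define \<xi> where "\<xi> x = \<Phi> (?E x x0) \<xi>0" for x
  have "spatial_basis X dX Y \<Phi> \<xi>"
    unfolding spatial_basis_def
  proof (intro conjI ballI)
    fix x assume x: "x \<in> X"
    show "\<xi> x \<in> l2 Y" unfolding \<xi>_def using x assms(4) \<xi>0 by (intro mem)
  next
    fix x x' assume x: "x \<in> X" "x' \<in> X"
    have "l2inner Y (\<xi> x) (\<xi> x') = l2inner Y \<xi>0 (\<Phi> (?E x0 x) (\<Phi> (?E x' x0) \<xi>0))"
      unfolding \<xi>_def using x assms(4) \<xi>0 by (intro swap[symmetric] mem)
    also have "\<dots> = delta x' x * l2inner Y \<xi>0 \<xi>0"
      using mult[OF assms(4) x assms(4)] q\<xi>0 by (simp add: l2inner_scale_right)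
    finally show "l2inner Y (\<xi> x) (\<xi> x') = (if x = x' then 1 else 0)"
      by (simp add: n\<xi>0 delta_def)
  next
    fix S x x' assume S: "S \<in> ?A" and x: "x \<in> X" "x' \<in> X"
    have "l2inner Y (\<xi> x) (\<Phi> S (\<xi> x')) = l2inner Y \<xi>0 (\<Phi> (?E x0 x) (\<Phi> S (\<Phi> (?E x' x0) \<xi>0)))"
      unfolding \<xi>_def using x assms(4) \<xi>0 bounded_op_mem[OF bop[OF S]]
      by (intro swap[symmetric] mem) (auto intro: mem)
    also have "\<dots> = entry S x x' * l2inner Y \<xi>0 \<xi>0"
      using sandwich[OF assms(4) x assms(4) S] q\<xi>0 by (simp add: l2inner_scale_right)
    finally show "l2inner Y (\<xi> x) (\<Phi> S (\<xi> x')) = entry S x x'" by (simp add: n\<xi>0)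
  next
    fix x x' f assume x: "x \<in> X" "x' \<in> X" and f: "f \<in> l2 Y"
    have m: "\<Phi> (?E x0 x') f \<in> l2 Y" using x assms(4) f by (intro mem)
    have "\<Phi> (?E x x') f = \<Phi> (?E x x0) (?q (\<Phi> (?E x0 x') f))"
      using mult[OF x(1) assms(4) assms(4) x(2)] mult[OF assms(4) assms(4) assms(4) x(2)] by simp
    also have "\<dots> = \<Phi> (?E x x0) (\<lambda>y. l2inner Y \<xi>0 (\<Phi> (?E x0 x') f) * \<xi>0 y)"
      using q\<xi>[OF m] by simp
    also have "\<dots> = (\<lambda>y. l2inner Y \<xi>0 (\<Phi> (?E x0 x') f) * \<xi> x y)"
      unfolding \<xi>_def by (rule bounded_op_scale[OF bop[OF E[OF x(1) assms(4)]] \<xi>0])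
    also have "l2inner Y \<xi>0 (\<Phi> (?E x0 x') f) = l2inner Y (\<xi> x') f"
      unfolding \<xi>_def using x assms(4) \<xi>0 f by (intro swap)
    finally show "\<Phi> (?E x x') f = (\<lambda>y. l2inner Y (\<xi> x') f * \<xi> x y)" .
  qed
  then show thesis by (rule that)
qed

text \<open>The entry \<open>u y x\<close> is the \<open>(y, x)\<close> entry of a unitary \<open>U\<close> from \<open>l2 X\<close> to \<open>l2 Y\<close>
  such that \<open>T \<mapsto> U T U\<^sup>*\<close> maps the Roe algebra of \<open>X\<close> onto that of \<open>Y\<close>.\<close>

definition unitary_impl :: "'a set \<Rightarrow> ('a \<Rightarrow> 'a \<Rightarrow> real) \<Rightarrow> 'b set \<Rightarrow> ('b \<Rightarrow> 'b \<Rightarrow> real)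
    \<Rightarrow> ('b \<Rightarrow> 'a \<Rightarrow> complex) \<Rightarrow> bool" where
  "unitary_impl X dX Y dY u \<longleftrightarrow>
     (\<forall>x\<in>X. (\<lambda>y. u y x) \<in> l2 Y) \<and>
     (\<forall>y\<in>Y. (\<lambda>x. cnj (u y x)) \<in> l2 X) \<and>
     (\<forall>x\<in>X. \<forall>x'\<in>X. l2inner Y (\<lambda>y. u y x) (\<lambda>y. u y x') = (if x = x' then 1 else 0)) \<and>
     (\<forall>y\<in>Y. \<forall>y'\<in>Y. l2inner X (\<lambda>x. cnj (u y x)) (\<lambda>x. cnj (u y' x)) = (if y = y' then 1 else 0)) \<and>
     (\<forall>T\<in>uniform_roe X dX. \<exists>S\<in>uniform_roe Y dY.
        (\<forall>y\<in>Y. \<forall>y'\<in>Y. entry S y y' = l2inner X (\<lambda>x. cnj (u y x)) (T (\<lambda>x. cnj (u y' x)))) \<and>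
        (\<forall>x\<in>X. \<forall>x'\<in>X. entry T x x' = l2inner Y (\<lambda>y. u y x) (S (\<lambda>y. u y x')))) \<and>
     (\<forall>S\<in>uniform_roe Y dY. \<exists>T\<in>uniform_roe X dX.
        (\<forall>x\<in>X. \<forall>x'\<in>X. entry T x x' = l2inner Y (\<lambda>y. u y x) (S (\<lambda>y. u y x'))) \<and>
        (\<forall>y\<in>Y. \<forall>y'\<in>Y. entry S y y' = l2inner X (\<lambda>x. cnj (u y x)) (T (\<lambda>x. cnj (u y' x)))))"

text \<open>The clauses are chosen to be permuted by conjugate transposition, so that every
  statement about rows yields one about columns.\<close>

lemma unitary_impl_swap:
  "unitary_impl X dX Y dY u \<Longrightarrow> unitary_impl Y dY X dX (\<lambda>x y. cnj (u y x))"
  unfolding unitary_impl_def complex_cnj_cnj by (elim conjE, intro conjI) assumption+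

text \<open>Over the empty set every operator is zero, whereas a point of \<open>Y\<close> yields a
  non-zero matrix unit. This settles the case in which there is no base point from which to build a
  basis.\<close>

lemma roe_iso_empty:
  assumes "roe_iso {} dX Y dY \<Phi>"
  shows "Y = {}"
proof (rule ccontr)
  assume "Y \<noteq> {}"
  then obtain y where y: "y \<in> Y" by blast
  let ?E = "matunit Y y y"
  have E: "?E \<in> uniform_roe Y dY" using y y by (rule matunit_roe)
  have bij: "bij_betw \<Phi> (uniform_roe {} dX) (uniform_roe Y dY)"
    using assms by (simp add: roe_iso_def)
  have eq: "S = T" if "S \<in> uniform_roe {} dX" "T \<in> uniform_roe {} dX" for S T
  proof -
    have "T' f x = 0" if "T' \<in> uniform_roe {} dX" for T' f x
    proof (cases "f \<in> l2 {}")
      case True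
      then show ?thesis
        using l2_outside[OF bounded_op_mem[OF uniform_roe_bounded[OF that] True]] by simp
    next
      case False
      then show ?thesis using bounded_op_outside[OF uniform_roe_bounded[OF that]] by simp
    qed
    then show ?thesis using that by (intro ext) metis
  qed
  obtain S where S: "S \<in> uniform_roe {} dX" "\<Phi> S = ?E"
    using bij E by (metis bij_betw_imp_surj_on imageE)
  obtain T where T: "T \<in> uniform_roe {} dX" "\<Phi> T = op_scale 0 ?E"
    using bij uniform_roe_op_scale[OF E] by (metis bij_betw_imp_surj_on imageE)
  have "?E = op_scale 0 ?E" using S T eq[OF S(1) T(1)] by simp
  then have "?E (delta y) y = op_scale 0 ?E (delta y) y" by simp
  then show False using y by (simp add: op_scale_def matunit_apply)
qed

text \<open>Row orthonormality encodes completeness of the columns and is taken from the basis of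
  the inverse isomorphism. As the two bases are built independently, what remains is to match
  them.\<close>

lemma roe_iso_imp_unitary_impl:
  assumes "Metric_space X dX" "Metric_space Y dY" "roe_iso X dX Y dY \<Phi>" "X \<noteq> {}"
  obtains u where "unitary_impl X dX Y dY u"
proof -
  let ?A = "uniform_roe X dX" and ?B = "uniform_roe Y dY"
  define \<Psi> where "\<Psi> = inv_into ?A \<Phi>"
  have \<Psi>: "roe_iso Y dY X dX \<Psi>" unfolding \<Psi>_def using assms(1,3) by (rule roe_iso_inverse)
  have bij: "bij_betw \<Phi> ?A ?B" using assms(3) by (simp add: roe_iso_def)
  have \<Psi>A: "\<Psi> S \<in> ?A" if "S \<in> ?B" for S
    unfolding \<Psi>_def using that bij by (simp add: bij_betw_def inv_into_into)
  have \<Phi>B: "\<Phi> T \<in> ?B" if "T \<in> ?A" for T using that bij by (auto dest: bij_betwE)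
  have \<Phi>\<Psi>: "\<Phi> (\<Psi> S) = S" if "S \<in> ?B" for S
    unfolding \<Psi>_def using that bij by (simp add: bij_betw_inv_into_right)
  have \<Psi>\<Phi>: "\<Psi> (\<Phi> T) = T" if "T \<in> ?A" for T
    unfolding \<Psi>_def using that bij by (simp add: bij_betw_inv_into_left)
  obtain x0 where x0: "x0 \<in> X" using assms(4) by blast
  obtain \<xi> where sb: "spatial_basis X dX Y \<Phi> \<xi>"
    using roe_iso_basis[OF assms(1-3) x0] .
  have \<xi>: "\<And>x. x \<in> X \<Longrightarrow> \<xi> x \<in> l2 Y"
    "\<And>x x'. x \<in> X \<Longrightarrow> x' \<in> X \<Longrightarrow> l2inner Y (\<xi> x) (\<xi> x') = (if x = x' then 1 else 0)"
    "\<And>T x x'. T \<in> ?A \<Longrightarrow> x \<in> X \<Longrightarrow> x' \<in> X \<Longrightarrow> l2inner Y (\<xi> x) (\<Phi> T (\<xi> x')) = entry T x x'"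
    using sb by (simp_all add: spatial_basis_def)
  have "\<xi> x0 \<noteq> (\<lambda>_. 0)" using \<xi>(2)[OF x0 x0] by auto
  then obtain y0 where y0: "\<xi> x0 y0 \<noteq> 0" by auto
  then have y0Y: "y0 \<in> Y" using \<xi>(1)[OF x0] by (metis l2_outside)
  obtain \<zeta> where sb': "spatial_basis Y dY X \<Psi> \<zeta>"
    using roe_iso_basis[OF assms(2,1) \<Psi> y0Y] .
  have \<zeta>: "\<And>y. y \<in> Y \<Longrightarrow> \<zeta> y \<in> l2 X"
    "\<And>y y'. y \<in> Y \<Longrightarrow> y' \<in> Y \<Longrightarrow> l2inner X (\<zeta> y) (\<zeta> y') = (if y = y' then 1 else 0)"
    "\<And>S y y'. S \<in> ?B \<Longrightarrow> y \<in> Y \<Longrightarrow> y' \<in> Y \<Longrightarrow> l2inner X (\<zeta> y) (\<Psi> S (\<zeta> y')) = entry S y y'"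
    "\<And>y y' f. y \<in> Y \<Longrightarrow> y' \<in> Y \<Longrightarrow> f \<in> l2 X \<Longrightarrow>
      \<Psi> (matunit Y y y') f = (\<lambda>x. l2inner X (\<zeta> y') f * \<zeta> y x)"
    using sb' by (simp_all add: spatial_basis_def)
  \<comment> \<open>Both sides compute the entry at \<open>(x0, x)\<close> of the preimage of
    \<open>matunit Y y0 y\<close>, once with each basis.\<close>
  have rel: "\<xi> x y * cnj (\<xi> x0 y0) = cnj (\<zeta> y x) * \<zeta> y0 x0" if x: "x \<in> X" and y: "y \<in> Y" for x y
  proof -
    have E: "matunit Y y0 y \<in> ?B" using y0Y y by (rule matunit_roe)
    have "\<xi> x y * cnj (\<xi> x0 y0) = l2inner Y (\<xi> x0) (matunit Y y0 y (\<xi> x))"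
      using \<xi>(1)[OF x] y0Y by (simp add: matunit_apply l2inner_scale_right)
    also have "\<dots> = entry (\<Psi> (matunit Y y0 y)) x0 x"
      using \<xi>(3)[OF \<Psi>A[OF E] x0 x] \<Phi>\<Psi>[OF E] by simp
    also have "\<dots> = cnj (\<zeta> y x) * \<zeta> y0 x0"
      using \<zeta>(4)[OF y0Y y, of "delta x"] x by (simp add: entry_def)
    finally show ?thesis .
  qed
  \<comment> \<open>Each basis is determined only up to a phase. \<open>c\<close> is the phase
    between them, read off at the reference entry \<open>(x0, y0)\<close>, which is non-zero by the
    choice of \<open>y0\<close>; the moduli there agree by \<open>rel\<close> itself.\<close>
  define c where "c = cnj (\<zeta> y0 x0) / \<xi> x0 y0"
  have z: "cnj (\<xi> x y) = c * \<zeta> y x" if "x \<in> X" "y \<in> Y" for x y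
    using arg_cong[OF rel[OF that], of cnj] y0 by (simp add: c_def field_simps)
  have "cmod (\<xi> x0 y0) * cmod (\<xi> x0 y0) = cmod (\<zeta> y0 x0) * cmod (\<zeta> y0 x0)"
    using arg_cong[OF rel[OF x0 y0Y], of cmod] by (simp add: norm_mult)
  then have "cmod (\<xi> x0 y0) = cmod (\<zeta> y0 x0)"
    by (simp add: abs_eq_iff flip: power2_eq_square power2_eq_iff)
  then have "cmod c = 1" using y0 by (auto simp: c_def norm_divide)
  then have cc: "cnj c * c = 1"
    by (metis complex_norm_square mult.commute of_real_1 power_one)
  \<comment> \<open>The value 0 off \<open>X\<close> makes the rows vanish there, as membership in
    \<open>l2 X\<close> demands.\<close>
  define u where "u y x = (if x \<in> X then \<xi> x y else 0)" for y x
  have u\<xi>: "(\<lambda>y. u y x) = \<xi> x" if "x \<in> X" for x using that by (simp add: u_def)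
  have u\<zeta>: "(\<lambda>x. cnj (u y x)) = (\<lambda>x. c * \<zeta> y x)" if "y \<in> Y" for y
    using z[OF _ that] l2_outside[OF \<zeta>(1)[OF that]] by (intro ext) (simp add: u_def)
  have cinner: "l2inner X (\<lambda>x. c * f x) (\<lambda>x. c * g x) = l2inner X f g" for f g
    using cc by (simp add: l2inner_scale_left l2inner_scale_right mult.assoc[symmetric] mult.commute)
  have op: "l2inner X (\<lambda>x. c * \<zeta> y x) (T (\<lambda>x. c * \<zeta> y' x)) = entry S y y'"
    if "T \<in> ?A" "S = \<Phi> T" "y \<in> Y" "y' \<in> Y" for T S y y'
  proof -
    have "T (\<lambda>x. c * \<zeta> y' x) = (\<lambda>x. c * T (\<zeta> y') x)"
      by (rule bounded_op_scale[OF uniform_roe_bounded[OF that(1)] \<zeta>(1)[OF that(4)]])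
    then show ?thesis
      using cinner \<zeta>(3)[OF \<Phi>B[OF that(1)] that(3,4)] \<Psi>\<Phi>[OF that(1)] that(2) by simp
  qed
  have "unitary_impl X dX Y dY u"
    unfolding unitary_impl_def
  proof (intro conjI ballI)
    fix T assume T: "T \<in> ?A"
    show "\<exists>S\<in>?B. (\<forall>y\<in>Y. \<forall>y'\<in>Y. entry S y y' = l2inner X (\<lambda>x. cnj (u y x)) (T (\<lambda>x. cnj (u y' x)))) \<and>
        (\<forall>x\<in>X. \<forall>x'\<in>X. entry T x x' = l2inner Y (\<lambda>y. u y x) (S (\<lambda>y. u y x')))"
      using T \<Phi>B[OF T] \<xi>(3)[OF T] op[OF T]
      by (intro bexI[of _ "\<Phi> T"]) (auto simp: u\<xi> u\<zeta>)
  next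
    fix S assume S: "S \<in> ?B"
    show "\<exists>T\<in>?A. (\<forall>x\<in>X. \<forall>x'\<in>X. entry T x x' = l2inner Y (\<lambda>y. u y x) (S (\<lambda>y. u y x'))) \<and>
        (\<forall>y\<in>Y. \<forall>y'\<in>Y. entry S y y' = l2inner X (\<lambda>x. cnj (u y x)) (T (\<lambda>x. cnj (u y' x))))"
      using \<Psi>A[OF S] \<Phi>\<Psi>[OF S] \<xi>(3)[OF \<Psi>A[OF S]] op[OF \<Psi>A[OF S]]
      by (intro bexI[of _ "\<Psi> S"]) (auto simp: u\<xi> u\<zeta>)
  qed (use \<xi> \<zeta> in \<open>auto simp: u\<xi> u\<zeta> l2_scale cinner\<close>)
  then show thesis by (rule that)
qed

section \<open>Combinatorial lemmas\<close>

text \<open>The Baire category theorem for the product space of subsets: basic open sets prescribe a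
  subset on a finite window, \<open>closed\<close> says that each \<open>P n\<close> is closed, and
  the conclusion is that some \<open>P n\<close> contains a basic open set. Otherwise nested windows
  could be chosen that avoid \<open>P 0\<close>, \<open>P 1\<close> and so on in turn.\<close>

lemma powerset_Baire:
  fixes P :: "nat \<Rightarrow> 'a set \<Rightarrow> bool"
  assumes cover: "\<And>A. \<exists>n. P n A"
    and closed: "\<And>n A. \<not> P n A \<Longrightarrow> \<exists>F. finite F \<and> (\<forall>A'. A' \<inter> F = A \<inter> F \<longrightarrow> \<not> P n A')"
  shows "\<exists>n F E. finite F \<and> (\<forall>A. A \<inter> F = E \<inter> F \<longrightarrow> P n A)"
proof (rule ccontr)
  assume neg: "\<not> ?thesis"
  have no: "\<exists>A. A \<inter> F = E \<inter> F \<and> \<not> P n A" if "finite F" for n F E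
    using neg that by auto
  \<comment> \<open>A state consists of a finite window and a pattern. A step keeps the old pattern
    on the old window and enlarges the window until no subset with the new pattern satisfies
    \<open>P n\<close>.\<close>
  let ?good = "\<lambda>(n::nat) (p :: 'a set \<times> 'a set). finite (fst p)"
  let ?step = "\<lambda>n p q. fst p \<subseteq> fst q \<and> snd q \<inter> fst p = snd p \<inter> fst p \<and>
    (\<forall>A. A \<inter> fst q = snd q \<inter> fst q \<longrightarrow> \<not> P n A)"
  have "\<exists>f. \<forall>n. ?good n (f n) \<and> ?step n (f n) (f (Suc n))"
  proof (rule dependent_nat_choice)
    show "\<exists>p. ?good 0 p" by (auto intro: exI[of _ "({}, {})"])
    fix p n assume p: "?good n p"
    obtain A where A: "A \<inter> fst p = snd p \<inter> fst p" "\<not> P n A"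
      using no[OF p, of "snd p" n] by blast
    obtain F where F: "finite F" "\<And>A'. A' \<inter> F = A \<inter> F \<Longrightarrow> \<not> P n A'" using closed[OF A(2)] by blast
    have "\<not> P n A'" if "A' \<inter> (fst p \<union> F) = A \<inter> (fst p \<union> F)" for A'
      using F(2)[of A'] that by blast
    then show "\<exists>q. ?good (Suc n) q \<and> ?step n p q"
      using p A(1) F(1) by (intro exI[of _ "(fst p \<union> F, A)"]) auto
  qed
  then obtain f where f0: "\<forall>n. ?good n (f n) \<and> ?step n (f n) (f (Suc n))" ..
  have f: "?step n (f n) (f (Suc n))" for n
    by (rule spec[OF f0, of n, THEN conjunct2])
  define F where "F n = fst (f n)" for n
  define E where "E n = snd (f n)" for n
  have F_mono: "F n \<subseteq> F m" if "n \<le> m" for n m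
    using lift_Suc_mono_le[of F, OF _ that] f by (simp add: F_def)
  have E_stable: "E m \<inter> F n = E n \<inter> F n" if "n \<le> m" for n m
    using that
  proof (induction m rule: dec_induct)
    case (step m)
    have "E (Suc m) \<inter> F m = E m \<inter> F m" using f[of m] by (simp add: E_def F_def)
    moreover have "F n \<subseteq> F m" using step F_mono by simp
    ultimately show ?case using step by blast
  qed simp
  \<comment> \<open>The patterns are stable on each window, so their union realises all of them at
    once and escapes every \<open>P n\<close>.\<close>
  define A where "A = (\<Union>n. E n \<inter> F n)"
  have A: "A \<inter> F n = E n \<inter> F n" for n
  proof
    show "A \<inter> F n \<subseteq> E n \<inter> F n"
    proof
      fix x assume "x \<in> A \<inter> F n"
      then obtain m where x: "x \<in> E m" "x \<in> F m" "x \<in> F n" by (auto simp: A_def)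
      then show "x \<in> E n \<inter> F n"
        using E_stable[of m n] E_stable[of n m] by (cases "m \<le> n") auto
    qed
  qed (auto simp: A_def)
  have "\<not> P n A" for n using f[of n] A[of "Suc n"] by (simp add: E_def F_def)
  then show False using cover by blast
qed

text \<open>For independent uniform signs the mixed terms cancel in the mean, so the right-hand side
  is the mean of the left-hand side and some choice stays below it. The induction fixes one sign at
  a time by the parallelogram law, with \<open>c\<close> absorbing the signs already fixed;
  \<open>B\<close> collects the indices with sign -1.\<close>

lemma sign_balancing:
  fixes a :: "'a \<Rightarrow> 'b \<Rightarrow> complex"
  assumes "finite G"
  shows "\<exists>B\<subseteq>G. (\<Sum>z\<in>K. (cmod (c z + (\<Sum>x\<in>G. (if x \<in> B then -1 else 1) * a x z)))\<^sup>2)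
    \<le> (\<Sum>z\<in>K. (cmod (c z))\<^sup>2) + (\<Sum>x\<in>G. \<Sum>z\<in>K. (cmod (a x z))\<^sup>2)"
  using assms
proof (induction G arbitrary: c)
  case (insert x G)
  have par: "(cmod (v + w))\<^sup>2 + (cmod (v + - w))\<^sup>2 = 2 * (cmod v)\<^sup>2 + 2 * (cmod w)\<^sup>2" for v w
    unfolding cmod_power2 by (simp add: power2_eq_square algebra_simps)
  have "(\<Sum>z\<in>K. (cmod (c z + a x z))\<^sup>2) + (\<Sum>z\<in>K. (cmod (c z + - a x z))\<^sup>2)
      = 2 * ((\<Sum>z\<in>K. (cmod (c z))\<^sup>2) + (\<Sum>z\<in>K. (cmod (a x z))\<^sup>2))"
    by (simp only: sum.distrib[symmetric] par) (simp add: sum.distrib sum_distrib_left)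
  then obtain s :: complex where s: "s = 1 \<or> s = -1"
    "(\<Sum>z\<in>K. (cmod (c z + s * a x z))\<^sup>2) \<le> (\<Sum>z\<in>K. (cmod (c z))\<^sup>2) + (\<Sum>z\<in>K. (cmod (a x z))\<^sup>2)"
    by (smt (verit, best) mult_1 mult_minus1 sum.cong)
  obtain B where B: "B \<subseteq> G"
    "(\<Sum>z\<in>K. (cmod (c z + s * a x z + (\<Sum>x\<in>G. (if x \<in> B then -1 else 1) * a x z)))\<^sup>2)
      \<le> (\<Sum>z\<in>K. (cmod (c z + s * a x z))\<^sup>2) + (\<Sum>x\<in>G. \<Sum>z\<in>K. (cmod (a x z))\<^sup>2)"
    using insert.IH[of "\<lambda>z. c z + s * a x z"] by blast
  define B' where "B' = (if s = 1 then B else insert x B)"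
  have "(\<Sum>x\<in>insert x G. (if x \<in> B' then -1 else 1) * a x z)
      = s * a x z + (\<Sum>x\<in>G. (if x \<in> B then -1 else 1) * a x z)" for z
  proof -
    have "(if x \<in> B' then -1 else 1) = s" using s(1) B(1) insert(2) by (auto simp: B'_def)
    moreover have "(\<Sum>x\<in>G. (if x \<in> B' then -1 else 1) * a x z)
        = (\<Sum>x\<in>G. (if x \<in> B then -1 else 1) * a x z)"
      using insert(2) by (intro sum.cong) (auto simp: B'_def)
    ultimately show ?thesis using insert(1,2) by simp
  qed
  moreover have "B' \<subseteq> insert x G" using B(1) by (auto simp: B'_def)
  ultimately show ?case
    using B(2) s(2) insert(1,2) by (intro exI[of _ B']) (simp add: add.assoc)
qed simp

text \<open>Pairing each \<open>B\<close> that avoids \<open>x\<close> with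
  \<open>insert x B\<close> leaves \<open>- c x\<close> for each of the
  \<open>2 ^ (card A - 1)\<close> pairs. It is the Fourier coefficient of an additive set function
  at the sign of \<open>x\<close>.\<close>

lemma signed_subset_sum:
  fixes c :: "'a \<Rightarrow> complex"
  assumes "finite A" "x \<in> A"
  shows "(\<Sum>B\<in>Pow A. (if x \<in> B then -1 else 1) * (\<Sum>i\<in>B. c i)) = - (2 ^ (card A - 1) * c x)"
proof -
  define A' where "A' = A - {x}"
  have A': "A = insert x A'" "x \<notin> A'" "finite A'" using assms by (auto simp: A'_def)
  have inj: "inj_on (insert x) (Pow A')" using A'(2) by (auto simp: inj_on_def)
  have "(\<Sum>B\<in>Pow A. (if x \<in> B then -1 else 1) * (\<Sum>i\<in>B. c i))
      = (\<Sum>B\<in>Pow A'. (if x \<in> B then -1 else 1) * (\<Sum>i\<in>B. c i))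
        + (\<Sum>B\<in>insert x ` Pow A'. (if x \<in> B then -1 else 1) * (\<Sum>i\<in>B. c i))"
    unfolding A'(1) Pow_insert using A' by (intro sum.union_disjoint) auto
  also have "\<dots> = (\<Sum>B\<in>Pow A'. (\<Sum>i\<in>B. c i)) + (\<Sum>B\<in>Pow A'. - (\<Sum>i\<in>insert x B. c i))"
    unfolding sum.reindex[OF inj] using A'(2) by (intro arg_cong2[where f="(+)"] sum.cong) auto
  also have "\<dots> = (\<Sum>B\<in>Pow A'. (\<Sum>i\<in>B. c i) - (\<Sum>i\<in>insert x B. c i))"
    by (simp add: sum_negf sum_subtractf)
  also have "\<dots> = (\<Sum>B\<in>Pow A'. - c x)"
  proof (rule sum.cong)
    fix B assume "B \<in> Pow A'"
    then have "finite B" "x \<notin> B" using A' finite_subset by auto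
    then show "(\<Sum>i\<in>B. c i) - (\<Sum>i\<in>insert x B. c i) = - c x" by simp
  qed simp
  also have "\<dots> = - (2 ^ (card A - 1) * c x)" using A' by (simp add: card_Pow)
  finally show ?thesis .
qed

text \<open>Gaussian elimination, one equation at a time: a pivot \<open>x0\<close> of equation
  \<open>y\<close> is eliminated from the others, and the coefficient \<open>g0\<close> of the pivot
  is then forced by that equation.\<close>

lemma underdetermined_nontrivial_solution:
  fixes M :: "'b \<Rightarrow> 'a \<Rightarrow> complex"
  assumes "finite N" "finite A" "card N < card A"
  shows "\<exists>g. (\<exists>x\<in>A. g x \<noteq> 0) \<and> (\<forall>y\<in>N. (\<Sum>x\<in>A. g x * M y x) = 0)"
  using assms
proof (induction N arbitrary: A M)
  case empty
  then have "A \<noteq> {}" by auto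
  then show ?case by (intro exI[of _ "\<lambda>_. 1"]) auto
next
  case (insert y N)
  show ?case
  proof (cases "\<forall>x\<in>A. M y x = 0")
    case True
    have "card N < card A" using insert by simp
    then obtain g where "\<exists>x\<in>A. g x \<noteq> 0" "\<forall>y\<in>N. (\<Sum>x\<in>A. g x * M y x) = 0"
      using insert.IH[OF insert.prems(1)] by blast
    then show ?thesis using True by (intro exI[of _ g]) auto
  next
    case False
    then obtain x0 where x0: "x0 \<in> A" "M y x0 \<noteq> 0" by blast
    define A' where "A' = A - {x0}"
    have A': "A = insert x0 A'" "x0 \<notin> A'" "finite A'" using insert.prems x0 by (auto simp: A'_def)
    have "card N < card A'" using insert.prems insert.hyps A' by simp
    then obtain g where g: "\<exists>x\<in>A'. g x \<noteq> 0"
      "\<forall>z\<in>N. (\<Sum>x\<in>A'. g x * (M z x - M z x0 * M y x / M y x0)) = 0"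
      using insert.IH[OF A'(3), of "\<lambda>z x. M z x - M z x0 * M y x / M y x0"] by blast
    define g0 where "g0 = - (\<Sum>x\<in>A'. g x * M y x) / M y x0"
    define h where "h = g(x0 := g0)"
    have h: "(\<Sum>x\<in>A. h x * M z x) = g0 * M z x0 + (\<Sum>x\<in>A'. g x * M z x)" for z
    proof -
      have "(\<Sum>x\<in>A'. h x * M z x) = (\<Sum>x\<in>A'. g x * M z x)"
        using A'(2) by (intro sum.cong) (auto simp: h_def)
      then show ?thesis using A' by (simp add: h_def)
    qed
    have "(\<Sum>x\<in>A. h x * M y x) = 0" using x0(2) by (simp add: h g0_def)
    moreover have "(\<Sum>x\<in>A. h x * M z x) = 0" if "z \<in> N" for z
    proof -
      have "0 = (\<Sum>x\<in>A'. g x * (M z x - M z x0 * M y x / M y x0))"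
        using g(2) that by simp
      also have "\<dots> = (\<Sum>x\<in>A'. g x * M z x - M z x0 / M y x0 * (g x * M y x))"
        by (rule sum.cong) (auto simp: algebra_simps)
      also have "\<dots> = (\<Sum>x\<in>A'. g x * M z x) - M z x0 / M y x0 * (\<Sum>x\<in>A'. g x * M y x)"
        by (simp only: sum_subtractf sum_distrib_left)
      also have "\<dots> = (\<Sum>x\<in>A. h x * M z x)" by (simp add: h g0_def algebra_simps)
      finally show ?thesis by simp
    qed
    moreover have "\<exists>x\<in>A. h x \<noteq> 0" using g(1) A' by (auto simp: h_def)
    ultimately show ?thesis by blast
  qed
qed

text \<open>Rado's proof of the marriage theorem: in a minimal subfamily satisfying Hall's condition
  every set is a singleton, by submodularity of the cardinality of unions.\<close>

lemma hall_rado: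
  fixes S :: "'a \<Rightarrow> 'b set"
  assumes fin: "\<And>x. x \<in> X \<Longrightarrow> finite (S x)"
    and hall: "\<And>A. finite A \<Longrightarrow> A \<subseteq> X \<Longrightarrow> card A \<le> card (\<Union>x\<in>A. S x)"
  obtains g where "inj_on g X" "\<And>x. x \<in> X \<Longrightarrow> g x \<in> S x"
proof -
  define Q where "Q T \<longleftrightarrow> (\<forall>A. finite A \<longrightarrow> A \<subseteq> X \<longrightarrow> card A \<le> card (T `` A))" for T :: "('a \<times> 'b) set"
  let ?P = "Sigma X S"
  have finP: "finite (T `` A)" if "finite A" "A \<subseteq> X" "T \<subseteq> ?P" for T A
  proof -
    have "T `` A \<subseteq> (\<Union>x\<in>A. S x)" using that by auto
    moreover have "finite (\<Union>x\<in>A. S x)" using that fin by auto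
    ultimately show ?thesis by (rule finite_subset)
  qed
  \<comment> \<open>Zorn's lemma is applied to the set \<open>K\<close> of deleted pairs. Over a
    finite \<open>A\<close> there are finitely many pairs, since the sets \<open>S x\<close> are
    finite, and a finite part of the union of a chain lies in one member; so Hall's condition passes
    to the union.\<close>
  have "\<exists>K\<in>{K. Q (?P - K)}. \<forall>L\<in>{K. Q (?P - K)}. K \<subseteq> L \<longrightarrow> L = K"
  proof (rule subset_Zorn')
    fix C assume C: "subset.chain {K. Q (?P - K)} C"
    show "\<Union>C \<in> {K. Q (?P - K)}"
    proof (cases "C = {}")
      case True
      have "?P `` A = (\<Union>x\<in>A. S x)" if "A \<subseteq> X" for A using that by auto
      then show ?thesis using True hall by (simp add: Q_def)
    next
      case False
      have "card A \<le> card ((?P - \<Union>C) `` A)" if A: "finite A" "A \<subseteq> X" for A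
      proof -
        have "finite (Sigma A S)" using A fin by auto
        then have "finite (\<Union>C \<inter> Sigma A S)" by simp
        then obtain K where K: "K \<in> C" "\<Union>C \<inter> Sigma A S \<subseteq> K"
          by (rule finite_subset_Union_chain[OF _ _ False C]) auto
        have "(?P - K) `` A \<subseteq> (?P - \<Union>C) `` A" using K(2) A by blast
        then have "card ((?P - K) `` A) \<le> card ((?P - \<Union>C) `` A)"
          using A by (intro card_mono finP) auto
        moreover have "card A \<le> card ((?P - K) `` A)"
          using C K(1) A unfolding subset.chain_def Q_def by blast
        ultimately show ?thesis by linarith
      qed
      then show ?thesis by (simp add: Q_def)
    qed
  qed
  then obtain K where K: "Q (?P - K)" "\<And>L. Q (?P - L) \<Longrightarrow> K \<subseteq> L \<Longrightarrow> L = K" by auto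
  define T where "T = ?P - K"
  have T: "T \<subseteq> ?P" by (auto simp: T_def)
  have QT: "card A \<le> card (T `` A)" if "finite A" "A \<subseteq> X" for A
    using K(1) that by (simp add: Q_def T_def)
  have fT: "finite (T `` A)" if "finite A" "A \<subseteq> X" for A using that T by (rule finP)
  have removal: "\<exists>A. finite A \<and> A \<subseteq> X \<and> x \<in> A \<and> card (T `` (A - {x}) \<union> (T `` {x} - {y})) < card A"
    if "(x, y) \<in> T" for x y
  proof -
    have "?P - insert (x, y) K = T - {(x, y)}" by (auto simp: T_def)
    moreover have "insert (x, y) K \<noteq> K" using that by (auto simp: T_def)
    ultimately have "\<not> Q (T - {(x, y)})" using K(2)[of "insert (x, y) K"] by auto
    then obtain A where A: "finite A" "A \<subseteq> X" "card ((T - {(x, y)}) `` A) < card A"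
      unfolding Q_def by (auto simp: not_le)
    have "x \<in> A"
    proof (rule ccontr)
      assume "x \<notin> A"
      then have "(T - {(x, y)}) `` A = T `` A" by auto
      then show False using A QT[OF A(1,2)] by simp
    qed
    moreover from this have "(T - {(x, y)}) `` A = T `` (A - {x}) \<union> (T `` {x} - {y})" by auto
    ultimately show ?thesis using A by auto
  qed
  have single: "y1 = y2" if y: "(x, y1) \<in> T" "(x, y2) \<in> T" for x y1 y2
  proof (rule ccontr)
    assume ne: "y1 \<noteq> y2"
    obtain A1 where A1: "finite A1" "A1 \<subseteq> X" "x \<in> A1"
      "card (T `` (A1 - {x}) \<union> (T `` {x} - {y1})) < card A1" (is "card ?P1 < _")
      using removal[OF y(1)] by blast
    obtain A2 where A2: "finite A2" "A2 \<subseteq> X" "x \<in> A2"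
      "card (T `` (A2 - {x}) \<union> (T `` {x} - {y2})) < card A2" (is "card ?P2 < _")
      using removal[OF y(2)] by blast
    have x: "x \<in> X" using A1 by auto
    have f: "finite ?P1" "finite ?P2" 
      using fT[of "A1 - {x}"] fT[of "A2 - {x}"] fT[of "{x}"] A1 A2 x by auto
    \<comment> \<open>The only neighbour of \<open>x\<close> deleted on the left is
      \<open>y1\<close>, and it is present on the right because it differs from
      \<open>y2\<close>.\<close>
    have "T `` (A1 \<union> A2) \<subseteq> ?P1 \<union> ?P2" using ne by blast
    then have "card (T `` (A1 \<union> A2)) \<le> card (?P1 \<union> ?P2)" using f by (intro card_mono) auto
    then have 1: "card (A1 \<union> A2) \<le> card (?P1 \<union> ?P2)"
      using QT[of "A1 \<union> A2"] A1 A2 by simp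
    \<comment> \<open>Dropping \<open>x\<close> from the intersection costs 1, but \<open>A1\<close>
      and \<open>A2\<close> each fall short of Hall's condition by at least 1, so adding the bounds
      for union and intersection is contradictory.\<close>
    have "T `` (A1 \<inter> A2 - {x}) \<subseteq> ?P1 \<inter> ?P2" by blast
    then have "card (T `` (A1 \<inter> A2 - {x})) \<le> card (?P1 \<inter> ?P2)" using f by (intro card_mono) auto
    moreover have "card (A1 \<inter> A2 - {x}) \<le> card (T `` (A1 \<inter> A2 - {x}))"
      using A1 A2 by (intro QT) auto
    moreover have "card (A1 \<inter> A2 - {x}) = card (A1 \<inter> A2) - 1" "card (A1 \<inter> A2) > 0"
      using A1 A2 by (auto simp: card_gt_0_iff)
    ultimately have 2: "card (A1 \<inter> A2) \<le> card (?P1 \<inter> ?P2) + 1" by linarith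
    show False
      using 1 2 card_Un_Int[OF f] card_Un_Int[OF A1(1) A2(1)] A1(4) A2(4) by linarith
  qed
  have ex: "\<exists>y. (x, y) \<in> T" if "x \<in> X" for x
  proof -
    have "T `` {x} \<noteq> {}" using QT[of "{x}"] that by auto
    then show ?thesis by blast
  qed
  define g where "g x = (SOME y. (x, y) \<in> T)" for x
  have g: "(x, g x) \<in> T" if "x \<in> X" for x
    unfolding g_def using ex[OF that] by (rule someI_ex)
  have "inj_on g X"
  proof (rule inj_onI, rule ccontr)
    fix x x' assume x: "x \<in> X" "x' \<in> X" "g x = g x'" "x \<noteq> x'"
    have "T `` {x, x'} \<subseteq> {g x}" using g[OF x(1)] g[OF x(2)] x(3) single by auto
    then have "card (T `` {x, x'}) \<le> 1" using card_mono[of "{g x}"] by fastforce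
    then show False using QT[of "{x, x'}"] x by simp
  qed
  moreover have "g x \<in> S x" if "x \<in> X" for x using g[OF that] T by auto
  ultimately show thesis by (rule that)
qed

text \<open>A mere bijection would lose the geometry. Recording that \<open>h\<close> follows
  \<open>f\<close> or the inverse of \<open>g\<close> at each point lets displacement bounds for the
  two injections carry over to \<open>h\<close>. The set \<open>C\<close> on which \<open>f\<close>
  is followed is a Knaster-Tarski fixed point.\<close>

lemma Schroeder_Bernstein_graph:
  assumes "inj_on f X" "f ` X \<subseteq> Y" "inj_on g Y" "g ` Y \<subseteq> X"
  obtains h where "bij_betw h X Y" "\<And>x. x \<in> X \<Longrightarrow> h x = f x \<or> g (h x) = x"
proof -
  define C where "C = lfp (\<lambda>Z. X - g ` (Y - f ` Z))"
  have C: "C = X - g ` (Y - f ` C)"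
    unfolding C_def by (rule lfp_unfold, rule monoI) blast
  have CX: "C \<subseteq> X" using C by blast
  have XC: "X - C = g ` (Y - f ` C)" using C assms(4) by blast
  define h where "h x = (if x \<in> C then f x else inv_into Y g x)" for x
  have "bij_betw h C (f ` C)"
    using inj_on_subset[OF assms(1) CX] by (auto simp: bij_betw_def h_def inj_on_def)
  moreover have inv: "bij_betw (inv_into Y g) (X - C) (Y - f ` C)"
    unfolding XC by (rule bij_betw_inv_into_subset[of _ _ "g ` Y"])
      (use assms(3) in \<open>auto simp: bij_betw_def\<close>)
  then have "bij_betw h (X - C) (Y - f ` C)"
    by (rule bij_betw_cong[THEN iffD1, rotated]) (auto simp: h_def)
  ultimately have "bij_betw h (C \<union> (X - C)) (f ` C \<union> (Y - f ` C))"
    by (rule bij_betw_combine) auto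
  moreover have "C \<union> (X - C) = X" "f ` C \<union> (Y - f ` C) = Y" using CX assms(2) by auto
  ultimately have "bij_betw h X Y" by simp
  moreover have "h x = f x \<or> g (h x) = x" if "x \<in> X" for x
  proof (cases "x \<in> C")
    case False
    then have "x \<in> g ` Y" using that XC by blast
    then show ?thesis using False by (simp add: h_def f_inv_into_f)
  qed (simp add: h_def)
  ultimately show thesis by (rule that)
qed

section \<open>Quasi-locality\<close>

text \<open>Only finite supports are tested, so the notion applies to any matrix and every failure
  has a finite witness.\<close>

definition quasi_local :: "'b set \<Rightarrow> ('b \<Rightarrow> 'b \<Rightarrow> real) \<Rightarrow> ('b \<Rightarrow> 'b \<Rightarrow> complex) \<Rightarrow> real \<Rightarrow> real \<Rightarrow> bool"
  where "quasi_local Y d m e r \<longleftrightarrow>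
    (\<forall>C D a b. finite C \<longrightarrow> finite D \<longrightarrow> C \<subseteq> Y \<longrightarrow> D \<subseteq> Y \<longrightarrow> (\<forall>y\<in>C. \<forall>z\<in>D. r < d y z) \<longrightarrow>
      cmod (\<Sum>y\<in>C. \<Sum>z\<in>D. cnj (a y) * m y z * b z)
        \<le> e * (L2_set (\<lambda>y. cmod (a y)) C * L2_set (\<lambda>z. cmod (b z)) D))"

lemma quasi_localD:
  assumes "quasi_local Y d m e r" "finite C" "finite D" "C \<subseteq> Y" "D \<subseteq> Y"
    and "\<And>y z. y \<in> C \<Longrightarrow> z \<in> D \<Longrightarrow> r < d y z"
  shows "cmod (\<Sum>y\<in>C. \<Sum>z\<in>D. cnj (a y) * m y z * b z)
    \<le> e * (L2_set (\<lambda>y. cmod (a y)) C * L2_set (\<lambda>z. cmod (b z)) D)"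
proof -
  have "\<forall>y\<in>C. \<forall>z\<in>D. r < d y z" using assms(6) by blast
  then show ?thesis using assms(1-5) unfolding quasi_local_def by (elim allE impE) assumption+
qed

lemma quasi_localI:
  assumes "\<And>C D a b. finite C \<Longrightarrow> finite D \<Longrightarrow> C \<subseteq> Y \<Longrightarrow> D \<subseteq> Y \<Longrightarrow>
    (\<And>y z. y \<in> C \<Longrightarrow> z \<in> D \<Longrightarrow> r < d y z) \<Longrightarrow>
    cmod (\<Sum>y\<in>C. \<Sum>z\<in>D. cnj (a y) * m y z * b z)
      \<le> e * (L2_set (\<lambda>y. cmod (a y)) C * L2_set (\<lambda>z. cmod (b z)) D)"
  shows "quasi_local Y d m e r"
  unfolding quasi_local_def by (intro allI impI) (rule assms, auto)

lemma quasi_local_mono: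
  assumes "quasi_local Y d m e r" "r \<le> r'"
  shows "quasi_local Y d m e r'"
proof (rule quasi_localI)
  fix C D a b assume h: "finite C" "finite D" "C \<subseteq> Y" "D \<subseteq> Y" "\<And>y z. y \<in> C \<Longrightarrow> z \<in> D \<Longrightarrow> r' < d y z"
  have "r < d y z" if "y \<in> C" "z \<in> D" for y z using h(5)[OF that] assms(2) by simp
  then show "cmod (\<Sum>y\<in>C. \<Sum>z\<in>D. cnj (a y) * m y z * b z)
      \<le> e * (L2_set (\<lambda>y. cmod (a y)) C * L2_set (\<lambda>z. cmod (b z)) D)"
    by (rule quasi_localD[OF assms(1) h(1-4)])
qed

text \<open>Shaped for changing a subset inside a finite window: insert the new part and remove the
  old one.\<close>

lemma quasi_local_add_diff:
  assumes "quasi_local Y d m1 e1 r" "quasi_local Y d m2 e2 r" "quasi_local Y d m3 e3 r"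
    and "\<And>y z. y \<in> Y \<Longrightarrow> z \<in> Y \<Longrightarrow> m y z = m1 y z + m2 y z - m3 y z"
  shows "quasi_local Y d m (e1 + e2 + e3) r"
proof (rule quasi_localI)
  fix C D a b assume h: "finite C" "finite D" "C \<subseteq> Y" "D \<subseteq> Y" "\<And>y z. y \<in> C \<Longrightarrow> z \<in> D \<Longrightarrow> r < d y z"
  let ?s = "\<lambda>m. \<Sum>y\<in>C. \<Sum>z\<in>D. cnj (a y) * m y z * b z"
  let ?n = "L2_set (\<lambda>y. cmod (a y)) C * L2_set (\<lambda>z. cmod (b z)) D"
  have "?s m = (\<Sum>y\<in>C. \<Sum>z\<in>D. cnj (a y) * m1 y z * b z + cnj (a y) * m2 y z * b z
      - cnj (a y) * m3 y z * b z)"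
    by (intro sum.cong refl)
      (simp add: assms(4) subsetD[OF h(3)] subsetD[OF h(4)] ring_distribs)
  also have "\<dots> = ?s m1 + ?s m2 - ?s m3" by (simp add: sum.distrib sum_subtractf)
  finally have "cmod (?s m) \<le> cmod (?s m1) + cmod (?s m2) + cmod (?s m3)"
    using norm_triangle_ineq4[of "?s m1 + ?s m2" "?s m3"] norm_triangle_ineq[of "?s m1" "?s m2"] by simp
  also have "\<dots> \<le> e1 * ?n + e2 * ?n + e3 * ?n"
    by (intro add_mono quasi_localD[OF assms(1) h(1-5)] quasi_localD[OF assms(2) h(1-5)]
        quasi_localD[OF assms(3) h(1-5)])
  finally show "cmod (?s m) \<le> (e1 + e2 + e3) * ?n" by (simp add: algebra_simps)
qed

section \<open>Roe operators have quasi-local matrices\<close>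

lemma restr_finite:
  assumes "finite C" "C \<subseteq> Y"
  shows restr_finite_l2: "restr C a \<in> l2 Y"
    and l2norm_restr_finite: "l2norm Y (restr C a) = L2_set (\<lambda>y. cmod (a y)) C"
proof -
  have z: "\<And>x. x \<notin> C \<Longrightarrow> restr C a x = 0" by (simp add: restr_def)
  show "restr C a \<in> l2 Y" using assms z by (rule l2_finite_support)
  have "l2norm Y (restr C a) = L2_set (\<lambda>y. cmod (restr C a y)) C"
    using assms z by (rule l2norm_finite_support)
  also have "\<dots> = L2_set (\<lambda>y. cmod (a y)) C" by (rule L2_set_cong) (auto simp: restr_def)
  finally show "l2norm Y (restr C a) = L2_set (\<lambda>y. cmod (a y)) C" .
qed

lemma l2inner_matrix_form:
  assumes "bounded_op Y S" "finite C" "C \<subseteq> Y" "finite D" "D \<subseteq> Y"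
  shows "l2inner Y (restr C a) (S (restr D b)) = (\<Sum>y\<in>C. \<Sum>z\<in>D. cnj (a y) * entry S y z * b z)"
proof -
  have S: "S (restr D b) = (\<lambda>y. \<Sum>z\<in>D. restr D b z * S (delta z) y)"
    using assms(1,4,5) by (rule bounded_op_finite_support) (simp add: restr_def)
  have "l2inner Y (restr C a) (S (restr D b)) = (\<Sum>y\<in>C. cnj (restr C a y) * S (restr D b) y)"
    using assms(2,3) by (rule l2inner_finite_support) (simp add: restr_def)
  also have "\<dots> = (\<Sum>y\<in>C. \<Sum>z\<in>D. cnj (a y) * entry S y z * b z)"
    unfolding S sum_distrib_left by (intro sum.cong refl) (simp add: restr_def entry_def)
  finally show ?thesis .
qed

text \<open>Between sets farther apart than its propagation, the approximant \<open>T\<close>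
  contributes nothing; what is left is \<open>S - T\<close>, of norm at most
  \<open>e\<close>.\<close>

lemma uniform_roe_quasi_local:
  assumes "S \<in> uniform_roe Y d" "0 < e"
  obtains r where "quasi_local Y d (entry S) e r"
proof -
  have bS: "bounded_op Y S" using assms(1) by (rule uniform_roe_bounded)
  obtain T where T: "bounded_op Y T" "finite_propagation Y d T"
    "\<And>f. f \<in> l2 Y \<Longrightarrow> l2norm Y (\<lambda>x. S f x - T f x) \<le> e * l2norm Y f"
    using uniform_roe_approx[OF assms] by blast
  obtain R where R: "\<And>y z. y \<in> Y \<Longrightarrow> z \<in> Y \<Longrightarrow> entry T y z \<noteq> 0 \<Longrightarrow> d y z \<le> R"
    using T(2) unfolding finite_propagation_def by blast
  have "quasi_local Y d (entry S) e R"
  proof (rule quasi_localI)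
    fix C D a b assume h: "finite C" "finite D" "C \<subseteq> Y" "D \<subseteq> Y" "\<And>y z. y \<in> C \<Longrightarrow> z \<in> D \<Longrightarrow> R < d y z"
    define f where "f = restr C a"
    define g where "g = restr D b"
    have f: "f \<in> l2 Y" "l2norm Y f = L2_set (\<lambda>y. cmod (a y)) C"
      unfolding f_def using restr_finite[OF h(1,3)] by auto
    have g: "g \<in> l2 Y" "l2norm Y g = L2_set (\<lambda>y. cmod (b y)) D"
      unfolding g_def using restr_finite[OF h(2,4)] by auto
    have "entry T y z = 0" if "y \<in> C" "z \<in> D" for y z
      using R[of y z] h(5)[OF that] h(3,4) that by force
    then have "l2inner Y f (T g) = 0"
      unfolding f_def g_def l2inner_matrix_form[OF T(1) h(1,3,2,4)] by (intro sum.neutral) auto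
    then have "(\<Sum>y\<in>C. \<Sum>z\<in>D. cnj (a y) * entry S y z * b z) = l2inner Y f (\<lambda>x. S g x - T g x)"
      using l2inner_diff_right[OF f(1) bounded_op_mem[OF bS g(1)] bounded_op_mem[OF T(1) g(1)]]
        l2inner_matrix_form[OF bS h(1,3,2,4), of a b] by (simp add: f_def g_def)
    also have "cmod \<dots> \<le> l2norm Y f * l2norm Y (\<lambda>x. S g x - T g x)"
      by (intro l2inner_bound f(1) l2_diff bounded_op_mem[OF bS g(1)] bounded_op_mem[OF T(1) g(1)])
    also have "\<dots> \<le> l2norm Y f * (e * l2norm Y g)"
      by (intro mult_left_mono T(3) g(1) l2norm_nonneg)
    finally show "cmod (\<Sum>y\<in>C. \<Sum>z\<in>D. cnj (a y) * entry S y z * b z)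
        \<le> e * (L2_set (\<lambda>y. cmod (a y)) C * L2_set (\<lambda>z. cmod (b z)) D)"
      by (simp add: f(2) g(2) algebra_simps)
  qed
  then show thesis by (rule that)
qed

section \<open>Two kinds of test operators: coordinate projections and neighbourhood sums\<close>

definition cut :: "'a set \<Rightarrow> 'a set \<Rightarrow> 'a op" where
  "cut X A = (\<lambda>f. if f \<in> l2 X then restr A f else (\<lambda>_. 0))"

lemma cut_roe:
  assumes "Metric_space X d"
  shows "cut X A \<in> uniform_roe X d"
proof (rule uniform_roe_finite_propagation)
  show "bounded_op X (cut X A)"
    by (rule bounded_opI[where C=1])
      (simp_all add: cut_def restr_l2 l2norm_restr_le l2_add l2_scale, auto simp: restr_def)
  have "d x x' \<le> 0" if "x \<in> X" "x' \<in> X" "entry (cut X A) x x' \<noteq> 0" for x x'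
  proof -
    have "x = x'"
      using that by (simp add: entry_def cut_def restr_def split: if_splits)
        (auto simp: delta_def split: if_splits)
    then show ?thesis using that Metric_space.zero[OF assms, of x x] by simp
  qed
  then show "finite_propagation X d (cut X A)"
    unfolding finite_propagation_def by blast
qed

text \<open>The adjacency operator, with loops, of the graph that joins points at distance at most
  \<open>r\<close>.\<close>

definition neighbour_sum :: "'a set \<Rightarrow> ('a \<Rightarrow> 'a \<Rightarrow> real) \<Rightarrow> real \<Rightarrow> 'a op" where
  "neighbour_sum X d r = (\<lambda>f. if f \<in> l2 X
     then (\<lambda>x. if x \<in> X then (\<Sum>x'\<in>{x'\<in>X. d x x' \<le> r}. f x') else 0) else (\<lambda>_. 0))"

lemma entry_neighbour_sum:
  assumes "x \<in> X" "x' \<in> X" "finite {x'\<in>X. d x x' \<le> r}"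
  shows "entry (neighbour_sum X d r) x x' = (if d x x' \<le> r then 1 else 0)"
proof -
  have "entry (neighbour_sum X d r) x x' = (\<Sum>z\<in>{z\<in>X. d x z \<le> r}. delta x' z)"
    using assms by (simp add: entry_def neighbour_sum_def)
  also have "\<dots> = (\<Sum>z\<in>{z\<in>X. d x z \<le> r}. if z = x' then 1 else 0)"
    by (rule sum.cong) (auto simp: delta_def)
  also have "\<dots> = (if d x x' \<le> r then 1 else 0)"
    using assms by (simp add: sum.delta)
  finally show ?thesis .
qed

text \<open>A Schur test: Cauchy-Schwarz on rows with at most \<open>N\<close> entries, then double
  counting over columns with at most \<open>N\<close> entries, gives norm at most
  \<open>N\<close>.\<close>

lemma neighbour_sum_roe:
  assumes "Metric_space X d" "ulf X d" "0 < r"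
  shows "neighbour_sum X d r \<in> uniform_roe X d"
proof (rule uniform_roe_finite_propagation)
  let ?B = "\<lambda>x. {x'\<in>X. d x x' \<le> r}"
  obtain N :: nat where N: "\<And>x. x \<in> X \<Longrightarrow> finite (?B x) \<and> card (?B x) \<le> N"
    using assms(2,3) unfolding ulf_def by blast
  let ?T = "neighbour_sum X d r"
  have fin: "L2_set (\<lambda>x. cmod (?T f x)) F \<le> N * l2norm X f"
    if f: "f \<in> l2 X" and F: "finite F" "F \<subseteq> X" for f F
  proof -
    define M where "M = (\<Union>x\<in>F. ?B x)"
    have M: "finite M" "M \<subseteq> X" unfolding M_def using F N by auto
    have MB: "?B x = {x'. x' \<in> M \<and> d x x' \<le> r}" if "x \<in> F" for x
      using that by (auto simp: M_def)
    have pt: "(cmod (?T f x))\<^sup>2 \<le> N * (\<Sum>x'\<in>?B x. (cmod (f x'))\<^sup>2)" if x: "x \<in> F" for x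
    proof -
      have xX: "x \<in> X" using x F by auto
      have "cmod (?T f x) \<le> (\<Sum>x'\<in>?B x. cmod (f x'))"
        using f xX by (simp add: neighbour_sum_def norm_sum)
      then have "(cmod (?T f x))\<^sup>2 \<le> (\<Sum>x'\<in>?B x. cmod (f x'))\<^sup>2" by (rule power_mono) simp
      also have "\<dots> \<le> (\<Sum>x'\<in>?B x. (cmod (f x'))\<^sup>2) * card (?B x)"
        by (rule sum_squared_le_sum_of_squares)
      also have "\<dots> \<le> (\<Sum>x'\<in>?B x. (cmod (f x'))\<^sup>2) * N"
        using N[OF xX] by (intro mult_left_mono sum_nonneg) auto
      finally show ?thesis by (simp add: mult.commute)
    qed
    have cnt: "card {x. x \<in> F \<and> d x x' \<le> r} \<le> N" if "x' \<in> M" for x'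
    proof -
      have x': "x' \<in> X" using that M by auto
      have "{x. x \<in> F \<and> d x x' \<le> r} \<subseteq> ?B x'"
        using F(2) Metric_space.commute[OF assms(1)] by auto
      then have "card {x. x \<in> F \<and> d x x' \<le> r} \<le> card (?B x')"
        using N[OF x'] by (intro card_mono) auto
      then show ?thesis using N[OF x'] by linarith
    qed
    have "(\<Sum>x\<in>F. (cmod (?T f x))\<^sup>2) \<le> (\<Sum>x\<in>F. N * (\<Sum>x'\<in>?B x. (cmod (f x'))\<^sup>2))"
      by (rule sum_mono) (rule pt)
    also have "\<dots> = N * (\<Sum>x\<in>F. \<Sum>x'\<in>{x'. x' \<in> M \<and> d x x' \<le> r}. (cmod (f x'))\<^sup>2)"
      unfolding sum_distrib_left[symmetric] by (intro arg_cong2[where f="(*)"] sum.cong) (auto simp: MB)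
    also have "\<dots> = N * (\<Sum>x'\<in>M. \<Sum>x\<in>{x. x \<in> F \<and> d x x' \<le> r}. (cmod (f x'))\<^sup>2)"
      using sum.swap_restrict[OF F(1) M(1), of "\<lambda>x x'. (cmod (f x'))\<^sup>2" "\<lambda>x x'. d x x' \<le> r"] by simp
    also have "\<dots> \<le> N * (\<Sum>x'\<in>M. N * (cmod (f x'))\<^sup>2)"
      using cnt by (intro mult_left_mono sum_mono) (auto intro!: mult_right_mono)
    also have "\<dots> = (N * L2_set (\<lambda>x. cmod (f x)) M)\<^sup>2"
      unfolding power_mult_distrib L2_set_square
      by (simp add: sum_distrib_left power2_eq_square[of "real N"] mult.assoc)
    also have "\<dots> \<le> (N * l2norm X f)\<^sup>2"
      using L2_set_le_l2norm[OF f M] by (intro power_mono mult_left_mono) auto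
    finally show ?thesis
      unfolding L2_set_def by (intro real_le_lsqrt) (auto simp: l2norm_nonneg)
  qed
  have out: "?T f x = 0" if "x \<notin> X" for f x using that by (simp add: neighbour_sum_def)
  have mem: "?T f \<in> l2 X" if "f \<in> l2 X" for f
    using out fin[OF that] by (rule l2_via_finite_mem)
  have bnd: "l2norm X (?T f) \<le> N * l2norm X f" if "f \<in> l2 X" for f
    using out fin[OF that] by (rule l2_via_finite_norm)
  show "bounded_op X ?T"
    by (rule bounded_opI[OF _ mem _ _ bnd])
      (auto simp: neighbour_sum_def l2_add l2_scale sum.distrib sum_distrib_left)
  have "d x x' \<le> r" if "x \<in> X" "x' \<in> X" "entry ?T x x' \<noteq> 0" for x x'
    using that N[OF that(1)] by (simp add: entry_neighbour_sum split: if_splits)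
  then show "finite_propagation X d ?T"
    unfolding finite_propagation_def by blast
qed

section \<open>Large entries of the unitary\<close>

locale roe_unitary =
  fixes X :: "'a set" and dX :: "'a \<Rightarrow> 'a \<Rightarrow> real" and Y :: "'b set" and dY :: "'b \<Rightarrow> 'b \<Rightarrow> real"
    and u :: "'b \<Rightarrow> 'a \<Rightarrow> complex"
  assumes metric_X: "Metric_space X dX" and metric_Y: "Metric_space Y dY"
    and ulf_X: "ulf X dX" and ulf_Y: "ulf Y dY"
    and impl: "unitary_impl X dX Y dY u"
begin

text \<open>\<open>row y\<close> is \<open>U\<^sup>*\<close> applied to \<open>delta y\<close>,
  hence the conjugation; \<open>col x\<close> is \<open>U\<close> applied to
  \<open>delta x\<close>.\<close>

definition row :: "'b \<Rightarrow> 'a \<Rightarrow> complex" where "row y = (\<lambda>x. cnj (u y x))"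
definition col :: "'a \<Rightarrow> 'b \<Rightarrow> complex" where "col x = (\<lambda>y. u y x)"

lemma row_l2: "y \<in> Y \<Longrightarrow> row y \<in> l2 X"
  and col_l2: "x \<in> X \<Longrightarrow> col x \<in> l2 Y"
  and row_inner: "y \<in> Y \<Longrightarrow> y' \<in> Y \<Longrightarrow> l2inner X (row y) (row y') = (if y = y' then 1 else 0)"
  and col_inner: "x \<in> X \<Longrightarrow> x' \<in> X \<Longrightarrow> l2inner Y (col x) (col x') = (if x = x' then 1 else 0)"
  using impl unfolding unitary_impl_def row_def col_def by simp_all

lemma roe_transport:
  assumes "T \<in> uniform_roe X dX"
  shows "\<exists>S\<in>uniform_roe Y dY.
      (\<forall>y\<in>Y. \<forall>y'\<in>Y. entry S y y' = l2inner X (row y) (T (row y'))) \<and>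
      (\<forall>x\<in>X. \<forall>x'\<in>X. entry T x x' = l2inner Y (col x) (S (col x')))"
  using impl assms unfolding unitary_impl_def row_def col_def by blast

lemma row_norm: "y \<in> Y \<Longrightarrow> l2norm X (row y) = 1"
  by (rule l2norm_unit) (simp_all add: row_l2 row_inner)

lemma col_norm: "x \<in> X \<Longrightarrow> l2norm Y (col x) = 1"
  by (rule l2norm_unit) (simp_all add: col_l2 col_inner)

lemma sum_row_le:
  assumes "y \<in> Y" "finite F" "F \<subseteq> X"
  shows "(\<Sum>x\<in>F. (cmod (u y x))\<^sup>2) \<le> 1"
proof -
  have "L2_set (\<lambda>x. cmod (row y x)) F \<le> 1"
    using L2_set_le_l2norm[OF row_l2 assms(2,3)] row_norm assms(1) by metis
  then have "(L2_set (\<lambda>x. cmod (row y x)) F)\<^sup>2 \<le> 1" by (simp add: power_le_one)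
  then show ?thesis by (simp add: L2_set_square row_def)
qed

text \<open>The matrix of the image of the projection onto \<open>l2 A\<close>.\<close>

definition proj :: "'a set \<Rightarrow> 'b \<Rightarrow> 'b \<Rightarrow> complex" where
  "proj A y z = l2inner X (row y) (restr A (row z))"

lemma proj_finite:
  assumes "finite A" "A \<subseteq> X"
  shows "proj A y z = (\<Sum>x\<in>A. u y x * cnj (u z x))"
proof -
  have "proj A y z = cnj (l2inner X (restr A (row z)) (row y))"
    unfolding proj_def by (rule l2inner_cnj)
  also have "l2inner X (restr A (row z)) (row y) = (\<Sum>x\<in>A. cnj (restr A (row z) x) * row y x)"
    using assms by (rule l2inner_finite_support) (simp add: restr_def)
  also have "cnj \<dots> = (\<Sum>x\<in>A. u y x * cnj (u z x))"
    unfolding cnj_sum by (rule sum.cong) (auto simp: restr_def row_def)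
  finally show ?thesis .
qed

lemma proj_quasi_local:
  assumes "0 < e"
  obtains r where "quasi_local Y dY (proj A) e r"
proof -
  obtain S where S: "S \<in> uniform_roe Y dY"
    "\<forall>y\<in>Y. \<forall>y'\<in>Y. entry S y y' = l2inner X (row y) (cut X A (row y'))"
    using roe_transport[OF cut_roe[OF metric_X, of A]] by (elim bexE conjE)
  obtain r where r: "quasi_local Y dY (entry S) (e / 3) r"
    using uniform_roe_quasi_local[OF S(1), of "e / 3"] assms by auto
  \<comment> \<open>Instance \<open>m + m - m = m\<close>, which serves to pass from
    \<open>entry S\<close> to \<open>proj A\<close>, equal to it on \<open>Y\<close>.\<close>
  have "quasi_local Y dY (proj A) (e / 3 + e / 3 + e / 3) r"
    by (rule quasi_local_add_diff[OF r r r]) (simp add: S(2) proj_def cut_def row_l2)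
  then show thesis using that by simp
qed

text \<open>A failure is witnessed by \<open>\<alpha>\<close> and \<open>\<beta>\<close>, the images
  of two test vectors under \<open>U\<^sup>*\<close>. Nearly all of \<open>\<beta>\<close> lives on
  a finite \<open>F\<close>, so changing \<open>A\<close> off \<open>F\<close> hardly moves the
  inner product of \<open>\<alpha>\<close> with \<open>restr A \<beta>\<close>, and the strict
  inequality persists.\<close>

lemma proj_closed:
  assumes "\<not> quasi_local Y dY (proj A) e r"
  shows "\<exists>F. finite F \<and> (\<forall>A'. A' \<inter> F = A \<inter> F \<longrightarrow> \<not> quasi_local Y dY (proj A') e r)"
proof -
  obtain C D a b where h: "finite C" "finite D" "C \<subseteq> Y" "D \<subseteq> Y" "\<forall>y\<in>C. \<forall>z\<in>D. r < dY y z"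
    and gt: "e * (L2_set (\<lambda>y. cmod (a y)) C * L2_set (\<lambda>z. cmod (b z)) D)
      < cmod (\<Sum>y\<in>C. \<Sum>z\<in>D. cnj (a y) * proj A y z * b z)" (is "?E < _")
    using assms unfolding quasi_local_def by (auto simp: not_le)
  define \<alpha> where "\<alpha> = (\<lambda>x. \<Sum>y\<in>C. a y * row y x)"
  define \<beta> where "\<beta> = (\<lambda>x. \<Sum>z\<in>D. b z * row z x)"
  have \<alpha>: "\<alpha> \<in> l2 X" unfolding \<alpha>_def using h row_l2 by (intro l2_sum) auto
  have \<beta>: "\<beta> \<in> l2 X" unfolding \<beta>_def using h row_l2 by (intro l2_sum) auto
  have form: "(\<Sum>y\<in>C. \<Sum>z\<in>D. cnj (a y) * proj A y z * b z) = l2inner X \<alpha> (restr A \<beta>)" for A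
  proof -
    have rl: "restr A (row z) \<in> l2 X" if "z \<in> D" for z
      using that h row_l2 by (intro restr_l2) auto
    have "restr A \<beta> = (\<lambda>x. \<Sum>z\<in>D. b z * restr A (row z) x)"
      by (auto simp: \<beta>_def restr_def)
    moreover have "l2inner X \<alpha> g = (\<Sum>y\<in>C. cnj (a y) * l2inner X (row y) g)" if "g \<in> l2 X" for g
      unfolding \<alpha>_def using h row_l2 that by (intro l2inner_sum_left) auto
    moreover have "l2inner X (row y) (\<lambda>x. \<Sum>z\<in>D. b z * restr A (row z) x)
        = (\<Sum>z\<in>D. b z * proj A y z)" if "y \<in> C" for y
      unfolding proj_def using h(2) rl row_l2 that h(3) by (intro l2inner_sum_right) auto
    ultimately show ?thesis
      using restr_l2[OF \<beta>, of A] by (simp add: sum_distrib_left mult_ac)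
  qed
  define gap where "gap = cmod (l2inner X \<alpha> (restr A \<beta>)) - ?E"
  have gap: "0 < gap" using gt by (simp add: gap_def form)
  \<comment> \<open>Sets that agree on \<open>F\<close> change the inner product by at most
    \<open>2 * l2norm X \<alpha> * (gap / n)\<close>; the added 1 keeps this strictly below
    \<open>gap\<close>.\<close>
  define n where "n = 2 * l2norm X \<alpha> + 1"
  have n: "0 < n" using l2norm_nonneg[of X \<alpha>] by (simp add: n_def)
  obtain F where F: "finite F" "F \<subseteq> X" "l2norm X (\<lambda>x. \<beta> x - restr F \<beta> x) \<le> gap / n"
    using l2_finite_approx[OF \<beta>, of "gap / n"] gap n by auto
  define \<gamma> where "\<gamma> = (\<lambda>x. \<beta> x - restr F \<beta> x)"
  have \<gamma>: "\<gamma> \<in> l2 X" unfolding \<gamma>_def by (intro l2_diff \<beta> restr_l2)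
  have "\<not> quasi_local Y dY (proj A') e r" if A': "A' \<inter> F = A \<inter> F" for A'
  proof
    assume q: "quasi_local Y dY (proj A') e r"
    have "(\<lambda>x. restr A \<beta> x - restr A' \<beta> x) = (\<lambda>x. restr A \<gamma> x - restr A' \<gamma> x)"
    proof
      fix x
      show "restr A \<beta> x - restr A' \<beta> x = restr A \<gamma> x - restr A' \<gamma> x"
        using A' by (cases "x \<in> F") (auto simp: restr_def \<gamma>_def)
    qed
    then have "l2inner X \<alpha> (restr A \<beta>) - l2inner X \<alpha> (restr A' \<beta>)
        = l2inner X \<alpha> (\<lambda>x. restr A \<gamma> x - restr A' \<gamma> x)"
      using l2inner_diff_right[OF \<alpha> restr_l2[OF \<beta>] restr_l2[OF \<beta>]] by metis
    then have "cmod (l2inner X \<alpha> (restr A \<beta>)) \<le> cmod (l2inner X \<alpha> (restr A' \<beta>))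
        + cmod (l2inner X \<alpha> (\<lambda>x. restr A \<gamma> x - restr A' \<gamma> x))"
      by (metis diff_add_cancel add.commute norm_triangle_ineq)
    also have "cmod (l2inner X \<alpha> (restr A' \<beta>)) \<le> ?E"
      using quasi_localD[OF q h(1-4), of a b] h(5) by (simp add: form)
    also have "cmod (l2inner X \<alpha> (\<lambda>x. restr A \<gamma> x - restr A' \<gamma> x))
        \<le> l2norm X \<alpha> * l2norm X (\<lambda>x. restr A \<gamma> x - restr A' \<gamma> x)"
      by (intro l2inner_bound \<alpha> l2_diff restr_l2 \<gamma>)
    also have "\<dots> \<le> l2norm X \<alpha> * (2 * (gap / n))"
    proof (rule mult_left_mono)
      show "l2norm X (\<lambda>x. restr A \<gamma> x - restr A' \<gamma> x) \<le> 2 * (gap / n)"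
        using l2norm_diff_le[OF restr_l2[OF \<gamma>] restr_l2[OF \<gamma>], of A A']
          l2norm_restr_le[OF \<gamma>, of A] l2norm_restr_le[OF \<gamma>, of A'] F(3)
        unfolding \<gamma>_def[symmetric] by linarith
    qed (rule l2norm_nonneg)
    also have "\<dots> = gap * (2 * l2norm X \<alpha> / n)" by simp
    also have "\<dots> < gap * 1"
      using gap n by (intro mult_strict_left_mono) (auto simp: n_def)
    finally show False by (simp add: gap_def)
  qed
  then show ?thesis using F(1) by blast
qed

text \<open>The category argument gives one radius for all subsets with a fixed pattern
  \<open>E\<close> on a finite window \<open>F\<close>. Any \<open>A\<close> is brought to that
  pattern by changing it inside \<open>F\<close> only, and there are finitely many possibilities for
  \<open>A \<inter> F\<close>; the three summands take \<open>e / 3\<close> each.\<close>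

lemma proj_uniformly_quasi_local:
  assumes "0 < e"
  obtains r where "0 < r" "\<And>A. quasi_local Y dY (proj A) e r"
proof -
  let ?P = "\<lambda>n A. quasi_local Y dY (proj A) (e / 3) (real n)"
  have cover: "\<exists>n. ?P n A" for A
  proof -
    obtain r where r: "quasi_local Y dY (proj A) (e / 3) r"
      using proj_quasi_local[of "e / 3" A] assms by auto
    obtain n where "r \<le> real n" using real_arch_simple by blast
    then show ?thesis using quasi_local_mono[OF r] by blast
  qed
  have "\<exists>n F E. finite F \<and> (\<forall>A. A \<inter> F = E \<inter> F \<longrightarrow> ?P n A)"
    using cover proj_closed by (rule powerset_Baire)
  then obtain n F E where F: "finite F" and P: "\<And>A. A \<inter> F = E \<inter> F \<Longrightarrow> ?P n A" by blast
  obtain k where k: "\<And>A. ?P (k A) A" using cover by metis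
  \<comment> \<open>\<open>Suc n\<close> instead of \<open>n\<close> makes the final radius
    positive.\<close>
  define N where "N = Max (insert (Suc n) (k ` Pow F))"
  have fin: "finite (insert (Suc n) (k ` Pow F))" using F by simp
  have nN: "Suc n \<le> N" unfolding N_def using fin by (intro Max_ge) auto
  have kN: "k G \<le> N" if "G \<subseteq> F" for G unfolding N_def using fin that by (intro Max_ge) auto
  have "quasi_local Y dY (proj A) e (real N)" for A
  proof -
    define B where "B = (A - F) \<union> (E \<inter> F)"
    have "?P n B" by (rule P) (auto simp: B_def)
    then have "quasi_local Y dY (proj B) (e / 3) (real N)"
      by (rule quasi_local_mono) (use nN in simp)
    moreover have "quasi_local Y dY (proj (A \<inter> F)) (e / 3) (real N)"
      by (rule quasi_local_mono[OF k]) (use kN[of "A \<inter> F"] in simp)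
    moreover have "quasi_local Y dY (proj (E \<inter> F)) (e / 3) (real N)"
      by (rule quasi_local_mono[OF k]) (use kN[of "E \<inter> F"] in simp)
    ultimately have "quasi_local Y dY (proj A) (e / 3 + e / 3 + e / 3) (real N)"
    proof (rule quasi_local_add_diff)
      fix y z assume yz: "y \<in> Y" "z \<in> Y"
      have "restr A (row z) = (\<lambda>x. (restr B (row z) x + restr (A \<inter> F) (row z) x) - restr (E \<inter> F) (row z) x)"
        by (auto simp: restr_def B_def)
      then show "proj A y z = proj B y z + proj (A \<inter> F) y z - proj (E \<inter> F) y z"
        unfolding proj_def using yz
        by (simp add: l2inner_diff_right l2inner_add_right l2_add restr_l2 row_l2)
    qed
    then show ?thesis by simp
  qed
  then show thesis using that[of "real N"] nN by simp
qed

text \<open>\<open>p\<close> is the projection \<open>U \<chi>\<^sub>B U\<^sup>*\<close> applied to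
  \<open>delta y\<close>, and \<open>s\<close> is both its coordinate at \<open>y\<close> and its
  squared norm. It is used at \<open>t = 2\<close>, where the reflection preserves the norm, and at
  \<open>t = 1\<close>, where the complement has squared norm \<open>1 - s\<close>.\<close>

lemma unitary_column_norm:
  assumes "y \<in> Y" "finite B" "B \<subseteq> X"
  defines "s \<equiv> (\<Sum>x\<in>B. (cmod (u y x))\<^sup>2)"
  defines "p \<equiv> (\<lambda>z. \<Sum>x\<in>B. cnj (u y x) * col x z)"
  shows "p \<in> l2 Y" and "(l2norm Y (\<lambda>z. delta y z - of_real t * p z))\<^sup>2 = 1 - 2 * t * s + t\<^sup>2 * s"
proof -
  show p: "p \<in> l2 Y" unfolding p_def using assms col_l2 by (intro l2_sum) auto
  have sc: "(\<Sum>x\<in>B. cnj (u y x) * u y x) = of_real s"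
    by (simp add: s_def complex_norm_square mult.commute del: of_real_power)
  have py: "p y = of_real s" using sc by (simp add: p_def col_def)
  have cp: "l2inner Y (col x) p = cnj (u y x)" if x: "x \<in> B" for x
  proof -
    have "l2inner Y (col x) p = (\<Sum>i\<in>B. cnj (u y i) * l2inner Y (col x) (col i))"
      unfolding p_def using assms(2,3) col_l2 x by (intro l2inner_sum_right) auto
    also have "\<dots> = (\<Sum>i\<in>B. if i = x then cnj (u y x) else 0)"
      using assms(3) x by (intro sum.cong) (auto simp: col_inner subset_iff)
    also have "\<dots> = cnj (u y x)" using x assms(2) by simp
    finally show ?thesis .
  qed
  have "l2inner Y p p = (\<Sum>x\<in>B. cnj (cnj (u y x)) * l2inner Y (col x) p)"
    unfolding p_def using assms(2,3) col_l2 p[unfolded p_def] by (intro l2inner_sum_left) auto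
  also have "\<dots> = (\<Sum>x\<in>B. cnj (u y x) * u y x)" by (intro sum.cong) (auto simp: cp)
  finally have pp: "l2inner Y p p = of_real s" using sc by simp
  let ?f = "\<lambda>z. delta y z - of_real t * p z"
  have tp: "(\<lambda>z. of_real t * p z) \<in> l2 Y" using p by (rule l2_scale)
  have d: "delta y \<in> l2 Y" using assms(1) by simp
  have f: "?f \<in> l2 Y" using d tp by (rule l2_diff)
  have "of_real ((l2norm Y ?f)\<^sup>2) = l2inner Y ?f ?f" using l2inner_self[OF f] by simp
  also have "\<dots> = l2inner Y (delta y) ?f - l2inner Y (\<lambda>z. of_real t * p z) ?f"
    by (rule l2inner_diff_left[OF f d tp])
  also have "l2inner Y (delta y) ?f = of_real (1 - t * s)"
    using assms(1) py by simp
  also have "l2inner Y (\<lambda>z. of_real t * p z) ?f = of_real t * (cnj (p y) - of_real t * l2inner Y p p)"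
    unfolding l2inner_scale_left l2inner_diff_right[OF p d tp] l2inner_scale_right
    using assms(1) by simp
  finally have "of_real ((l2norm Y ?f)\<^sup>2) = complex_of_real (1 - t * s - t * (s - t * s))"
    by (simp add: py pp)
  then have "(l2norm Y ?f)\<^sup>2 = 1 - t * s - t * (s - t * s)" by (simp only: of_real_eq_iff)
  then show "(l2norm Y ?f)\<^sup>2 = 1 - 2 * t * s + t\<^sup>2 * s"
    by (simp add: power2_eq_square algebra_simps)
qed

text \<open>For a random sign vector \<open>s\<close> the unitary image of \<open>diag s\<close> moves the basis vector at
  \<open>y\<close> to a unit vector living essentially on a ball of bounded size, while on average its entries
  are no larger than the entries of row \<open>y\<close>.\<close>

lemma large_entry_in_row:
  obtains \<delta> where "0 < \<delta>" "\<And>y. y \<in> Y \<Longrightarrow> \<exists>x\<in>X. \<delta> \<le> cmod (u y x)"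
proof -
  obtain r where r: "0 < r" "\<And>A. quasi_local Y dY (proj A) (1 / 4) r"
    using proj_uniformly_quasi_local[of "1 / 4"] by auto
  obtain N :: nat where N: "\<And>y. y \<in> Y \<Longrightarrow> finite {z\<in>Y. dY y z \<le> r} \<and> card {z\<in>Y. dY y z \<le> r} \<le> N"
    using ulf_Y r(1) unfolding ulf_def by blast
  \<comment> \<open>Makes \<open>N * \<delta>^2\<close> at most 1/4, the allowance for the random
    part on a ball of at most \<open>N\<close> points.\<close>
  define \<delta> where "\<delta> = 1 / (2 * sqrt (N + 1))"
  have \<delta>: "0 < \<delta>" "\<delta>\<^sup>2 = 1 / (4 * (real N + 1))"
    by (simp_all add: \<delta>_def power_divide power_mult_distrib)
  have "\<exists>x\<in>X. \<delta> \<le> cmod (u y x)" if y: "y \<in> Y" for y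
  proof (rule ccontr)
    assume "\<not> ?thesis"
    then have small: "cmod (u y x) \<le> \<delta>" if "x \<in> X" for x using that by force
    define K where "K = {z\<in>Y. dY y z \<le> r}"
    have K: "finite K" "K \<subseteq> Y" "card K \<le> N" using N[OF y] by (auto simp: K_def)
    \<comment> \<open>Signs can be balanced only over a finite set; norm above 9/10 on
      \<open>G\<close> leaves at most \<open>1 - (9/10)^2\<close>, below 1/4, outside.\<close>
    have "\<exists>G. finite G \<and> G \<subseteq> X \<and> 9 / 10 < L2_set (\<lambda>x. cmod (row y x)) G"
    proof (rule ccontr)
      assume "\<not> ?thesis"
      then have "l2norm X (row y) \<le> 9 / 10"
        using l2_outside[OF row_l2[OF y]] by (intro l2_via_finite_norm) (auto simp: not_less)
      then show False using row_norm[OF y] by simp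
    qed
    then obtain G where G: "finite G" "G \<subseteq> X" "9 / 10 < L2_set (\<lambda>x. cmod (row y x)) G" by blast
    define p where "p B = (\<lambda>z. \<Sum>x\<in>B. cnj (u y x) * col x z)" for B
    define a where "a x z = cnj (u y x) * u z x" for x z
    have "(9 / 10)\<^sup>2 \<le> (L2_set (\<lambda>x. cmod (row y x)) G)\<^sup>2" using G(3) by (intro power_mono) auto
    then have sG: "(9 / 10)\<^sup>2 \<le> (\<Sum>x\<in>G. (cmod (u y x))\<^sup>2)" by (simp add: L2_set_square row_def)
    \<comment> \<open>Applied to \<open>delta y\<close>, the reflection
      \<open>1 - 2 U \<chi>\<^sub>B U\<^sup>*\<close> is the fixed vector
      \<open>delta y - p G\<close> plus the signed sum of the vectors \<open>a x\<close>. Balancing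
      bounds its mass on \<open>K\<close>.\<close>
    obtain B where B: "B \<subseteq> G"
      "(\<Sum>z\<in>K. (cmod (delta y z - p G z + (\<Sum>x\<in>G. (if x \<in> B then -1 else 1) * a x z)))\<^sup>2)
        \<le> (\<Sum>z\<in>K. (cmod (delta y z - p G z))\<^sup>2) + (\<Sum>x\<in>G. \<Sum>z\<in>K. (cmod (a x z))\<^sup>2)"
      using sign_balancing[OF G(1), where K=K and c="\<lambda>z. delta y z - p G z" and a=a] by blast
    have Bf: "finite B" "B \<subseteq> X" using B(1) G finite_subset by auto
    define f where "f = (\<lambda>z. delta y z - of_real 2 * p B z)"
    have pB: "p B \<in> l2 Y" and nf: "(l2norm Y f)\<^sup>2 = 1"
      unfolding p_def f_def using unitary_column_norm(1)[OF y Bf] unitary_column_norm(2)[OF y Bf, of 2] by auto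
    have fl: "f \<in> l2 Y" unfolding f_def using y pB by (intro l2_diff l2_scale) auto
    have f_eq: "delta y z - p G z + (\<Sum>x\<in>G. (if x \<in> B then -1 else 1) * a x z) = f z" for z
    proof -
      have "(\<Sum>x\<in>G. (if x \<in> B then -1 else 1) * a x z) = (\<Sum>x\<in>G. a x z - 2 * (if x \<in> B then a x z else 0))"
        by (intro sum.cong) auto
      also have "\<dots> = p G z - 2 * p B z"
        using G(1) B(1) by (simp add: sum_subtractf sum_distrib_left[symmetric] sum.If_cases Int_absorb2
            p_def a_def col_def Int_commute)
      finally show ?thesis by (simp add: f_def)
    qed
    have projB: "proj B z y = p B z" for z
      unfolding proj_finite[OF Bf] p_def col_def by (simp add: mult.commute)
    \<comment> \<open>Pairing \<open>p B\<close> on \<open>C\<close> with \<open>proj B\<close> at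
      \<open>delta y\<close> returns its own squared norm on \<open>C\<close>, so that norm is at
      most the tolerance 1/4. The factor 2 in \<open>f\<close> turns the square into 1/4.\<close>
    have far: "(\<Sum>z\<in>C. (cmod (f z))\<^sup>2) \<le> 1 / 4" if C: "finite C" "C \<subseteq> Y - K" for C
    proof -
      let ?L = "L2_set (\<lambda>z. cmod (p B z)) C"
      have "(\<Sum>z\<in>C. \<Sum>w\<in>{y}. cnj (p B z) * proj B z w * 1) = of_real (?L\<^sup>2)"
        by (simp add: projB L2_set_square complex_norm_square mult.commute del: of_real_power)
      then have "?L\<^sup>2 = cmod (\<Sum>z\<in>C. \<Sum>w\<in>{y}. cnj (p B z) * proj B z w * 1)"
        by (simp only: norm_of_real abs_power2)
      also have "\<dots> \<le> 1 / 4 * (?L * L2_set (\<lambda>w. cmod 1) {y})"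
        by (rule quasi_localD[OF r(2)])
          (use C y Metric_space.commute[OF metric_Y] in \<open>auto simp: K_def\<close>)
      finally have "?L * ?L \<le> ?L * (1 / 4)" by (simp add: power2_eq_square)
      then have L: "?L \<le> 1 / 4"
        using L2_set_nonneg[of "\<lambda>z. cmod (p B z)" C] by (cases "?L = 0") (auto simp: mult_le_cancel_left)
      have yK: "y \<in> K" using y r(1) Metric_space.zero[OF metric_Y, of y y] by (simp add: K_def)
      have "(\<Sum>z\<in>C. (cmod (f z))\<^sup>2) = (\<Sum>z\<in>C. 4 * (cmod (p B z))\<^sup>2)"
        using C yK by (intro sum.cong) (auto simp: f_def delta_def norm_mult power_mult_distrib)
      also have "\<dots> = 4 * ?L\<^sup>2" by (simp add: L2_set_square sum_distrib_left)
      also have "\<dots> \<le> 4 * (1 / 4)\<^sup>2" using L by (intro mult_left_mono power_mono) auto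
      finally show ?thesis by (simp add: power2_eq_square)
    qed
    have "l2norm Y f \<le> sqrt ((\<Sum>z\<in>K. (cmod (f z))\<^sup>2) + 1 / 4)"
    proof (rule l2_via_finite_norm)
      show "f z = 0" if "z \<notin> Y" for z using fl that by (rule l2_outside)
      fix F assume F: "finite F" "F \<subseteq> Y"
      have "(\<Sum>z\<in>F. (cmod (f z))\<^sup>2) = (\<Sum>z\<in>F \<inter> K. (cmod (f z))\<^sup>2) + (\<Sum>z\<in>F - K. (cmod (f z))\<^sup>2)"
        using F(1) by (rule sum.Int_Diff)
      also have "\<dots> \<le> (\<Sum>z\<in>K. (cmod (f z))\<^sup>2) + 1 / 4"
        using F K(1) by (intro add_mono sum_mono2 far) auto
      finally show "L2_set (\<lambda>z. cmod (f z)) F \<le> sqrt ((\<Sum>z\<in>K. (cmod (f z))\<^sup>2) + 1 / 4)"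
        unfolding L2_set_def by (rule real_sqrt_le_mono)
    qed
    then have "(l2norm Y f)\<^sup>2 \<le> (sqrt ((\<Sum>z\<in>K. (cmod (f z))\<^sup>2) + 1 / 4))\<^sup>2"
      by (intro power_mono l2norm_nonneg)
    \<comment> \<open>The unit mass of \<open>f\<close> is now bounded by three quarters: off
      \<open>K\<close>, from the fixed vector, and from the random part.\<close>
    then have "1 \<le> (\<Sum>z\<in>K. (cmod (f z))\<^sup>2) + 1 / 4"
      using nf by (simp add: sum_nonneg)
    also have "(\<Sum>z\<in>K. (cmod (f z))\<^sup>2)
        \<le> (\<Sum>z\<in>K. (cmod (delta y z - p G z))\<^sup>2) + (\<Sum>x\<in>G. \<Sum>z\<in>K. (cmod (a x z))\<^sup>2)"
      using B(2) unfolding f_eq .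
    also have "(\<Sum>z\<in>K. (cmod (delta y z - p G z))\<^sup>2) \<le> 1 / 4"
    proof -
      let ?h = "\<lambda>z. delta y z - of_real 1 * p G z"
      have pG: "p G \<in> l2 Y" and nh: "(l2norm Y ?h)\<^sup>2 = 1 - (\<Sum>x\<in>G. (cmod (u y x))\<^sup>2)"
        unfolding p_def using unitary_column_norm(1)[OF y G(1,2)] unitary_column_norm(2)[OF y G(1,2), of 1]
        by auto
      have hl: "?h \<in> l2 Y" using y pG by (intro l2_diff l2_scale) auto
      have "(L2_set (\<lambda>z. cmod (?h z)) K)\<^sup>2 \<le> (l2norm Y ?h)\<^sup>2"
        using L2_set_le_l2norm[OF hl K(1,2)] by (intro power_mono) auto
      also have "\<dots> \<le> 1 - (9 / 10)\<^sup>2" using sG nh by simp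
      also have "\<dots> \<le> 1 / 4" by (simp add: power2_eq_square)
      finally show ?thesis by (simp add: L2_set_square)
    qed
    also have "(\<Sum>x\<in>G. \<Sum>z\<in>K. (cmod (a x z))\<^sup>2) \<le> 1 / 4"
    proof -
      have "(\<Sum>x\<in>G. \<Sum>z\<in>K. (cmod (a x z))\<^sup>2) = (\<Sum>z\<in>K. \<Sum>x\<in>G. (cmod (u y x))\<^sup>2 * (cmod (u z x))\<^sup>2)"
        by (subst sum.swap) (simp add: a_def norm_mult power_mult_distrib)
      also have "\<dots> \<le> (\<Sum>z\<in>K. \<Sum>x\<in>G. \<delta>\<^sup>2 * (cmod (u z x))\<^sup>2)"
        using small G(2) by (intro sum_mono mult_right_mono power_mono) auto
      also have "\<dots> = (\<Sum>z\<in>K. \<delta>\<^sup>2 * (\<Sum>x\<in>G. (cmod (u z x))\<^sup>2))"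
        by (simp add: sum_distrib_left)
      also have "\<dots> \<le> (\<Sum>z\<in>K. \<delta>\<^sup>2 * 1)"
        using K(2) by (intro sum_mono mult_left_mono sum_row_le G(1,2)) auto
      also have "\<dots> = real (card K) * \<delta>\<^sup>2" by simp
      also have "\<dots> \<le> real N * \<delta>\<^sup>2" using K(3) by (intro mult_right_mono) auto
      also have "\<dots> \<le> 1 / 4" unfolding \<delta>(2) by (simp add: field_simps)
      finally show ?thesis .
    qed
    finally show False by simp
  qed
  with \<delta>(1) show thesis by (rule that)
qed

text \<open>\<open>proj {x}\<close> is the rank-one matrix of column \<open>x\<close>. Testing it
  between the far part of the column, of norm \<open>L\<close>, and \<open>delta y\<close> gives
  \<open>cmod (u y x) * L^2\<close> on one side and at most \<open>e * L\<close> on the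
  other.\<close>

lemma col_concentrated:
  assumes q: "quasi_local Y dY (proj {x}) e r" and x: "x \<in> X" and y: "y \<in> Y"
    and \<delta>: "0 < \<delta>" "\<delta> \<le> cmod (u y x)" and e: "0 \<le> e"
  shows "l2norm Y (\<lambda>z. col x z - restr {z\<in>Y. dY y z \<le> r} (col x) z) \<le> e / \<delta>"
proof (rule l2_via_finite_norm)
  let ?K = "{z\<in>Y. dY y z \<le> r}"
  show "col x z - restr ?K (col x) z = 0" if "z \<notin> Y" for z
    using l2_outside[OF col_l2[OF x] that] by (simp add: restr_def)
  fix F assume F: "finite F" "F \<subseteq> Y"
  define C where "C = F - ?K"
  let ?L = "L2_set (\<lambda>z. cmod (col x z)) C"
  have "(\<Sum>z\<in>F. (cmod (col x z - restr ?K (col x) z))\<^sup>2) = (\<Sum>z\<in>C. (cmod (col x z))\<^sup>2)"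
    by (rule sum.mono_neutral_cong_right) (use F in \<open>auto simp: restr_def C_def\<close>)
  then have L: "L2_set (\<lambda>z. cmod (col x z - restr ?K (col x) z)) F = ?L"
    by (simp add: L2_set_def)
  have "(\<Sum>z\<in>C. \<Sum>w\<in>{y}. cnj (col x z) * proj {x} z w * 1) = cnj (u y x) * of_real (?L\<^sup>2)"
  proof -
    have "(\<Sum>z\<in>C. \<Sum>w\<in>{y}. cnj (col x z) * proj {x} z w * 1)
        = (\<Sum>z\<in>C. cnj (u y x) * of_real ((cmod (col x z))\<^sup>2))"
    proof (rule sum.cong)
      fix z
      have "proj {x} z y = u z x * cnj (u y x)" using x by (simp add: proj_finite)
      then show "(\<Sum>w\<in>{y}. cnj (col x z) * proj {x} z w * 1)
          = cnj (u y x) * of_real ((cmod (col x z))\<^sup>2)"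
        unfolding complex_norm_square by (simp add: col_def mult_ac)
    qed simp
    then show ?thesis by (simp add: L2_set_square sum_distrib_left)
  qed
  then have "cmod (u y x) * ?L\<^sup>2 = cmod (\<Sum>z\<in>C. \<Sum>w\<in>{y}. cnj (col x z) * proj {x} z w * 1)"
    by (simp only: norm_mult complex_mod_cnj norm_of_real abs_power2)
  also have "\<dots> \<le> e * (?L * L2_set (\<lambda>w. cmod 1) {y})"
    by (rule quasi_localD[OF q])
      (use F y Metric_space.commute[OF metric_Y] in \<open>auto simp: C_def\<close>)
  finally have "cmod (u y x) * ?L\<^sup>2 \<le> e * ?L" by simp
  moreover have "\<delta> * ?L\<^sup>2 \<le> cmod (u y x) * ?L\<^sup>2" using \<delta>(2) by (intro mult_right_mono) auto
  ultimately have "?L * (\<delta> * ?L) \<le> ?L * e" by (simp add: power2_eq_square algebra_simps)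
  then have "\<delta> * ?L \<le> e"
    using L2_set_nonneg[of "\<lambda>z. cmod (col x z)" C] e by (cases "?L = 0") (auto simp: mult_le_cancel_left)
  then show "L2_set (\<lambda>z. cmod (col x z - restr ?K (col x) z)) F \<le> e / \<delta>"
    unfolding L using \<delta>(1) by (simp add: field_simps)
qed

text \<open>Columns are concentrated near their large entries, and the image of the summation operator
  over \<open>r\<close>-balls is quasi-local with coefficient 1 between the columns of \<open>r\<close>-close points.\<close>

lemma large_entries_coarse:
  assumes \<delta>: "0 < \<delta>" and r: "0 < r"
  shows "\<exists>R. \<forall>x\<in>X. \<forall>x'\<in>X. \<forall>y\<in>Y. \<forall>y'\<in>Y.
    \<delta> \<le> cmod (u y x) \<longrightarrow> \<delta> \<le> cmod (u y' x') \<longrightarrow> dX x x' \<le> r \<longrightarrow> dY y y' \<le> R"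
proof -
  define T where "T = neighbour_sum X dX r"
  have T: "T \<in> uniform_roe X dX" unfolding T_def using metric_X ulf_X r by (rule neighbour_sum_roe)
  obtain S where S: "S \<in> uniform_roe Y dY"
    "\<forall>x\<in>X. \<forall>x'\<in>X. entry T x x' = l2inner Y (col x) (S (col x'))"
    using roe_transport[OF T] by (elim bexE conjE)
  have bS: "bounded_op Y S" using S(1) by (rule uniform_roe_bounded)
  obtain c where c: "0 < c" "\<And>f. f \<in> l2 Y \<Longrightarrow> l2norm Y (S f) \<le> c * l2norm Y f"
    using bounded_op_bound[OF bS] by blast
  \<comment> \<open>\<open>t\<close> bounds the tails of both columns, and
    \<open>c * t = 1 / 4\<close> makes each tail term at most 1/4. The tolerance for
    \<open>proj\<close> is \<open>\<delta> * t\<close> because \<open>col_concentrated\<close>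
    divides by \<open>\<delta>\<close>.\<close>
  define t where "t = 1 / (4 * c)"
  have t: "0 < t" "c * t = 1 / 4" using c(1) by (simp_all add: t_def)
  obtain r1 where r1: "0 < r1" "\<And>A. quasi_local Y dY (proj A) (\<delta> * t) r1"
    using proj_uniformly_quasi_local[of "\<delta> * t"] \<delta> t(1) by auto
  obtain r2 where r2: "quasi_local Y dY (entry S) (1 / 4) r2"
    using uniform_roe_quasi_local[OF S(1), of "1 / 4"] by auto
  \<comment> \<open>Beyond this distance the balls of radius \<open>r1\<close> that carry the two
    columns would be more than \<open>r2\<close> apart, and the entry 1 of \<open>T\<close> would be
    a sum of three terms of modulus at most 1/4.\<close>
  have "dY y y' \<le> 2 * r1 + r2"
    if x: "x \<in> X" "x' \<in> X" and y: "y \<in> Y" "y' \<in> Y" and u: "\<delta> \<le> cmod (u y x)" "\<delta> \<le> cmod (u y' x')"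
      and d: "dX x x' \<le> r" for x x' y y'
  proof (rule ccontr)
    assume far: "\<not> dY y y' \<le> 2 * r1 + r2"
    define K where "K = {z\<in>Y. dY y z \<le> r1}"
    define K' where "K' = {z\<in>Y. dY y' z \<le> r1}"
    have K: "finite K" "K \<subseteq> Y" and K': "finite K'" "K' \<subseteq> Y"
      using ulf_Y r1(1) y unfolding ulf_def K_def K'_def by blast+
    define a where "a = restr K (col x)"
    define b where "b = restr K' (col x')"
    have a: "a \<in> l2 Y" "l2norm Y a \<le> 1"
      unfolding a_def using restr_l2[OF col_l2[OF x(1)]] l2norm_restr_le[OF col_l2[OF x(1)], of K]
        col_norm[OF x(1)] by auto
    have b: "b \<in> l2 Y" "l2norm Y b \<le> 1"
      unfolding b_def using restr_l2[OF col_l2[OF x(2)]] l2norm_restr_le[OF col_l2[OF x(2)], of K']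
        col_norm[OF x(2)] by auto
    define a' where "a' = (\<lambda>z. col x z - a z)"
    define b' where "b' = (\<lambda>z. col x' z - b z)"
    have a': "a' \<in> l2 Y" "l2norm Y a' \<le> t"
      using l2_diff[OF col_l2[OF x(1)] a(1)] col_concentrated[OF r1(2) x(1) y(1) \<delta> u(1)] \<delta> t(1)
      unfolding a'_def a_def K_def by auto
    have b': "b' \<in> l2 Y" "l2norm Y b' \<le> t"
      using l2_diff[OF col_l2[OF x(2)] b(1)] col_concentrated[OF r1(2) x(2) y(2) \<delta> u(2)] \<delta> t(1)
      unfolding b'_def b_def K'_def by auto
    have Sm: "S f \<in> l2 Y" if "f \<in> l2 Y" for f using bS that by (rule bounded_op_mem)
    have cx': "col x' \<in> l2 Y" using x(2) by (rule col_l2)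
    have "1 = entry T x x'"
      using entry_neighbour_sum[OF x, of dX r] d ulf_X r x(1) unfolding ulf_def T_def by fastforce
    also have "\<dots> = l2inner Y (col x) (S (col x'))" using S(2) x by simp
    also have "\<dots> = l2inner Y (\<lambda>z. a' z + a z) (S (col x'))" by (simp add: a'_def)
    also have "\<dots> = l2inner Y a' (S (col x')) + l2inner Y a (S (col x'))"
      by (rule l2inner_add_left[OF Sm[OF cx'] a'(1) a(1)])
    also have "S (col x') = S (\<lambda>z. b' z + b z)" by (simp add: b'_def)
    also have "\<dots> = (\<lambda>z. S b' z + S b z)" by (rule bounded_op_add[OF bS b'(1) b(1)])
    also have "l2inner Y a (\<lambda>z. S b' z + S b z) = l2inner Y a (S b') + l2inner Y a (S b)"
      by (rule l2inner_add_right[OF a(1) Sm[OF b'(1)] Sm[OF b(1)]])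
    also have "(\<lambda>z. S b' z + S b z) = S (col x')"
      using bounded_op_add[OF bS b'(1) b(1)] by (simp add: b'_def)
    finally have "1 = cmod (l2inner Y a' (S (col x')) + (l2inner Y a (S b') + l2inner Y a (S b)))"
      by (metis norm_one)
    also have "\<dots> \<le> cmod (l2inner Y a' (S (col x'))) + (cmod (l2inner Y a (S b')) + cmod (l2inner Y a (S b)))"
      by (intro order_trans[OF norm_triangle_ineq] add_left_mono norm_triangle_ineq)
    also have "cmod (l2inner Y a' (S (col x'))) \<le> 1 / 4"
    proof -
      have "cmod (l2inner Y a' (S (col x'))) \<le> l2norm Y a' * l2norm Y (S (col x'))"
        by (rule l2inner_bound[OF a'(1) Sm[OF cx']])
      also have "\<dots> \<le> t * c"
        using a'(2) c(2)[OF cx'] col_norm[OF x(2)] t(1) by (intro mult_mono) (auto simp: l2norm_nonneg)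
      finally show ?thesis using t(2) by (simp add: mult.commute)
    qed
    also have "cmod (l2inner Y a (S b')) \<le> 1 / 4"
    proof -
      have "cmod (l2inner Y a (S b')) \<le> l2norm Y a * l2norm Y (S b')"
        by (rule l2inner_bound[OF a(1) Sm[OF b'(1)]])
      also have "\<dots> \<le> 1 * (c * t)"
        using a(2) c(1) b'(2) by (intro mult_mono order_trans[OF c(2)[OF b'(1)]]) (auto simp: l2norm_nonneg)
      finally show ?thesis using t(2) by simp
    qed
    also have "cmod (l2inner Y a (S b)) \<le> 1 / 4"
    proof -
      have sep: "r2 < dY z z'" if z: "z \<in> K" "z' \<in> K'" for z z'
      proof -
        have m: "z \<in> Y" "z' \<in> Y" "dY y z \<le> r1" "dY z' y' \<le> r1"
          using z Metric_space.commute[OF metric_Y] by (auto simp: K_def K'_def)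
        have "dY y y' \<le> dY y z + dY z y'" "dY z y' \<le> dY z z' + dY z' y'"
          using Metric_space.triangle[OF metric_Y] m y by auto
        then show ?thesis using far m by linarith
      qed
      have "cmod (l2inner Y a (S b)) \<le> 1 / 4 * (L2_set (\<lambda>z. cmod (col x z)) K * L2_set (\<lambda>z. cmod (col x' z)) K')"
        unfolding a_def b_def l2inner_matrix_form[OF bS K K']
        by (rule quasi_localD[OF r2 K(1) K'(1) K(2) K'(2) sep])
      also have "\<dots> = 1 / 4 * (l2norm Y a * l2norm Y b)"
        unfolding a_def b_def l2norm_restr_finite[OF K] l2norm_restr_finite[OF K'] ..
      also have "\<dots> \<le> 1 / 4 * (1 * 1)"
        using a(2) b(2) by (intro mult_left_mono mult_mono) (auto simp: l2norm_nonneg)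
      finally show ?thesis by simp
    qed
    finally show False by simp
  qed
  then show ?thesis by blast
qed

text \<open>Averaging over all sign vectors on \<open>A\<close> recovers a combination of columns indexed by \<open>A\<close>
  from the uniformly quasi-local matrices \<open>proj B\<close>. Hence such a combination cannot vanish
  on the neighbourhood of \<open>f ` A\<close>, which gives Hall's condition by counting dimensions.\<close>

lemma neighbourhood_hall_condition:
  assumes \<delta>: "0 < \<delta>" and f: "\<And>x. x \<in> X \<Longrightarrow> f x \<in> Y" "\<And>x. x \<in> X \<Longrightarrow> \<delta> \<le> cmod (u (f x) x)"
  shows "\<exists>r>0. \<forall>A. finite A \<longrightarrow> A \<subseteq> X \<longrightarrow> card A \<le> card (\<Union>x\<in>A. {y\<in>Y. dY (f x) y \<le> r})"
proof -
  \<comment> \<open>Two losses must be beaten: a factor 2, as \<open>Pow A\<close> has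
    \<open>2 ^ card A\<close> members but the average yields \<open>2 ^ (card A - 1)\<close>, and
    \<open>1 / \<delta>^2\<close> from the norm of \<open>b B\<close>. Their product with
    \<open>e\<close> is 1/2.\<close>
  define e where "e = \<delta>\<^sup>2 / 4"
  have e: "0 < e" using \<delta> by (simp add: e_def)
  obtain r where r: "0 < r" "\<And>A. quasi_local Y dY (proj A) e r"
    using proj_uniformly_quasi_local[OF e] by blast
  have "card A \<le> card (\<Union>x\<in>A. {y\<in>Y. dY (f x) y \<le> r})" if A: "finite A" "A \<subseteq> X" for A
  proof (rule ccontr)
    define N where "N = (\<Union>x\<in>A. {y\<in>Y. dY (f x) y \<le> r})"
    assume "\<not> ?thesis"
    then have less: "card N < card A" by (simp add: N_def)
    have "finite {y\<in>Y. dY (f x) y \<le> r}" if "x \<in> A" for x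
      using ulf_Y r(1) f(1) A(2) that unfolding ulf_def by blast
    then have finN: "finite N" unfolding N_def using A(1) by blast
    \<comment> \<open>The combination \<open>\<zeta>\<close> of columns with coefficients
      \<open>g\<close> vanishes on \<open>N\<close>, while by orthonormality it has the norm of
      \<open>g\<close>.\<close>
    obtain g where g: "\<exists>x\<in>A. g x \<noteq> 0" "\<forall>y\<in>N. (\<Sum>x\<in>A. g x * u y x) = 0"
      using underdetermined_nontrivial_solution[OF finN A(1) less, of u] by blast
    define \<zeta> where "\<zeta> = (\<lambda>y. \<Sum>x\<in>A. g x * col x y)"
    have colA: "col x \<in> l2 Y" if "x \<in> A" for x using that A(2) col_l2 by auto
    have \<zeta>: "\<zeta> \<in> l2 Y" unfolding \<zeta>_def using A(1) colA by (rule l2_sum)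
    let ?n = "L2_set (\<lambda>x. cmod (g x)) A"
    have n\<zeta>: "l2norm Y \<zeta> = ?n"
    proof -
      have c: "l2inner Y (col x) \<zeta> = g x" if x: "x \<in> A" for x
      proof -
        have "l2inner Y (col x) \<zeta> = (\<Sum>i\<in>A. g i * l2inner Y (col x) (col i))"
          unfolding \<zeta>_def using A(1) colA[OF x] colA by (rule l2inner_sum_right)
        also have "\<dots> = (\<Sum>i\<in>A. if i = x then g x else 0)"
          using A(2) x by (intro sum.cong) (auto simp: col_inner subset_iff)
        also have "\<dots> = g x" using x A(1) by simp
        finally show ?thesis .
      qed
      have "of_real ((l2norm Y \<zeta>)\<^sup>2) = l2inner Y \<zeta> \<zeta>" by (rule l2inner_self[OF \<zeta>, symmetric])
      also have "\<dots> = (\<Sum>x\<in>A. cnj (g x) * l2inner Y (col x) \<zeta>)"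
        using l2inner_sum_left[OF A(1) \<zeta>, of col g] colA by (simp add: \<zeta>_def)
      also have "\<dots> = (\<Sum>x\<in>A. of_real ((cmod (g x))\<^sup>2))"
        unfolding complex_norm_square by (intro sum.cong) (auto simp: c mult.commute)
      also have "\<dots> = of_real (?n\<^sup>2)" by (simp add: L2_set_square)
      finally have "(l2norm Y \<zeta>)\<^sup>2 = ?n\<^sup>2" by (simp only: of_real_eq_iff)
      then show ?thesis by (simp add: l2norm_nonneg)
    qed
    have npos: "0 < ?n"
    proof -
      have "?n \<noteq> 0" using g(1) A(1) by (auto simp: L2_set_eq_0_iff)
      then show ?thesis using L2_set_nonneg[of "\<lambda>x. cmod (g x)" A] by linarith
    qed
    \<comment> \<open>The division cancels in advance the diagonal factor produced by averaging.
      \<open>b B\<close> is \<open>h\<close> with the signs of \<open>B\<close>, pushed forward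
      along \<open>f\<close>; it sums over fibres because \<open>f\<close> may identify
      points.\<close>
    define h where "h x = g x / cnj (u (f x) x)" for x
    define sg where "sg B x = (if x \<in> B then -1 else 1 :: complex)" for B and x :: 'a
    define b where "b B z = (\<Sum>x\<in>{x\<in>A. f x = z}. h x * sg B x)" for B z
    have unz: "u (f x) x \<noteq> 0" if "x \<in> A" for x using f(2)[of x] \<delta> A(2) that by auto
    have hg: "cmod (h x) \<le> cmod (g x) / \<delta>" if "x \<in> A" for x
      using f(2)[of x] \<delta> A(2) that unfolding h_def norm_divide complex_mod_cnj
      by (intro divide_left_mono mult_pos_pos) auto
    \<comment> \<open>Row \<open>z\<close> is a unit vector to which each point of the fibre
      contributes at least \<open>\<delta>^2\<close>.\<close>
    have fibre: "real (card {x\<in>A. f x = z}) \<le> 1 / \<delta>\<^sup>2" if z: "z \<in> Y" for z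
    proof -
      let ?A = "{x\<in>A. f x = z}"
      have "real (card ?A) * \<delta>\<^sup>2 = (\<Sum>x\<in>?A. \<delta>\<^sup>2)" by simp
      also have "\<dots> \<le> (\<Sum>x\<in>?A. (cmod (u z x))\<^sup>2)"
        using f(2) A(2) \<delta> by (intro sum_mono power_mono) auto
      also have "\<dots> \<le> 1" using z A by (intro sum_row_le) auto
      finally show ?thesis using \<delta> by (simp add: field_simps)
    qed
    \<comment> \<open>Summing over fibres and dividing by large entries each cost a factor
      \<open>1 / \<delta>\<close> in norm.\<close>
    have bn: "L2_set (\<lambda>z. cmod (b B z)) (f ` A) \<le> ?n / \<delta>\<^sup>2" for B
    proof -
      have pt: "(cmod (b B z))\<^sup>2 \<le> 1 / \<delta>\<^sup>2 * (\<Sum>x\<in>{x\<in>A. f x = z}. (cmod (h x))\<^sup>2)" if z: "z \<in> f ` A" for z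
      proof -
        let ?A = "{x\<in>A. f x = z}"
        have "cmod (b B z) \<le> (\<Sum>x\<in>?A. cmod (h x))"
          unfolding b_def by (rule order_trans[OF norm_sum]) (auto intro!: sum_mono simp: norm_mult sg_def)
        then have "(cmod (b B z))\<^sup>2 \<le> (\<Sum>x\<in>?A. cmod (h x))\<^sup>2" by (rule power_mono) simp
        also have "\<dots> \<le> (\<Sum>x\<in>?A. (cmod (h x))\<^sup>2) * card ?A" by (rule sum_squared_le_sum_of_squares)
        also have "\<dots> \<le> (\<Sum>x\<in>?A. (cmod (h x))\<^sup>2) * (1 / \<delta>\<^sup>2)"
          using z f(1) A(2) by (intro mult_left_mono fibre sum_nonneg) auto
        finally show ?thesis by (simp add: mult.commute)
      qed
      have "(\<Sum>z\<in>f ` A. (cmod (b B z))\<^sup>2)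
          \<le> (\<Sum>z\<in>f ` A. 1 / \<delta>\<^sup>2 * (\<Sum>x\<in>{x\<in>A. f x = z}. (cmod (h x))\<^sup>2))"
        by (rule sum_mono) (rule pt)
      also have "\<dots> = 1 / \<delta>\<^sup>2 * (\<Sum>z\<in>f ` A. \<Sum>x\<in>{x\<in>A. f x = z}. (cmod (h x))\<^sup>2)"
        by (simp only: sum_distrib_left)
      also have "(\<Sum>z\<in>f ` A. \<Sum>x\<in>{x\<in>A. f x = z}. (cmod (h x))\<^sup>2) = (\<Sum>x\<in>A. (cmod (h x))\<^sup>2)"
        by (rule sum.image_gen[OF A(1), symmetric])
      also have "1 / \<delta>\<^sup>2 * (\<Sum>x\<in>A. (cmod (h x))\<^sup>2) \<le> 1 / \<delta>\<^sup>2 * (\<Sum>x\<in>A. (cmod (g x) / \<delta>)\<^sup>2)"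
        using hg by (intro mult_left_mono sum_mono power_mono) auto
      also have "\<dots> = (?n / \<delta>\<^sup>2)\<^sup>2"
        by (simp add: power_divide L2_set_square sum_divide_distrib[symmetric])
      finally show ?thesis
        unfolding L2_set_def[of "\<lambda>z. cmod (b B z)"] by (intro real_le_lsqrt) auto
    qed
    have "l2norm Y \<zeta> \<le> ?n / 2"
    proof (rule l2_via_finite_norm)
      show "\<zeta> y = 0" if "y \<notin> Y" for y using \<zeta> that by (rule l2_outside)
      fix F assume F: "finite F" "F \<subseteq> Y"
      define C where "C = F - N"
      let ?L = "L2_set (\<lambda>y. cmod (\<zeta> y)) C"
      have "(\<Sum>y\<in>F. (cmod (\<zeta> y))\<^sup>2) = (\<Sum>y\<in>C. (cmod (\<zeta> y))\<^sup>2)"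
        by (rule sum.mono_neutral_right) (use F g(2) in \<open>auto simp: C_def \<zeta>_def col_def\<close>)
      then have L: "L2_set (\<lambda>y. cmod (\<zeta> y)) F = ?L" by (simp add: L2_set_def)
      \<comment> \<open>After expanding \<open>proj B\<close>, only the index \<open>i = x\<close>
        survives the signed sum, and \<open>h x * cnj (u (f x) x) = g x\<close>. Compared with the
        reflections, \<open>proj B\<close> changes only scale and sign, as the signs cancel the
        constant part.\<close>
      have avg: "(\<Sum>B\<in>Pow A. \<Sum>z\<in>f ` A. proj B y z * b B z) = - (2 ^ (card A - 1)) * \<zeta> y" for y
      proof -
        have "(\<Sum>z\<in>f ` A. proj B y z * b B z) = (\<Sum>x\<in>A. proj B y (f x) * (h x * sg B x))" for B
        proof -
          have "(\<Sum>x\<in>A. proj B y (f x) * (h x * sg B x))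
              = (\<Sum>z\<in>f ` A. \<Sum>x\<in>{x\<in>A. f x = z}. proj B y (f x) * (h x * sg B x))"
            by (rule sum.image_gen[OF A(1)])
          also have "\<dots> = (\<Sum>z\<in>f ` A. proj B y z * b B z)"
            unfolding b_def sum_distrib_left by (intro sum.cong) auto
          finally show ?thesis by simp
        qed
        then have "(\<Sum>B\<in>Pow A. \<Sum>z\<in>f ` A. proj B y z * b B z)
            = (\<Sum>B\<in>Pow A. \<Sum>x\<in>A. proj B y (f x) * (h x * sg B x))" by simp
        also have "\<dots> = (\<Sum>x\<in>A. \<Sum>B\<in>Pow A. proj B y (f x) * (h x * sg B x))" by (rule sum.swap)
        also have "\<dots> = (\<Sum>x\<in>A. h x * (\<Sum>B\<in>Pow A. sg B x * (\<Sum>i\<in>B. u y i * cnj (u (f x) i))))"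
          unfolding sum_distrib_left[of "h _"]
        proof (intro sum.cong refl)
          fix x B assume "B \<in> Pow A"
          then have "finite B" "B \<subseteq> X" using A finite_subset by auto
          then show "proj B y (f x) * (h x * sg B x) = h x * (sg B x * (\<Sum>i\<in>B. u y i * cnj (u (f x) i)))"
            by (simp add: proj_finite)
        qed
        also have "\<dots> = (\<Sum>x\<in>A. - (2 ^ (card A - 1)) * (g x * col x y))"
        proof (intro sum.cong refl)
          fix x assume x: "x \<in> A"
          show "h x * (\<Sum>B\<in>Pow A. sg B x * (\<Sum>i\<in>B. u y i * cnj (u (f x) i)))
              = - (2 ^ (card A - 1)) * (g x * col x y)"
            unfolding sg_def signed_subset_sum[OF A(1) x] using unz[OF x] by (simp add: h_def col_def)
        qed
        also have "\<dots> = - (2 ^ (card A - 1)) * \<zeta> y"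
          by (simp only: \<zeta>_def sum_distrib_left)
        finally show ?thesis .
      qed
      have A0: "0 < card A" using less by simp
      let ?w = "2 ^ (card A - 1) :: real"
      have w2: "2 * ?w = 2 ^ card A" using A0 by (simp flip: power_Suc)
      have "(\<Sum>B\<in>Pow A. \<Sum>y\<in>C. \<Sum>z\<in>f ` A. cnj (\<zeta> y) * proj B y z * b B z)
          = (\<Sum>y\<in>C. cnj (\<zeta> y) * (\<Sum>B\<in>Pow A. \<Sum>z\<in>f ` A. proj B y z * b B z))"
        by (subst sum.swap) (simp add: sum_distrib_left mult.assoc)
      also have "\<dots> = (\<Sum>y\<in>C. - of_real ?w * of_real ((cmod (\<zeta> y))\<^sup>2))"
        unfolding avg complex_norm_square by (intro sum.cong) (simp_all add: mult_ac)
      also have "\<dots> = - of_real (?w * ?L\<^sup>2)"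
        by (simp add: L2_set_square sum_distrib_left sum_negf)
      finally have eq: "(\<Sum>B\<in>Pow A. \<Sum>y\<in>C. \<Sum>z\<in>f ` A. cnj (\<zeta> y) * proj B y z * b B z)
          = - of_real (?w * ?L\<^sup>2)" .
      have "?w * ?L\<^sup>2 = cmod (\<Sum>B\<in>Pow A. \<Sum>y\<in>C. \<Sum>z\<in>f ` A. cnj (\<zeta> y) * proj B y z * b B z)"
        unfolding eq by (simp only: norm_minus_cancel norm_of_real) simp
      also have "\<dots> \<le> (\<Sum>B\<in>Pow A. cmod (\<Sum>y\<in>C. \<Sum>z\<in>f ` A. cnj (\<zeta> y) * proj B y z * b B z))"
        by (rule norm_sum)
      also have "\<dots> \<le> (\<Sum>B\<in>Pow A. e * (?L * (?n / \<delta>\<^sup>2)))"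
      proof (rule sum_mono)
        fix B
        have "cmod (\<Sum>y\<in>C. \<Sum>z\<in>f ` A. cnj (\<zeta> y) * proj B y z * b B z)
            \<le> e * (?L * L2_set (\<lambda>z. cmod (b B z)) (f ` A))"
        proof (rule quasi_localD[OF r(2)])
          fix y z assume "y \<in> C" "z \<in> f ` A"
          then have "\<not> dY z y \<le> r" using F by (auto simp: C_def N_def)
          then show "r < dY y z" using Metric_space.commute[OF metric_Y, of y z] by simp
        qed (use F A f(1) in \<open>auto simp: C_def\<close>)
        also have "\<dots> \<le> e * (?L * (?n / \<delta>\<^sup>2))"
          using e by (intro mult_left_mono bn) auto
        finally show "cmod (\<Sum>y\<in>C. \<Sum>z\<in>f ` A. cnj (\<zeta> y) * proj B y z * b B z) \<le> e * (?L * (?n / \<delta>\<^sup>2))" .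
      qed
      also have "\<dots> = 2 ^ card A * (e * (?L * (?n / \<delta>\<^sup>2)))" using A(1) by (simp add: card_Pow)
      also have "\<dots> = ?w * (?L * (?n / 2))"
        unfolding w2[symmetric] using \<delta> by (simp add: e_def field_simps)
      finally have "?L * ?L \<le> ?L * (?n / 2)" by (simp add: power2_eq_square)
      then show "L2_set (\<lambda>y. cmod (\<zeta> y)) F \<le> ?n / 2"
        unfolding L using L2_set_nonneg[of "\<lambda>y. cmod (\<zeta> y)" C] npos
        by (cases "?L = 0") (auto simp: mult_le_cancel_left)
    qed
    then show False using n\<zeta> npos by simp
  qed
  then show ?thesis using r(1) by blast
qed

text \<open>Balls are finite, so the marriage theorem applies to the family of balls around the
  points \<open>f x\<close>, even for infinite \<open>X\<close>.\<close>

lemma injection_near_large_entries: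
  assumes \<delta>: "0 < \<delta>" and f: "\<And>x. x \<in> X \<Longrightarrow> f x \<in> Y" "\<And>x. x \<in> X \<Longrightarrow> \<delta> \<le> cmod (u (f x) x)"
  shows "\<exists>r>0. \<exists>i. inj_on i X \<and> (\<forall>x\<in>X. i x \<in> Y \<and> dY (f x) (i x) \<le> r)"
proof -
  obtain r where r: "0 < r" "\<And>A. finite A \<Longrightarrow> A \<subseteq> X \<Longrightarrow> card A \<le> card (\<Union>x\<in>A. {y\<in>Y. dY (f x) y \<le> r})"
    using neighbourhood_hall_condition[OF \<delta> f] by blast
  have "finite {y\<in>Y. dY (f x) y \<le> r}" if "x \<in> X" for x
    using ulf_Y r(1) f(1) that unfolding ulf_def by blast
  then obtain i where "inj_on i X" "\<And>x. x \<in> X \<Longrightarrow> i x \<in> {y\<in>Y. dY (f x) y \<le> r}"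
    using hall_rado[of X "\<lambda>x. {y\<in>Y. dY (f x) y \<le> r}"] r(2) by blast
  then show ?thesis using r(1) by (intro exI[of _ r] conjI exI[of _ i]) auto
qed

end

section \<open>Rigidity\<close>

theorem theorem3p1:
  fixes X :: "'a set" and dX :: "'a \<Rightarrow> 'a \<Rightarrow> real"
    and Y :: "'b set" and dY :: "'b \<Rightarrow> 'b \<Rightarrow> real"
  assumes "Metric_space X dX" and "Metric_space Y dY"
    and "ulf X dX" and "ulf Y dY"
    and "\<exists>\<Phi>. star_iso X dX Y dY \<Phi>"
  shows "bij_coarsely_equivalent X dX Y dY"
proof (cases "X = {}")
  case True
  obtain \<Phi> where "roe_iso X dX Y dY \<Phi>" using assms(5) star_iso_imp_roe_iso by blast
  then have "Y = {}" using roe_iso_empty True by blast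
  then show ?thesis
    using True by (auto simp: bij_coarsely_equivalent_def coarse_equivalence_def coarse_map_def
        close_maps_def bij_betw_def intro: exI[of _ 1])
next
  case False
  obtain \<Phi> where \<Phi>: "roe_iso X dX Y dY \<Phi>" using assms(5) star_iso_imp_roe_iso by blast
  obtain u where u: "unitary_impl X dX Y dY u"
    using roe_iso_imp_unitary_impl[OF assms(1,2) \<Phi> False] .
  interpret U: roe_unitary X dX Y dY u
    using assms(1-4) u by (rule roe_unitary.intro)
  interpret V: roe_unitary Y dY X dX "\<lambda>x y. cnj (u y x)"
    using assms(2,1,4,3) unitary_impl_swap[OF u] by (rule roe_unitary.intro)
  obtain \<delta>1 where \<delta>1: "0 < \<delta>1" "\<And>y. y \<in> Y \<Longrightarrow> \<exists>x\<in>X. \<delta>1 \<le> cmod (u y x)"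
    using U.large_entry_in_row by blast
  obtain \<delta>2 where \<delta>2: "0 < \<delta>2" "\<And>x. x \<in> X \<Longrightarrow> \<exists>y\<in>Y. \<delta>2 \<le> cmod (cnj (u y x))"
    using V.large_entry_in_row by blast
  \<comment> \<open>One threshold for both directions, so that the coarse bounds apply to entries
    selected by \<open>f\<close> and by \<open>g\<close> together.\<close>
  define \<delta> where "\<delta> = min \<delta>1 \<delta>2"
  have \<delta>: "0 < \<delta>" using \<delta>1 \<delta>2 by (simp add: \<delta>_def)
  have "\<forall>x\<in>X. \<exists>y. y \<in> Y \<and> \<delta> \<le> cmod (u y x)"
    using \<delta>2(2) by (force simp: \<delta>_def min_le_iff_disj)
  then obtain f where f: "\<And>x. x \<in> X \<Longrightarrow> f x \<in> Y" "\<And>x. x \<in> X \<Longrightarrow> \<delta> \<le> cmod (u (f x) x)"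
    by metis
  have "\<forall>y\<in>Y. \<exists>x. x \<in> X \<and> \<delta> \<le> cmod (u y x)"
    using \<delta>1(2) by (force simp: \<delta>_def min_le_iff_disj)
  then obtain g where g: "\<And>y. y \<in> Y \<Longrightarrow> g y \<in> X" "\<And>y. y \<in> Y \<Longrightarrow> \<delta> \<le> cmod (u y (g y))"
    by metis
  obtain r1 i where i: "0 < r1" "inj_on i X" "\<forall>x\<in>X. i x \<in> Y \<and> dY (f x) (i x) \<le> r1"
    using U.injection_near_large_entries[of \<delta> f, OF \<delta> f] by blast
  have "\<exists>r>0. \<exists>j. inj_on j Y \<and> (\<forall>y\<in>Y. j y \<in> X \<and> dX (g y) (j y) \<le> r)"
    by (rule V.injection_near_large_entries[OF \<delta> g(1)]) (simp_all add: g(2))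
  then obtain r2 j where j: "0 < r2" "inj_on j Y" "\<forall>y\<in>Y. j y \<in> X \<and> dX (g y) (j y) \<le> r2"
    by blast
  have U_coarse: "\<exists>R. \<forall>x\<in>X. \<forall>x'\<in>X. \<forall>y\<in>Y. \<forall>y'\<in>Y.
      \<delta> \<le> cmod (u y x) \<longrightarrow> \<delta> \<le> cmod (u y' x') \<longrightarrow> dX x x' \<le> r \<longrightarrow> dY y y' \<le> R" if "0 < r" for r
    using \<delta> that by (rule U.large_entries_coarse)
  have V_coarse: "\<exists>R. \<forall>y\<in>Y. \<forall>y'\<in>Y. \<forall>x\<in>X. \<forall>x'\<in>X.
      \<delta> \<le> cmod (u y x) \<longrightarrow> \<delta> \<le> cmod (u y' x') \<longrightarrow> dY y y' \<le> r \<longrightarrow> dX x x' \<le> R" if "0 < r" for r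
    using V.large_entries_coarse[OF \<delta> that] by simp
  obtain R0 where R0: "\<And>x x' y y'. x \<in> X \<Longrightarrow> x' \<in> X \<Longrightarrow> y \<in> Y \<Longrightarrow> y' \<in> Y \<Longrightarrow>
      \<delta> \<le> cmod (u y x) \<Longrightarrow> \<delta> \<le> cmod (u y' x') \<Longrightarrow> dX x x' \<le> r2 \<Longrightarrow> dY y y' \<le> R0"
    using U_coarse[OF j(1)] by blast
  \<comment> \<open>The entries at \<open>(y, g y)\<close> and \<open>(f (j y), j y)\<close> are
    both large and their column indices are within \<open>r2\<close>, so their row indices are
    close: \<open>f\<close> nearly inverts \<open>j\<close>.\<close>
  have fj: "dY (f (j y)) y \<le> R0" if y: "y \<in> Y" for y
    using R0[of "g y" "j y" y "f (j y)"] f g j(3) y Metric_space.commute[OF assms(2)] by auto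
  have iY: "i ` X \<subseteq> Y" and jX: "j ` Y \<subseteq> X" using i(3) j(3) by auto
  obtain F where F: "bij_betw F X Y" "\<And>x. x \<in> X \<Longrightarrow> F x = i x \<or> j (F x) = x"
    using Schroeder_Bernstein_graph[OF i(2) iY j(2) jX] by blast
  have FY: "F x \<in> Y" if "x \<in> X" for x using F(1) that by (rule bij_betwE[THEN bspec])
  define M where "M = max r1 R0"
  \<comment> \<open>Where \<open>F\<close> follows \<open>j\<close> backwards,
    \<open>f x = f (j (F x))\<close>, which is near \<open>F x\<close> by \<open>fj\<close>.\<close>
  have near: "dY (f x) (F x) \<le> M" if x: "x \<in> X" for x
    using F(2)[OF x]
  proof
    assume "F x = i x"
    then show ?thesis using i(3) x by (simp add: M_def max.coboundedI1)
  next
    assume "j (F x) = x"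
    then show ?thesis using fj[OF FY[OF x]] by (simp add: M_def max.coboundedI2)
  qed
  have M: "0 < M" using i(1) by (simp add: M_def)
  have tri4: "dY a c \<le> dY a b + dY b b' + dY c b'" if "a \<in> Y" "b \<in> Y" "b' \<in> Y" "c \<in> Y" for a b b' c
    using Metric_space.triangle[OF assms(2), of a b c] Metric_space.triangle[OF assms(2), of b b' c]
      Metric_space.commute[OF assms(2), of c b'] that by simp
  have coarse_F: "coarse_map X dX dY F"
    unfolding coarse_map_def
  proof (intro allI impI)
    fix r :: real assume "0 < r"
    then obtain R where R: "\<And>x x' y y'. x \<in> X \<Longrightarrow> x' \<in> X \<Longrightarrow> y \<in> Y \<Longrightarrow> y' \<in> Y \<Longrightarrow>
        \<delta> \<le> cmod (u y x) \<Longrightarrow> \<delta> \<le> cmod (u y' x') \<Longrightarrow> dX x x' \<le> r \<Longrightarrow> dY y y' \<le> R"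
      using U_coarse by blast
    have "dY (F x) (F x') \<le> 2 * M + \<bar>R\<bar>" if x: "x \<in> X" "x' \<in> X" "dX x x' \<le> r" for x x'
    proof -
      have "dY (F x) (F x') \<le> dY (F x) (f x) + dY (f x) (f x') + dY (F x') (f x')"
        using x FY f(1) by (intro tri4) auto
      moreover have "dY (f x) (f x') \<le> R" using R x f by blast
      moreover have "dY (F x) (f x) \<le> M" "dY (F x') (f x') \<le> M"
        using near x by (auto simp: Metric_space.commute[OF assms(2), of "F _"])
      ultimately show ?thesis by linarith
    qed
    then show "\<exists>s>0. \<forall>x\<in>X. \<forall>x'\<in>X. dX x x' \<le> r \<longrightarrow> dY (F x) (F x') \<le> s"
      using M by (intro exI[of _ "2 * M + \<bar>R\<bar>"]) auto
  qed
  let ?G = "inv_into X F"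
  have GX: "?G y \<in> X" and FG: "F (?G y) = y" if "y \<in> Y" for y
    using F(1) that by (auto simp: bij_betw_def inv_into_into f_inv_into_f)
  have GF: "?G (F x) = x" if "x \<in> X" for x
    using F(1) that by (simp add: bij_betw_def)
  have coarse_G: "coarse_map Y dY dX ?G"
    unfolding coarse_map_def
  proof (intro allI impI)
    fix r :: real assume r: "0 < r"
    \<comment> \<open>Passing from \<open>y\<close> to \<open>f (?G y)\<close> moves each end by at
      most \<open>M\<close>, so the radius grows by \<open>2 * M\<close>.\<close>
    then have "0 < r + 2 * M" using M by simp
    then obtain R where R: "\<And>x x' y y'. x \<in> X \<Longrightarrow> x' \<in> X \<Longrightarrow> y \<in> Y \<Longrightarrow> y' \<in> Y \<Longrightarrow>
        \<delta> \<le> cmod (u y x) \<Longrightarrow> \<delta> \<le> cmod (u y' x') \<Longrightarrow> dY y y' \<le> r + 2 * M \<Longrightarrow> dX x x' \<le> R"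
      using V_coarse by blast
    have "dX (?G y) (?G y') \<le> \<bar>R\<bar> + 1" if y: "y \<in> Y" "y' \<in> Y" "dY y y' \<le> r" for y y'
    proof -
      let ?x = "?G y" and ?x' = "?G y'"
      have x: "?x \<in> X" "?x' \<in> X" using GX y by auto
      have "dY (f ?x) (f ?x') \<le> dY (f ?x) y + dY y y' + dY (f ?x') y'"
        using x y f(1) by (intro tri4) auto
      moreover have "dY (f ?x) y \<le> M" "dY (f ?x') y' \<le> M"
        using near[OF x(1)] near[OF x(2)] FG y by auto
      ultimately have "dY (f ?x) (f ?x') \<le> r + 2 * M" using y(3) by linarith
      then have "dX ?x ?x' \<le> R" using R x f by blast
      then show ?thesis by linarith
    qed
    then show "\<exists>s>0. \<forall>y\<in>Y. \<forall>y'\<in>Y. dY y y' \<le> r \<longrightarrow> dX (?G y) (?G y') \<le> s"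
      by (intro exI[of _ "\<bar>R\<bar> + 1"]) auto
  qed
  have "close_maps Y dY (F \<circ> ?G) id"
    unfolding close_maps_def using FG Metric_space.mdist_zero[OF assms(2)] by (intro exI[of _ 0]) auto
  moreover have "close_maps X dX (?G \<circ> F) id"
    unfolding close_maps_def using GF Metric_space.mdist_zero[OF assms(1)] by (intro exI[of _ 0]) auto
  ultimately have "coarse_equivalence X dX Y dY F"
    unfolding coarse_equivalence_def using coarse_F coarse_G FY GX by blast
  then show ?thesis unfolding bij_coarsely_equivalent_def using F(1) by blast
qed

end
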